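(* Let $T>0$, $0<\beta,\delta\le 1$, $\alpha_0:=\min\{\tfrac12,\beta,\tfrac{\delta}{1+\delta}\}$ and $0<\alpha<\alpha_0$. Let $\sigma:[0,T]^2\times\mathbb{R}^d\to\mathbb{R}^{d\times m}$ be bounded and satisfy hypothesis (H1) with these exponents $\beta,\delta$ and with $\mu=1$, and let $b:[0,T]^2\times\mathbb{R}^d\to\mathbb{R}^d$ be of class $\mathcal B_0(1,1/\alpha)$. Let $h:[0,T]^2\times\mathbb{R}^d\to\mathbb{R}^{d\times d}$ be measurable, bounded and Lipschitz continuous with respect to its first variable $t$; let $f=(f^{i,k,\ell}):[0,T]^2\times\mathbb{R}^d\to\mathbb{R}^{d\times d\times m}$ be bounded and satisfy hypothesis (H1); let $w\in C^{1-\alpha}(0,T;\mathbb{R}^d)$ be Lipschitz continuous and bounded. Let $x_0\in\mathbb{R}^d$, $g\in W_2^{1-\alpha}(0,T;\mathbb{R}^m)$, and consider on $[0,T]$ the system $$x_t=x_0+\int_0^t b(t,r,x_r)\,dr+\int_0^t\sigma(t,r,x_r)\,dg_r,$$ $$z_t=w_t+\int_0^t h(t,r,x_r)z_r\,dr+\int_0^t f(t,r,x_r)z_r\,dg_r,$$ where $x\in C^{1-\alpha}(0,T;\mathbb{R}^d)$ is the unique solution of the first equation. Then there exists a unique solution $z\in C^{1-\alpha}(0,T;\mathbb{R}^d)$ of the second equation. Moreover, there exists a constant $C_{\alpha,\beta}>0$ such that $$\|z\|_\infty\le 2(1+\|w\|_\infty)\exp\left(T\left(K^{(5)}_{T,\alpha}+K^{(6)}_{T,\alpha,\beta}\|g\|_{1-\alpha}\right)^{1/(1-\alpha)}\vee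 1\vee T\right),$$ where $K^{(5)}_{T,\alpha}=16\left(K+\|h\|_\infty+L+L_0+B_{0,\alpha}\right)e^T(T+1)$ and $K^{(6)}_{T,\alpha,\beta}=C_{\alpha,\beta}\left(\|f\|_\infty+\|\sigma\|_\infty+1\right)e^T(T+1)$. Here $L_0,b_0$ are as in the definition of class $\mathcal B_0(1,1/\alpha)$ for $b$, $B_{0,\alpha}:=\sup_{t\in[0,T]}\left(\int_0^t|b_0(t,u)|^{1/\alpha}du\right)^{\alpha}$, $K$ is a constant which serves as Lipschitz constant of $w$ and as the constant $K$ in (H1) for $\sigma$ and $f$, and $L$ is a constant which serves both as Lipschitz constant of $h$ in $t$ and as the constant $L$ in the definition of class $\mathcal B_0(1,1/\alpha)$ for $b$.
   Context: Norms and spaces. For $0<\lambda\le1$, $C^\lambda(0,T;\mathbb{R}^d)$ is the space of $\lambda$-Hölder functions $f:[0,T]\to\mathbb{R}^d$ with norm $\|f\|_\lambda=\|f\|_\infty+\sup_{0\le s<t\le T}\frac{|f(t)-f(s)|}{|t-s|^\lambda}$, $\|f\|_\infty=\sup_{[0,T]}|f|$. For $\alpha\in(0,\frac12)$, $W_2^{1-\alpha}(0,T;\mathbb{R}^m)$ is the space of measurable $g:[0,T]\to\mathbb{R}^m$ with $\|g\|_{1-\alpha,2}:=\sup_{0\le s<t\le T}\left(\frac{|g(t)-g(s)|}{|t-s|^{1-\alpha}}+\int_s^t\frac{|g(y)-g(s)|}{|y-s|^{2-\alpha}}dy\right)<\infty$; it is contained in $C^{1-\alpha}(0,T;\mathbb{R}^m)$.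 $\|\sigma\|_\infty,\|f\|_\infty,\|h\|_\infty$ are suprema over $[0,T]^2\times\mathbb{R}^d$; $a\vee b=\max(a,b)$. $C_{\alpha,\beta}$ denotes a generic constant indexed by $\alpha$ and $\beta$. The $i$-th component of $\int_0^t f(t,r,x_r)z_r\,dg_r$ is $\sum_{k=1}^d\sum_{\ell=1}^m\int_0^t f^{i,k,\ell}(t,r,x_r)z^k_r\,dg^\ell_r$. Integral. Integrals with respect to $g$ are Riemann–Stieltjes (Young) integrals; equivalently $\int_a^b f\,dg=(-1)^\alpha\int_a^b D_{a+}^\alpha f(t)\,D_{b-}^{1-\alpha}g_{b-}(t)\,dt$ with $g_{b-}(t)=g(t)-g(b)$, where $D_{a+}^{\alpha}f(t)=\frac{1}{\Gamma(1-\alpha)}\left(\frac{f(t)}{(t-a)^\alpha}+\alpha\int_a^t\frac{f(t)-f(s)}{(t-s)^{\alpha+1}}ds\right)$ and $D_{b-}^{\alpha}f(t)=\frac{(-1)^\alpha}{\Gamma(1-\alpha)}\left(\frac{f(t)}{(b-t)^\alpha}+\alpha\int_t^b\frac{f(t)-f(s)}{(s-t)^{\alpha+1}}ds\right)$. Hypothesis (H1), for a function $\sigma(t,s,x)$ on $[0,T]^2\times\mathbb{R}^d$ with values in a finite-dimensional Euclidean space: $\sigma$ is measurable, the derivatives $\partial_x\sigma,\partial_t\sigma,\partial^2_{x,t}\sigma$ exist, and there exist some constants $0<\beta,\mu,\delta\le1$, $K>0$ and, for every $N\ge0$, $K_N>0$ such that for all $s,t,s_1,s_2,t_1,t_2\in[0,T]$,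 $i=1,\dots,d$: (1) $|\sigma(t,s,x)-\sigma(t,s,y)|+|\partial_t\sigma(t,s,x)-\partial_t\sigma(t,s,y)|\le K|x-y|$ for all $x,y\in\mathbb{R}^d$; (2) $|\partial_{x_i}\sigma(t,s,x)-\partial_{x_i}\sigma(t,s,y)|+|\partial^2_{x_i,t}\sigma(t,s,x)-\partial^2_{x_i,t}\sigma(t,s,y)|\le K_N|x-y|^\delta$ for all $|x|,|y|\le N$; (3) $|\sigma(t_1,s,x)-\sigma(t_2,s,x)|+|\partial_{x_i}\sigma(t_1,s,x)-\partial_{x_i}\sigma(t_2,s,x)|\le K|t_1-t_2|^\mu$ for all $x$; (4) $|\sigma(t,s_1,x)-\sigma(t,s_2,x)|+|\partial_t\sigma(t,s_1,x)-\partial_t\sigma(t,s_2,x)|\le K|s_1-s_2|^\beta$ for all $x$; (5) $|\partial^2_{x_i,t}\sigma(t,s_1,x)-\partial^2_{x_i,t}\sigma(t,s_2,x)|+|\partial_{x_i}\sigma(t,s_1,x)-\partial_{x_i}\sigma(t,s_2,x)|\le K|s_1-s_2|^\beta$ for all $x$. Class $\mathcal B_0(\mu,\rho)$, $0<\mu\le1$, $\rho\ge2$: measurable functions $b(t,s,x)$ on $[0,T]^2\times\mathbb{R}^d$ for which there are $b_0\in L^\rho([0,T]^2)$, constants $L,L_0>0$ and, for every $N\ge 0$, $L_N>0$ such that for all $s,t,t_1,t_2\in[0,T]$: (1) $|b(t,s,x)-b(t,s,y)|\le L_N|x-y|$ for $|x|,|y|\le N$; (2) $|b(t_1,s,x)-b(t_2,s,x)|\le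 L|t_1-t_2|^\mu$ for all $x$; (3) $|b(t,s,x)|\le L_0+b_0(t,s)$ for all $x$; (4) $|b(t_1,s,x_1)-b(t_1,s,x_2)-b(t_2,s,x_1)+b(t_2,s,x_2)|\le L_N|t_1-t_2||x_1-x_2|$ for $|x_1|,|x_2|\le N$. Existence and uniqueness of $x\in C^{1-\alpha}(0,T;\mathbb{R}^d)$ under these hypotheses is a known theorem.
   Formalization: The constant C may depend on K (and on d, m) besides α and β, since the bound fails with C depending on α, β only (σ=(1,0), f=(0, sin nx), K=n, rapidly rotating g); the bound is stated when B_{0,α} is finite, and f satisfies (H1) with the same β, δ, μ=1 as σ. *)

theory Defs
  imports "HOL-Analysis.Analysis"
begin

text \<open>
  Functions on \<open>[0,T]\<close> or \<open>[0,T]\<^sup>2 \<times> \<real>\<^sup>d\<close> are total HOL functions of which only the values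
  with times in \<open>{0..T}\<close> matter. The norm of \<open>real ^ 'm ^ 'd\<close> is the Euclidean norm of all entries.
\<close>

definition sup_norm :: "real \<Rightarrow> (real \<Rightarrow> 'a::real_normed_vector) \<Rightarrow> real" where
  "sup_norm T f = (SUP t\<in>{0..T}. norm (f t))"

definition sup_norm3 :: "real \<Rightarrow> (real \<Rightarrow> real \<Rightarrow> 'x \<Rightarrow> 'a::real_normed_vector) \<Rightarrow> real" where
  "sup_norm3 T \<phi> = (SUP (t, s, x)\<in>{0..T} \<times> {0..T} \<times> UNIV. norm (\<phi> t s x))"

definition bounded3 :: "real \<Rightarrow> (real \<Rightarrow> real \<Rightarrow> 'x \<Rightarrow> 'a::real_normed_vector) \<Rightarrow> bool" where
  "bounded3 T \<phi> \<longleftrightarrow> bounded ((\<lambda>(t, s, x). \<phi> t s x) ` ({0..T} \<times> {0..T} \<times> UNIV))"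

definition measurable3 ::
    "real \<Rightarrow> (real \<Rightarrow> real \<Rightarrow> 'x::euclidean_space \<Rightarrow> 'a::euclidean_space) \<Rightarrow> bool" where
  "measurable3 T \<phi> \<longleftrightarrow>
     (\<lambda>(t, s, x). \<phi> t s x) \<in> borel_measurable (restrict_space borel ({0..T} \<times> {0..T} \<times> UNIV))"


definition hoelder_quotients :: "real \<Rightarrow> real \<Rightarrow> (real \<Rightarrow> 'a::real_normed_vector) \<Rightarrow> real set" where
  "hoelder_quotients \<gamma> T f =
     {norm (f t - f s) / \<bar>t - s\<bar> powr \<gamma> | s t. 0 \<le> s \<and> s < t \<and> t \<le> T}"

definition hoelder_space :: "real \<Rightarrow> real \<Rightarrow> (real \<Rightarrow> 'a::real_normed_vector) set" where
  "hoelder_space \<gamma> T = {f. bounded (f ` {0..T}) \<and> bdd_above (hoelder_quotients \<gamma> T f)}"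

definition hoelder_norm :: "real \<Rightarrow> real \<Rightarrow> (real \<Rightarrow> 'a::real_normed_vector) \<Rightarrow> real" where
  "hoelder_norm \<gamma> T f = sup_norm T f + Sup (hoelder_quotients \<gamma> T f)"

text \<open>\<open>W2_norm \<alpha> T g\<close> is the quantity \<open>\<parallel>g\<parallel>\<close> with index \<open>(1 - \<alpha>, 2)\<close>, possibly infinite.\<close>

definition W2_norm :: "real \<Rightarrow> real \<Rightarrow> (real \<Rightarrow> 'a::euclidean_space) \<Rightarrow> ennreal" where
  "W2_norm \<alpha> T g =
     (SUP (s, t)\<in>{(s, t). 0 \<le> s \<and> s < t \<and> t \<le> T}.
        ennreal (norm (g t - g s) / \<bar>t - s\<bar> powr (1 - \<alpha>)) +
        (\<integral>\<^sup>+y\<in>{s..t}. ennreal (norm (g y - g s) / \<bar>y - s\<bar> powr (2 - \<alpha>)) \<partial>lborel))"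

definition W2_space :: "real \<Rightarrow> real \<Rightarrow> (real \<Rightarrow> 'a::euclidean_space) set" where
  "W2_space \<alpha> T =
     {g. g \<in> borel_measurable (restrict_space borel {0..T}) \<and> W2_norm \<alpha> T g < top}"


text \<open>
  Riemann--Stieltjes integral of \<open>f\<close> with respect to \<open>g\<close> as the limit of the sums of
  \<open>f \<xi> * (g v - g u)\<close> over tagged partitions as the mesh tends to \<open>0\<close>. The gauge is
  constant, so this is the Riemann and not the Henstock--Kurzweil notion: fineness with respect to
  balls of constant radius is, up to a factor \<open>2\<close>, a bound on the mesh.
\<close>

definition has_RS_integral ::
    "(real \<Rightarrow> real) \<Rightarrow> (real \<Rightarrow> real) \<Rightarrow> real \<Rightarrow> real \<Rightarrow> real \<Rightarrow> bool" where
  "has_RS_integral f g a b I \<longleftrightarrow>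
     (\<forall>\<epsilon>>0. \<exists>\<eta>>0. \<forall>p. p tagged_division_of {a..b} \<and> (\<lambda>\<xi>. ball \<xi> \<eta>) fine p \<longrightarrow>
        \<bar>(\<Sum>(\<xi>, J)\<in>p. f \<xi> * (g (Sup J) - g (Inf J))) - I\<bar> < \<epsilon>)"

definition RS_integrable :: "(real \<Rightarrow> real) \<Rightarrow> (real \<Rightarrow> real) \<Rightarrow> real \<Rightarrow> real \<Rightarrow> bool" where
  "RS_integrable f g a b \<longleftrightarrow> (\<exists>I. has_RS_integral f g a b I)"

definition RS_integral :: "(real \<Rightarrow> real) \<Rightarrow> (real \<Rightarrow> real) \<Rightarrow> real \<Rightarrow> real \<Rightarrow> real" where
  "RS_integral f g a b = (THE I. has_RS_integral f g a b I)"


text \<open>Partial derivatives; the one in \<open>t\<close> is one-sided at the endpoints of \<open>{0..T}\<close>.\<close>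

definition partial_t ::
    "real \<Rightarrow> (real \<Rightarrow> real \<Rightarrow> 'x \<Rightarrow> 'e::real_normed_vector) \<Rightarrow> real \<Rightarrow> real \<Rightarrow> 'x \<Rightarrow> 'e" where
  "partial_t T \<phi> t s x = vector_derivative (\<lambda>\<tau>. \<phi> \<tau> s x) (at t within {0..T})"

definition partial_x ::
    "'d::finite \<Rightarrow> (real \<Rightarrow> real \<Rightarrow> real ^ 'd \<Rightarrow> 'e::real_normed_vector)
       \<Rightarrow> real \<Rightarrow> real \<Rightarrow> real ^ 'd \<Rightarrow> 'e" where
  "partial_x i \<phi> t s x = vector_derivative (\<lambda>u. \<phi> t s (x + u *\<^sub>R axis i 1)) (at 0)"

definition has_partial_t ::
    "real \<Rightarrow> (real \<Rightarrow> real \<Rightarrow> 'x \<Rightarrow> 'e::real_normed_vector) \<Rightarrow> bool" where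
  "has_partial_t T \<phi> \<longleftrightarrow>
     (\<forall>t\<in>{0..T}. \<forall>s\<in>{0..T}. \<forall>x. (\<lambda>\<tau>. \<phi> \<tau> s x) differentiable (at t within {0..T}))"

definition has_partial_x ::
    "real \<Rightarrow> (real \<Rightarrow> real \<Rightarrow> real ^ 'd::finite \<Rightarrow> 'e::real_normed_vector) \<Rightarrow> bool" where
  "has_partial_x T \<phi> \<longleftrightarrow>
     (\<forall>i. \<forall>t\<in>{0..T}. \<forall>s\<in>{0..T}. \<forall>x. (\<lambda>u. \<phi> t s (x + u *\<^sub>R axis i 1)) differentiable (at 0))"

text \<open>
  Hypothesis (H1) with the given exponents and the given constant \<open>K\<close>. The mixed derivative is
  \<open>partial_x i (partial_t T \<sigma>)\<close>.
\<close>

definition H1 ::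
    "real \<Rightarrow> real \<Rightarrow> real \<Rightarrow> real \<Rightarrow> real
       \<Rightarrow> (real \<Rightarrow> real \<Rightarrow> real ^ 'd::finite \<Rightarrow> 'e::euclidean_space) \<Rightarrow> bool" where
  "H1 T \<beta> \<mu> \<delta> K \<sigma> \<longleftrightarrow>
     0 < \<beta> \<and> \<beta> \<le> 1 \<and> 0 < \<mu> \<and> \<mu> \<le> 1 \<and> 0 < \<delta> \<and> \<delta> \<le> 1 \<and> 0 < K \<and>
     measurable3 T \<sigma> \<and>
     has_partial_x T \<sigma> \<and> has_partial_t T \<sigma> \<and> has_partial_x T (partial_t T \<sigma>) \<and>
     (\<forall>t\<in>{0..T}. \<forall>s\<in>{0..T}. \<forall>x y.
        norm (\<sigma> t s x - \<sigma> t s y) + norm (partial_t T \<sigma> t s x - partial_t T \<sigma> t s y)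
          \<le> K * norm (x - y)) \<and>
     (\<forall>N\<ge>0. \<exists>KN>0. \<forall>t\<in>{0..T}. \<forall>s\<in>{0..T}. \<forall>i x y. norm x \<le> N \<and> norm y \<le> N \<longrightarrow>
        norm (partial_x i \<sigma> t s x - partial_x i \<sigma> t s y) +
        norm (partial_x i (partial_t T \<sigma>) t s x - partial_x i (partial_t T \<sigma>) t s y)
          \<le> KN * norm (x - y) powr \<delta>) \<and>
     (\<forall>t1\<in>{0..T}. \<forall>t2\<in>{0..T}. \<forall>s\<in>{0..T}. \<forall>i x.
        norm (\<sigma> t1 s x - \<sigma> t2 s x) + norm (partial_x i \<sigma> t1 s x - partial_x i \<sigma> t2 s x)
          \<le> K * \<bar>t1 - t2\<bar> powr \<mu>) \<and>
     (\<forall>t\<in>{0..T}. \<forall>s1\<in>{0..T}. \<forall>s2\<in>{0..T}. \<forall>x.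
        norm (\<sigma> t s1 x - \<sigma> t s2 x) + norm (partial_t T \<sigma> t s1 x - partial_t T \<sigma> t s2 x)
          \<le> K * \<bar>s1 - s2\<bar> powr \<beta>) \<and>
     (\<forall>t\<in>{0..T}. \<forall>s1\<in>{0..T}. \<forall>s2\<in>{0..T}. \<forall>i x.
        norm (partial_x i (partial_t T \<sigma>) t s1 x - partial_x i (partial_t T \<sigma>) t s2 x) +
        norm (partial_x i \<sigma> t s1 x - partial_x i \<sigma> t s2 x)
          \<le> K * \<bar>s1 - s2\<bar> powr \<beta>)"

text \<open>\<open>b\<close> is of class \<open>\<B>\<^sub>0(\<mu>,\<rho>)\<close> with the given \<open>b0\<close>, \<open>L\<close> and \<open>L0\<close>.\<close>

definition class_B0 ::
    "real \<Rightarrow> real \<Rightarrow> real \<Rightarrow> (real \<Rightarrow> real \<Rightarrow> real) \<Rightarrow> real \<Rightarrow> real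
       \<Rightarrow> (real \<Rightarrow> real \<Rightarrow> 'x::euclidean_space \<Rightarrow> 'e::euclidean_space) \<Rightarrow> bool" where
  "class_B0 T \<mu> \<rho> b0 L L0 b \<longleftrightarrow>
     0 < \<mu> \<and> \<mu> \<le> 1 \<and> 2 \<le> \<rho> \<and> 0 < L \<and> 0 < L0 \<and>
     measurable3 T b \<and>
     (\<lambda>(t, s). b0 t s) \<in> borel_measurable (restrict_space borel ({0..T} \<times> {0..T})) \<and>
     set_integrable lborel ({0..T} \<times> {0..T}) (\<lambda>(t, s). \<bar>b0 t s\<bar> powr \<rho>) \<and>
     (\<forall>N\<ge>0. \<exists>LN>0.
        (\<forall>t\<in>{0..T}. \<forall>s\<in>{0..T}. \<forall>x y. norm x \<le> N \<and> norm y \<le> N \<longrightarrow>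
           norm (b t s x - b t s y) \<le> LN * norm (x - y)) \<and>
        (\<forall>t1\<in>{0..T}. \<forall>t2\<in>{0..T}. \<forall>s\<in>{0..T}. \<forall>x1 x2. norm x1 \<le> N \<and> norm x2 \<le> N \<longrightarrow>
           norm (b t1 s x1 - b t1 s x2 - b t2 s x1 + b t2 s x2)
             \<le> LN * \<bar>t1 - t2\<bar> * norm (x1 - x2))) \<and>
     (\<forall>t1\<in>{0..T}. \<forall>t2\<in>{0..T}. \<forall>s\<in>{0..T}. \<forall>x.
        norm (b t1 s x - b t2 s x) \<le> L * \<bar>t1 - t2\<bar> powr \<mu>) \<and>
     (\<forall>t\<in>{0..T}. \<forall>s\<in>{0..T}. \<forall>x. norm (b t s x) \<le> L0 + b0 t s)"

text \<open>
  The constant \<open>B\<close> with index \<open>0,\<alpha>\<close>. Membership of \<open>b0\<close> in \<open>L\<^sup>\<rho>\<close> of the square does not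
  make the supremum finite; \<open>B_const_finite\<close> says that it is, and \<open>B_const\<close> is its value then.
\<close>

definition B_const :: "real \<Rightarrow> real \<Rightarrow> (real \<Rightarrow> real \<Rightarrow> real) \<Rightarrow> real" where
  "B_const T \<alpha> b0 = (SUP t\<in>{0..T}. (LINT u:{0..t}|lborel. \<bar>b0 t u\<bar> powr (1 / \<alpha>)) powr \<alpha>)"

definition B_const_finite :: "real \<Rightarrow> real \<Rightarrow> (real \<Rightarrow> real \<Rightarrow> real) \<Rightarrow> bool" where
  "B_const_finite T \<alpha> b0 \<longleftrightarrow>
     (\<forall>t\<in>{0..T}. set_integrable lborel {0..t} (\<lambda>u. \<bar>b0 t u\<bar> powr (1 / \<alpha>))) \<and>
     bdd_above ((\<lambda>t. (LINT u:{0..t}|lborel. \<bar>b0 t u\<bar> powr (1 / \<alpha>)) powr \<alpha>) ` {0..T})"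


text \<open>
  The equations on \<open>[0,T]\<close>, integrals with respect to \<open>g\<close> being taken component by component.
  That all integrals exist is part of being a solution.
\<close>

definition solves_x ::
    "real \<Rightarrow> (real \<Rightarrow> real \<Rightarrow> real ^ 'd \<Rightarrow> real ^ 'd)
       \<Rightarrow> (real \<Rightarrow> real \<Rightarrow> real ^ 'd \<Rightarrow> real ^ 'm ^ 'd)
       \<Rightarrow> (real \<Rightarrow> real ^ 'm) \<Rightarrow> real ^ 'd \<Rightarrow> (real \<Rightarrow> real ^ 'd) \<Rightarrow> bool" where
  "solves_x T b \<sigma> g x0 x \<longleftrightarrow>
     (\<forall>t\<in>{0..T}.
        set_integrable lborel {0..t} (\<lambda>r. b t r (x r)) \<and>
        (\<forall>i l. RS_integrable (\<lambda>r. \<sigma> t r (x r) $ i $ l) (\<lambda>r. g r $ l) 0 t) \<and>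
        x t = x0 + (LINT r:{0..t}|lborel. b t r (x r)) +
          (\<chi> i. \<Sum>l\<in>UNIV. RS_integral (\<lambda>r. \<sigma> t r (x r) $ i $ l) (\<lambda>r. g r $ l) 0 t))"

definition solves_z ::
    "real \<Rightarrow> (real \<Rightarrow> real \<Rightarrow> real ^ 'd \<Rightarrow> real ^ 'd ^ 'd)
       \<Rightarrow> (real \<Rightarrow> real \<Rightarrow> real ^ 'd \<Rightarrow> real ^ 'm ^ 'd ^ 'd)
       \<Rightarrow> (real \<Rightarrow> real ^ 'm) \<Rightarrow> (real \<Rightarrow> real ^ 'd) \<Rightarrow> (real \<Rightarrow> real ^ 'd)
       \<Rightarrow> (real \<Rightarrow> real ^ 'd) \<Rightarrow> bool" where
  "solves_z T h f g w x z \<longleftrightarrow>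
     (\<forall>t\<in>{0..T}.
        set_integrable lborel {0..t} (\<lambda>r. h t r (x r) *v z r) \<and>
        (\<forall>i k l. RS_integrable (\<lambda>r. f t r (x r) $ i $ k $ l * z r $ k) (\<lambda>r. g r $ l) 0 t) \<and>
        z t = w t + (LINT r:{0..t}|lborel. h t r (x r) *v z r) +
          (\<chi> i. \<Sum>k\<in>UNIV. \<Sum>l\<in>UNIV.
             RS_integral (\<lambda>r. f t r (x r) $ i $ k $ l * z r $ k) (\<lambda>r. g r $ l) 0 t))"

end

theory Submission
  imports Defs
begin

text \<open>
  Fix a scale \<open>1 / \<Lambda>\<close> and control a path \<open>u\<close> by \<open>B * exp (\<Lambda> * t)\<close> in supremum norm and by
  \<open>B * exp (\<Lambda> * t) * (\<Lambda> * (t - s)) powr (1 - \<alpha>)\<close> for increments over distances at most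
  \<open>1 / \<Lambda>\<close>. If the increments of \<open>x\<close> at this scale are at most
  \<open>(\<Lambda> * (t - s)) powr (1 - \<alpha>)\<close> and \<open>\<Lambda> powr (1 - \<alpha>)\<close> dominates the data, then the linear
  Volterra operator of the second equation halves \<open>B\<close>. The local part of an increment is
  estimated by the Young inequality; the memory part, in which the kernel and not the interval of
  integration changes, by cutting \<open>[0,s]\<close> into about \<open>\<Lambda> * s\<close> pieces and using the
  \<open>t\<close>-derivative of the kernel. Contraction gives existence and uniqueness for any large
  \<open>\<Lambda>\<close>, and the bound \<open>2 * (1 + \<parallel>w\<parallel>) * exp (\<Lambda> * T)\<close> when \<open>\<Lambda>\<close> is taken to be
  \<open>max 1 ((K5 + K6 * \<parallel>g\<parallel>) powr (1 / (1 - \<alpha>)))\<close>. For this \<open>\<Lambda>\<close> the same estimates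
  applied to the first equation, with the constant of \<open>b0\<close> finite, give the required
  bound on \<open>x\<close>.
\<close>

text \<open>At the scale \<open>1 / \<Lambda>\<close> the oscillation and the supremum of a path
  have the same size, so products and changes of exponent cost no power of \<open>\<Lambda>\<close>.
  Hence \<open>\<Lambda> powr (1 - \<alpha>)\<close> has to dominate the data only linearly, which
  is the origin of the exponent \<open>1 / (1 - \<alpha>)\<close>. The exponential weight absorbs
  the history: over a time \<open>1 / \<Lambda>\<close> it grows by \<open>exp 1 \<ge> 2\<close>.
  Kernels along \<open>x\<close> have the exponent \<open>min \<beta> (1 - \<alpha>)\<close>; its
  sum with \<open>1 - \<alpha>\<close> exceeds 1 because \<open>\<alpha> < \<beta>\<close> and
  \<open>\<alpha> < 1 / 2\<close>. The obstacle is the memory part: one Young estimate on all of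
  \<open>[0,s]\<close> leaves \<open>\<Lambda> powr (min \<beta> (1 - \<alpha>))\<close>, too much,
  whereas the short pieces together leave \<open>\<Lambda> powr \<alpha>\<close>, which the factor
  \<open>t - s\<close> in the kernel increment compensates. Existence may use a scale depending on
  the Hoelder constant of \<open>x\<close>, but the bound needs one given by the data;
  \<open>z\<close> is carried from one scale to the other through the Hoelder space.\<close>

definition hoelder_on :: "real \<Rightarrow> real \<Rightarrow> real set \<Rightarrow> (real \<Rightarrow> 'a::real_normed_vector) \<Rightarrow> bool" where
  "hoelder_on \<gamma> c S p \<longleftrightarrow> (\<forall>s\<in>S. \<forall>t\<in>S. norm (p t - p s) \<le> c * \<bar>t - s\<bar> powr \<gamma>)"

lemma hoelder_onD: "hoelder_on \<gamma> c S p \<Longrightarrow> s \<in> S \<Longrightarrow> t \<in> S \<Longrightarrow> norm (p t - p s) \<le> c * \<bar>t - s\<bar> powr \<gamma>"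
  by (auto simp: hoelder_on_def)

lemma hoelder_on_subset: "hoelder_on \<gamma> c S p \<Longrightarrow> S' \<subseteq> S \<Longrightarrow> hoelder_on \<gamma> c S' p"
  by (auto simp: hoelder_on_def)

subsection \<open>The Young integral\<close>

lemma sum_lessThan_double:
  fixes A :: "nat \<Rightarrow> 'a::comm_monoid_add"
  shows "(\<Sum>k<2 * m. A k) = (\<Sum>k<m. A (2 * k) + A (2 * k + 1))"
  by (induction m) (auto simp: algebra_simps)

text \<open>All cells strictly between the first and the last one that meet \<open>(u,v)\<close> lie
  inside it, which bounds their number by \<open>(v - u) / h\<close>; the summand 2 is for the two
  extreme cells. This allows \<open>u\<close> and \<open>v\<close> that are not grid points.\<close>

lemma card_cells_le:
  fixes a h u v :: real
  assumes "0 < h" "u \<le> v"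
  shows "real (card {k. k < N \<and> a + real k * h < v \<and> u < a + (real k + 1) * h}) \<le> (v - u) / h + 2"
    (is "real (card ?A) \<le> _")
proof (cases "?A = {}")
  case False
  have fin: "finite ?A" by auto
  have sub: "?A \<subseteq> {Min ?A..Max ?A}" using fin by auto
  have le: "Min ?A \<le> Max ?A" using Min_in[OF fin False] Max_ge[OF fin] by blast
  have "real (card ?A) \<le> real (Max ?A) - real (Min ?A) + 1"
    using card_mono[OF _ sub] le by (simp add: of_nat_diff)
  moreover have "a + real (Max ?A) * h < v" using Max_in[OF fin False] by blast
  moreover have "u < a + (real (Min ?A) + 1) * h" using Min_in[OF fin False] by blast
  ultimately have "(real (card ?A) - 2) * h \<le> (real (Max ?A) - real (Min ?A) - 1) * h"
    using assms by (intro mult_right_mono) auto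
  also have "\<dots> \<le> v - u"
    using \<open>a + real (Max ?A) * h < v\<close> \<open>u < a + (real (Min ?A) + 1) * h\<close> by (simp add: algebra_simps)
  finally show ?thesis using assms by (simp add: field_simps)
next
  case True
  have "real (card ?A) = 0" by (simp only: True card.empty of_nat_0)
  moreover have "0 \<le> (v - u) / h" using assms by simp
  ultimately show ?thesis by linarith
qed

text \<open>The constant of the Young inequality with \<open>\<theta>\<close> the sum of both
  exponents. The 3 counts the cells that meet \<open>[u,v]\<close> when the mesh is comparable to
  \<open>v - u\<close>; the quotient sums the corrections of all finer levels, a geometric series of
  ratio \<open>2 powr (1 - \<theta>)\<close>; the factor in front is there because that mesh may be
  as large as \<open>2 * (v - u)\<close>.\<close>

definition young_const :: "real \<Rightarrow> real" where
  "young_const \<theta> = 2 powr \<theta> * (3 + 5 / (1 - 2 powr (1 - \<theta>)))"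

lemma young_const_ge_0: "1 < \<theta> \<Longrightarrow> 0 \<le> young_const \<theta>"
proof -
  assume "1 < \<theta>"
  then have "2 powr (1 - \<theta>) < 2 powr 0" by (intro powr_less_mono) auto
  then show ?thesis by (simp add: young_const_def)
qed

locale young_pair =
  fixes f g :: "real \<Rightarrow> real" and a b \<gamma> \<kappa> F G :: real
  assumes ab: "a < b" and \<gamma>: "0 < \<gamma>" and \<kappa>: "0 < \<kappa>" and sum_gt_1: "1 < \<gamma> + \<kappa>"
    and F: "0 \<le> F" and G: "0 \<le> G"
    and f_hoelder: "hoelder_on \<gamma> F {a..b} f" and g_hoelder: "hoelder_on \<kappa> G {a..b} g"
begin

definition mesh :: "nat \<Rightarrow> real" where "mesh n = (b - a) / 2 ^ n"

definition node :: "nat \<Rightarrow> nat \<Rightarrow> real" where "node n k = a + real k * mesh n"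

text \<open>
  Stopping the integrator at \<open>t\<close>, instead of refining \<open>[a,t]\<close>, makes the sums additive in
  \<open>t\<close>, so that additivity of the limit needs no argument.
\<close>

definition dyadic_sum :: "nat \<Rightarrow> real \<Rightarrow> real" where
  "dyadic_sum n t = (\<Sum>k<2 ^ n. f (node n k) * (g (min t (node n (Suc k))) - g (min t (node n k))))"

definition young_primitive :: "real \<Rightarrow> real" where
  "young_primitive t = lim (\<lambda>n. dyadic_sum n t)"

lemma mesh_pos: "0 < mesh n"
  using ab by (simp add: mesh_def)

lemma mesh_Suc: "mesh (Suc n) = mesh n / 2"
  by (simp add: mesh_def)

lemma node_Suc: "node n (Suc k) = node n k + mesh n"
  by (simp add: node_def algebra_simps)

lemma node_double: "node (Suc n) (2 * k) = node n k"
  by (simp add: node_def mesh_Suc)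

lemma node_mem: "k \<le> 2 ^ n \<Longrightarrow> node n k \<in> {a..b}"
proof -
  assume "k \<le> 2 ^ n"
  then have "real k \<le> 2 ^ n" by (metis of_nat_le_iff of_nat_numeral of_nat_power)
  then have "real k * mesh n \<le> 2 ^ n * mesh n" using mesh_pos[of n] by (intro mult_right_mono) auto
  moreover have "0 \<le> real k * mesh n" using mesh_pos[of n] by simp
  moreover have "2 ^ n * mesh n = b - a" by (simp add: mesh_def)
  ultimately show ?thesis by (auto simp: node_def)
qed

abbreviation "pin u v p \<equiv> max u (min v p :: real)"

text \<open>In every position of \<open>p\<close>, \<open>g (min v p) - g (min u p)\<close> equals
  \<open>g (pin u v p) - g u\<close>, and the constant cancels in increments. So a difference of two
  stopped sums is one sum against the integrator clamped to \<open>[u,v]\<close>.\<close>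

lemma g_pin: "u \<le> v \<Longrightarrow> g (min v p) - g (min v q) - (g (min u p) - g (min u q)) = g (pin u v p) - g (pin u v q)"
  by (auto simp: min_def max_def)

lemma dyadic_sum_diff:
  assumes "u \<le> v"
  shows "dyadic_sum n v - dyadic_sum n u =
    (\<Sum>k<2 ^ n. f (node n k) * (g (pin u v (node n (Suc k))) - g (pin u v (node n k))))"
  unfolding dyadic_sum_def sum_subtractf[symmetric] right_diff_distrib[symmetric] g_pin[OF assms] ..

lemma g_pin_telescope:
  assumes "a \<le> u" "u \<le> v" "v \<le> b"
  shows "(\<Sum>k<2 ^ n. g (pin u v (node n (Suc k))) - g (pin u v (node n k))) = g v - g u"
proof -
  have "node n 0 = a" "node n (2 ^ n) = b" by (auto simp: node_def mesh_def)
  moreover have "pin u v a = u" "pin u v b = v" using assms by auto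
  ultimately show ?thesis by (subst sum_lessThan_telescope) simp
qed

text \<open>The clamped integrator is constant on cells outside \<open>(u,v)\<close>, so only the
  cells counted by \<open>card_cells_le\<close> contribute.\<close>

lemma clamped_sum_le:
  assumes "a \<le> u" "u \<le> v" "v \<le> b" "0 \<le> c"
    and A: "\<And>k. k < 2 ^ n \<Longrightarrow> node n k < v \<Longrightarrow> u < node n (Suc k) \<Longrightarrow> \<bar>A k\<bar> \<le> c"
    and A0: "\<And>k. k < 2 ^ n \<Longrightarrow> node n k \<ge> v \<or> u \<ge> node n (Suc k) \<Longrightarrow> A k = 0"
  shows "\<bar>\<Sum>k<2 ^ n. A k\<bar> \<le> ((v - u) / mesh n + 2) * c"
proof -
  define S where "S = {k. k < 2 ^ n \<and> a + real k * mesh n < v \<and> u < a + (real k + 1) * mesh n}"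
  have mem: "k \<in> S \<longleftrightarrow> k < 2 ^ n \<and> node n k < v \<and> u < node n (Suc k)" for k
    by (simp add: S_def node_def add.commute)
  have sub: "S \<subseteq> {..<2 ^ n}" by (auto simp: S_def)
  have zero: "A k = 0" if "k \<in> {..<2 ^ n} - S" for k
  proof -
    have k: "k < 2 ^ n" "k \<notin> S" using that by simp_all
    then have "node n k \<ge> v \<or> u \<ge> node n (Suc k)" unfolding mem by linarith
    with k(1) show ?thesis by (rule A0)
  qed
  have "(\<Sum>k<2 ^ n. A k) = (\<Sum>k\<in>S. A k)"
    by (rule sum.mono_neutral_right[OF finite_lessThan sub]) (use zero in blast)
  also have "\<bar>\<dots>\<bar> \<le> (\<Sum>k\<in>S. \<bar>A k\<bar>)" by (rule sum_abs)
  also have "\<dots> \<le> real (card S) * c"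
  proof (rule sum_bounded_above)
    fix k assume "k \<in> S"
    then show "\<bar>A k\<bar> \<le> c" unfolding mem by (elim conjE) (rule A)
  qed
  also have "\<dots> \<le> ((v - u) / mesh n + 2) * c"
    unfolding S_def by (rule mult_right_mono[OF card_cells_le[OF mesh_pos \<open>u \<le> v\<close>] \<open>0 \<le> c\<close>])
  finally show ?thesis .
qed

text \<open>Halving a cell alters its summand only on the right half, where the value of
  \<open>f\<close> at the node is replaced by that at the midpoint. What remains is a product of an
  increment of \<open>f\<close> and one of \<open>g\<close>, of order
  \<open>mesh n powr (\<gamma> + \<kappa>)\<close>.\<close>

lemma dyadic_sum_step:
  assumes "a \<le> u" "u \<le> v" "v \<le> b"
  shows "\<bar>(dyadic_sum (Suc n) v - dyadic_sum (Suc n) u) - (dyadic_sum n v - dyadic_sum n u)\<bar>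
    \<le> ((v - u) / mesh n + 2) * (F * G * mesh n powr (\<gamma> + \<kappa>))"
proof -
  define mid where "mid k = node (Suc n) (2 * k + 1)" for k
  have mid: "mid k = node n k + mesh n / 2" for k
    by (simp add: mid_def node_def mesh_Suc field_simps)
  define A where "A k = (f (mid k) - f (node n k)) * (g (pin u v (node n (Suc k))) - g (pin u v (mid k)))" for k
  have next_node: "node (Suc n) (Suc (2 * k)) = mid k" "node (Suc n) (Suc (2 * k + 1)) = node n (Suc k)" for k
    using node_double[of n "Suc k"] by (simp_all add: mid_def)
  have "(dyadic_sum (Suc n) v - dyadic_sum (Suc n) u) - (dyadic_sum n v - dyadic_sum n u) = (\<Sum>k<2 ^ n. A k)"
    unfolding dyadic_sum_diff[OF assms(2)] power_Suc sum_lessThan_double sum_subtractf[symmetric]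
    unfolding next_node node_double mid_def[symmetric]
    by (rule sum.cong) (simp_all add: A_def left_diff_distrib right_diff_distrib)
  also have "\<bar>\<dots>\<bar> \<le> ((v - u) / mesh n + 2) * (F * G * mesh n powr (\<gamma> + \<kappa>))"
  proof (rule clamped_sum_le[OF assms])
    show "0 \<le> F * G * mesh n powr (\<gamma> + \<kappa>)" using F G by simp
    fix k :: nat assume k: "k < 2 ^ n"
    have nodes: "node n k \<in> {a..b}" "mid k \<in> {a..b}" "node n (Suc k) \<in> {a..b}"
      using node_mem[of k n] node_mem[of "Suc k" n] k mid[of k] mesh_pos[of n]
      by (auto simp: node_Suc)
    have f1: "\<bar>f (mid k) - f (node n k)\<bar> \<le> F * mesh n powr \<gamma>"
    proof -
      have "\<bar>f (mid k) - f (node n k)\<bar> \<le> F * \<bar>mid k - node n k\<bar> powr \<gamma>"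
        using hoelder_onD[OF f_hoelder nodes(1,2)] by simp
      also have "\<dots> \<le> F * mesh n powr \<gamma>"
        using F \<gamma> mesh_pos[of n] by (intro mult_left_mono powr_mono2) (auto simp: mid)
      finally show ?thesis .
    qed
    have g1: "\<bar>g (pin u v (node n (Suc k))) - g (pin u v (mid k))\<bar> \<le> G * mesh n powr \<kappa>"
    proof -
      have "\<bar>g (pin u v (node n (Suc k))) - g (pin u v (mid k))\<bar>
          \<le> G * \<bar>pin u v (node n (Suc k)) - pin u v (mid k)\<bar> powr \<kappa>"
        using hoelder_onD[OF g_hoelder] assms by (auto simp: min_def max_def)
      also have "\<dots> \<le> G * mesh n powr \<kappa>"
        using G \<kappa> mesh_pos[of n] by (intro mult_left_mono powr_mono2) (auto simp: mid node_Suc)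
      finally show ?thesis .
    qed
    show "\<bar>A k\<bar> \<le> F * G * mesh n powr (\<gamma> + \<kappa>)"
    proof -
      have "\<bar>A k\<bar> \<le> (F * mesh n powr \<gamma>) * (G * mesh n powr \<kappa>)"
        unfolding A_def abs_mult using f1 g1 F by (intro mult_mono) auto
      then show ?thesis by (simp add: powr_add algebra_simps)
    qed
    show "A k = 0" if "node n k \<ge> v \<or> u \<ge> node n (Suc k)"
    proof -
      have "pin u v (node n (Suc k)) = pin u v (mid k)"
        using that mesh_pos[of n] assms by (auto simp: mid node_Suc min_def max_def)
      then show ?thesis by (simp add: A_def)
    qed
  qed
  finally show ?thesis .
qed

lemma mesh_powr: "mesh (n + k) powr \<rho> = mesh n powr \<rho> * (2 powr (-\<rho>)) ^ k"
proof -
  have "mesh (n + k) = mesh n * 2 powr (- real k)"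
    by (simp add: mesh_def powr_minus power_add powr_realpow divide_inverse)
  then have "mesh (n + k) powr \<rho> = mesh n powr \<rho> * (2 powr (- real k)) powr \<rho>"
    using mesh_pos[of n] by (simp add: powr_mult)
  also have "(2 powr (- real k)) powr \<rho> = (2 powr (-\<rho>)) ^ k"
    by (subst powr_realpow[symmetric]) (simp_all add: powr_powr mult.commute)
  finally show ?thesis .
qed

lemma ratio: "0 < 2 powr (1 - (\<gamma> + \<kappa>))" "2 powr (1 - (\<gamma> + \<kappa>)) < 1"
proof -
  have "2 powr (1 - (\<gamma> + \<kappa>)) < 2 powr 0" using sum_gt_1 by (intro powr_less_mono) auto
  then show "2 powr (1 - (\<gamma> + \<kappa>)) < 1" by simp
qed simp

text \<open>Once the mesh is at most \<open>2 * (v - u)\<close>, the two boundary cells are absorbed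
  into the factor 5. The number of cells costs one power of the mesh, and what is left still decays
  geometrically because \<open>\<gamma> + \<kappa> > 1\<close>.\<close>

lemma dyadic_step_geometric:
  assumes "a \<le> u" "u \<le> v" "v \<le> b" "mesh n \<le> 2 * (v - u)"
  shows "\<bar>(dyadic_sum (Suc (n + k)) v - dyadic_sum (Suc (n + k)) u) - (dyadic_sum (n + k) v - dyadic_sum (n + k) u)\<bar>
    \<le> 5 * F * G * (v - u) * mesh n powr (\<gamma> + \<kappa> - 1) * (2 powr (1 - (\<gamma> + \<kappa>))) ^ k"
proof -
  have h: "0 < mesh (n + k)" "mesh (n + k) \<le> mesh n"
    using mesh_pos ab by (auto simp: mesh_def intro!: divide_left_mono power_increasing)
  then have le: "(v - u) / mesh (n + k) + 2 \<le> 5 * ((v - u) / mesh (n + k))"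
  proof -
    have "1 \<le> 2 * (v - u) / mesh (n + k)" using assms(4) h by (simp add: le_divide_eq)
    then have "2 \<le> 4 * ((v - u) / mesh (n + k))" by linarith
    then show ?thesis by linarith
  qed
  note dyadic_sum_step[OF assms(1-3), of "n + k"]
  also have "((v - u) / mesh (n + k) + 2) * (F * G * mesh (n + k) powr (\<gamma> + \<kappa>))
      \<le> 5 * ((v - u) / mesh (n + k)) * (F * G * mesh (n + k) powr (\<gamma> + \<kappa>))"
    using le F G by (intro mult_right_mono) auto
  also have "\<dots> = 5 * F * G * (v - u) * mesh (n + k) powr (\<gamma> + \<kappa> - 1)"
    using h by (simp add: powr_diff field_simps)
  finally show ?thesis by (simp add: mesh_powr[of n k] mult.assoc)
qed

lemma dyadic_sum_left: "dyadic_sum n a = 0"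
proof -
  have "min a (node n k) = a" for k using mesh_pos[of n] by (simp add: node_def)
  then show ?thesis by (simp add: dyadic_sum_def)
qed

text \<open>Since the sums vanish at \<open>a\<close>, the increment estimate with
  \<open>u = a\<close> bounds the sums themselves. It holds only from a level on that depends on
  \<open>t\<close>, so the telescoping series starts there.\<close>

lemma young_primitive:
  assumes "t \<in> {a..b}"
  shows "(\<lambda>n. dyadic_sum n t) \<longlonglongrightarrow> young_primitive t"
proof (cases "t = a")
  case True
  then show ?thesis by (simp add: young_primitive_def dyadic_sum_left)
next
  case False
  then have t: "a \<le> a" "a \<le> t" "t \<le> b" "0 < t - a" using assms by auto
  have "(\<lambda>n. (b - a) * (1 / 2) ^ n) \<longlonglongrightarrow> (b - a) * 0" by (intro tendsto_intros) auto
  moreover have "mesh = (\<lambda>n. (b - a) * (1 / 2) ^ n)" by (rule ext) (simp add: mesh_def power_divide)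
  ultimately have "mesh \<longlonglongrightarrow> 0" by simp
  then have "eventually (\<lambda>n. mesh n < t - a) sequentially" using t by (intro order_tendstoD) auto
  then obtain n where n: "mesh n < t - a" by (auto simp: eventually_sequentially)
  have "summable (\<lambda>k. dyadic_sum (Suc k + n) t - dyadic_sum (k + n) t)"
  proof (rule summable_comparison_test)
    show "summable (\<lambda>k. 5 * F * G * (t - a) * mesh n powr (\<gamma> + \<kappa> - 1) * (2 powr (1 - (\<gamma> + \<kappa>))) ^ k)"
      using ratio by (intro summable_mult summable_geometric) auto
    show "\<exists>N. \<forall>k\<ge>N. norm (dyadic_sum (Suc k + n) t - dyadic_sum (k + n) t)
        \<le> 5 * F * G * (t - a) * mesh n powr (\<gamma> + \<kappa> - 1) * (2 powr (1 - (\<gamma> + \<kappa>))) ^ k"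
      using dyadic_step_geometric[OF t(1-3), of n] n t by (simp add: dyadic_sum_left add.commute)
  qed
  then have "convergent (\<lambda>k. dyadic_sum (k + n) t)"
  proof -
    assume "summable (\<lambda>k. dyadic_sum (Suc k + n) t - dyadic_sum (k + n) t)"
    then have "convergent (\<lambda>m. \<Sum>k<m. dyadic_sum (Suc k + n) t - dyadic_sum (k + n) t)"
      by (simp add: summable_iff_convergent)
    also have "(\<lambda>m. \<Sum>k<m. dyadic_sum (Suc k + n) t - dyadic_sum (k + n) t)
        = (\<lambda>m. dyadic_sum (m + n) t - dyadic_sum n t)"
      using sum_lessThan_telescope[of "\<lambda>k. dyadic_sum (k + n) t"] by (intro ext) simp
    finally have "convergent (\<lambda>m. (dyadic_sum (m + n) t - dyadic_sum n t) + dyadic_sum n t)"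
      by (intro convergent_add convergent_const)
    then show ?thesis by simp
  qed
  then have "convergent (\<lambda>n. dyadic_sum n t)"
    by (subst (asm) convergent_ignore_initial_segment)
  then show ?thesis unfolding young_primitive_def by (simp add: convergent_LIMSEQ_iff)
qed

lemma mesh_scale:
  assumes "0 < r" "r \<le> b - a"
  obtains n where "r \<le> mesh n" "mesh n \<le> 2 * r"
proof -
  \<comment> \<open>The first level finer than \<open>r\<close>; its predecessor is the witness, and
    it exists because \<open>mesh 0\<close> is at least \<open>r\<close>.\<close>
  define m where "m = (LEAST m. mesh m < r)"
  have "\<exists>m. mesh m < r"
  proof -
    obtain m where "(1 / 2) ^ m < r / (b - a)"
      using real_arch_pow_inv[of "r / (b - a)" "1 / 2"] assms ab by auto
    then have "mesh m < r" using ab by (simp add: mesh_def power_divide field_simps)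
    then show ?thesis ..
  qed
  then have m: "mesh m < r" unfolding m_def by (rule LeastI_ex)
  have "mesh 0 \<ge> r" using assms by (simp add: mesh_def)
  with m obtain n where n: "m = Suc n" by (cases m) auto
  have "\<not> mesh n < r"
    using not_less_Least[of n "\<lambda>m. mesh m < r"] n by (simp add: m_def)
  then show ?thesis using m n that[of n] by (simp add: mesh_Suc)
qed

text \<open>The clamped increments of \<open>g\<close> telescope to \<open>g v - g u\<close>, so
  subtracting \<open>f u * (g v - g u)\<close> replaces \<open>f\<close> at each node by its
  increment from \<open>u\<close>. At this mesh at most three cells count, and their nodes are
  within \<open>2 * (v - u)\<close> of \<open>u\<close>.\<close>

lemma dyadic_sum_local:
  assumes "a \<le> u" "u < v" "v \<le> b" "v - u \<le> mesh n" "mesh n \<le> 2 * (v - u)"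
  shows "\<bar>dyadic_sum n v - dyadic_sum n u - f u * (g v - g u)\<bar>
    \<le> 3 * (F * G * (2 * (v - u)) powr (\<gamma> + \<kappa>))"
proof -
  define A where "A k = (f (node n k) - f u) * (g (pin u v (node n (Suc k))) - g (pin u v (node n k)))" for k
  let ?c = "F * G * (2 * (v - u)) powr (\<gamma> + \<kappa>)"
  have uv: "u \<le> v" using assms by simp
  have "dyadic_sum n v - dyadic_sum n u - f u * (g v - g u) = (\<Sum>k<2 ^ n. A k)"
    unfolding dyadic_sum_diff[OF uv] g_pin_telescope[OF assms(1) uv assms(3), symmetric, of n]
      sum_distrib_left sum_subtractf[symmetric] A_def
    by (rule sum.cong) (simp_all add: algebra_simps)
  also have "\<bar>\<dots>\<bar> \<le> ((v - u) / mesh n + 2) * ?c"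
  proof (rule clamped_sum_le[OF assms(1) uv assms(3)])
    show "0 \<le> ?c" using F G by simp
    fix k :: nat assume k: "k < 2 ^ n"
    show "A k = 0" if "node n k \<ge> v \<or> u \<ge> node n (Suc k)"
    proof -
      have "pin u v (node n (Suc k)) = pin u v (node n k)"
        using that mesh_pos[of n] assms by (auto simp: node_Suc min_def max_def)
      then show ?thesis by (simp add: A_def)
    qed
    assume k2: "node n k < v" "u < node n (Suc k)"
    have nodes: "node n k \<in> {a..b}" "u \<in> {a..b}"
      using node_mem[of k n] k assms by auto
    have "\<bar>f (node n k) - f u\<bar> \<le> F * \<bar>node n k - u\<bar> powr \<gamma>"
      using hoelder_onD[OF f_hoelder nodes(2,1)] by simp
    also have "\<dots> \<le> F * (2 * (v - u)) powr \<gamma>"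
      using F \<gamma> k2 assms by (intro mult_left_mono powr_mono2) (auto simp: node_Suc)
    finally have f1: "\<bar>f (node n k) - f u\<bar> \<le> F * (2 * (v - u)) powr \<gamma>" .
    have "\<bar>g (pin u v (node n (Suc k))) - g (pin u v (node n k))\<bar>
          \<le> G * \<bar>pin u v (node n (Suc k)) - pin u v (node n k)\<bar> powr \<kappa>"
      using hoelder_onD[OF g_hoelder] assms by (auto simp: min_def max_def)
    also have "\<dots> \<le> G * (2 * (v - u)) powr \<kappa>"
      using G \<kappa> assms by (intro mult_left_mono powr_mono2) auto
    finally have g1: "\<bar>g (pin u v (node n (Suc k))) - g (pin u v (node n k))\<bar> \<le> G * (2 * (v - u)) powr \<kappa>" .
    have "\<bar>A k\<bar> \<le> (F * (2 * (v - u)) powr \<gamma>) * (G * (2 * (v - u)) powr \<kappa>)"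
      unfolding A_def abs_mult using f1 g1 F by (intro mult_mono) auto
    then show "\<bar>A k\<bar> \<le> ?c" by (simp add: powr_add mult.assoc mult.left_commute)
  qed
  also have "\<dots> \<le> 3 * ?c"
    using assms mesh_pos[of n] F G by (intro mult_right_mono) auto
  finally show ?thesis .
qed

text \<open>The level whose mesh is comparable to \<open>v - u\<close> is compared with the
  one-point approximation, and the corrections of all finer levels are summed. Starting at a level
  adapted to \<open>v - u\<close> is what produces the power \<open>\<gamma> + \<kappa>\<close> of
  \<open>v - u\<close>.\<close>

lemma young_primitive_local:
  assumes "a \<le> u" "u \<le> v" "v \<le> b"
  shows "\<bar>young_primitive v - young_primitive u - f u * (g v - g u)\<bar>
    \<le> young_const (\<gamma> + \<kappa>) * F * G * (v - u) powr (\<gamma> + \<kappa>)"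
proof (cases "u = v")
  case False
  let ?\<theta> = "\<gamma> + \<kappa>" and ?q = "2 powr (1 - (\<gamma> + \<kappa>))" and ?w = "v - u"
  let ?D = "\<lambda>n. dyadic_sum n v - dyadic_sum n u"
  have w: "0 < ?w" "?w \<le> b - a" using False assms by auto
  obtain n where n: "?w \<le> mesh n" "mesh n \<le> 2 * ?w" by (rule mesh_scale[OF w])
  define c where "c = 5 * F * G * ?w * mesh n powr (?\<theta> - 1)"
  have "c \<le> 5 * F * G * ?w * (2 * ?w) powr (?\<theta> - 1)"
    unfolding c_def using F G w n sum_gt_1 mesh_pos[of n] by (intro mult_left_mono powr_mono2) auto
  also have "\<dots> = 5 * F * G * (2 * ?w) powr ?\<theta> / 2"
    using w by (simp add: powr_diff field_simps)
  also have "\<dots> \<le> 5 * F * G * (2 * ?w) powr ?\<theta>"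
    using F G by simp
  finally have c: "c \<le> 5 * F * G * (2 * ?w) powr ?\<theta>" .
  have c0: "0 \<le> c" using F G w by (simp add: c_def)
  have partial: "\<bar>?D (n + k) - ?D n\<bar> \<le> (\<Sum>j<k. c * ?q ^ j)" for k
  proof (induction k)
    case (Suc k)
    have "\<bar>?D (Suc (n + k)) - ?D (n + k)\<bar> \<le> c * ?q ^ k"
      using dyadic_step_geometric[OF assms n(2)] by (simp add: c_def)
    with Suc show ?case by simp
  qed simp
  have geo: "(\<Sum>j<k. c * ?q ^ j) \<le> c / (1 - ?q)" for k
  proof -
    have "(\<Sum>j<k. ?q ^ j) \<le> (\<Sum>j. ?q ^ j)"
      using ratio by (intro sum_le_suminf summable_geometric) auto
    also have "\<dots> = 1 / (1 - ?q)" using ratio by (intro suminf_geometric) auto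
    finally show ?thesis using c0 by (simp add: sum_distrib_left[symmetric] mult_left_mono divide_inverse)
  qed
  have "\<bar>?D (n + k) - f u * (g v - g u)\<bar> \<le> 3 * (F * G * (2 * ?w) powr ?\<theta>) + c / (1 - ?q)" for k
    using partial[of k] geo[of k] dyadic_sum_local[OF assms(1) _ assms(3) n] w by linarith
  moreover have "(\<lambda>k. \<bar>?D (n + k) - f u * (g v - g u)\<bar>) \<longlonglongrightarrow>
      \<bar>young_primitive v - young_primitive u - f u * (g v - g u)\<bar>"
    using LIMSEQ_ignore_initial_segment[OF young_primitive[of v], of n]
      LIMSEQ_ignore_initial_segment[OF young_primitive[of u], of n] assms
    by (intro tendsto_intros) (auto simp: add.commute)
  ultimately have "\<bar>young_primitive v - young_primitive u - f u * (g v - g u)\<bar>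
      \<le> 3 * (F * G * (2 * ?w) powr ?\<theta>) + c / (1 - ?q)"
    by (intro LIMSEQ_le_const2) auto
  also have "\<dots> \<le> 3 * (F * G * (2 * ?w) powr ?\<theta>) + 5 * F * G * (2 * ?w) powr ?\<theta> / (1 - ?q)"
    using c ratio by (intro add_left_mono divide_right_mono) auto
  also have "\<dots> = young_const ?\<theta> * F * G * ?w powr ?\<theta>"
    by (simp only: young_const_def powr_mult) (simp add: algebra_simps)
  finally show ?thesis .
qed simp

text \<open>The primitive is additive over any division, and on each cell it differs from the
  Riemann summand by a power greater than 1 of the length. One factor of the length sums to
  \<open>v - u\<close>; the surplus power is small with the mesh. This makes the limit along dyadic
  grids a limit over all tagged divisions.\<close>

lemma has_RS_integral_young_primitive:
  assumes "a \<le> u" "u \<le> v" "v \<le> b"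
  shows "has_RS_integral f g u v (young_primitive v - young_primitive u)"
  unfolding has_RS_integral_def
proof (intro allI impI)
  fix \<epsilon> :: real assume \<epsilon>: "0 < \<epsilon>"
  let ?\<theta> = "\<gamma> + \<kappa>"
  \<comment> \<open>The 1 pays for moving the tag to the left end of its cell,
    \<open>young_const\<close> for the local estimate there.\<close>
  define c where "c = (young_const ?\<theta> + 1) * F * G"
  have c0: "0 \<le> c" using F G young_const_ge_0[OF sum_gt_1] by (simp add: c_def)
  \<comment> \<open>Cells have length at most \<open>2 * \<eta>\<close>, and this choice makes the
    total error \<open>c * (v - u) * \<epsilon> / (2 * (c * (v - u) + 1))\<close>. The 1 keeps the
    denominator positive when \<open>c\<close> or \<open>v - u\<close> vanishes.\<close>
  define \<eta> where "\<eta> = (\<epsilon> / (2 * (c * (v - u) + 1))) powr (1 / (?\<theta> - 1)) / 2"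
  have cv: "0 < c * (v - u) + 1" using c0 assms by (simp add: add_nonneg_pos)
  have \<eta>: "0 < \<eta>" "(2 * \<eta>) powr (?\<theta> - 1) = \<epsilon> / (2 * (c * (v - u) + 1))"
    using \<epsilon> cv sum_gt_1 by (auto simp: \<eta>_def powr_powr)
  have "\<bar>(\<Sum>(\<xi>, J)\<in>p. f \<xi> * (g (Sup J) - g (Inf J))) - (young_primitive v - young_primitive u)\<bar> < \<epsilon>"
    if p: "p tagged_division_of {u..v}" and fine: "(\<lambda>\<xi>. ball \<xi> \<eta>) fine p" for p
  proof -
    let ?\<Phi> = young_primitive
    have cell: "\<bar>f \<xi> * (g (Sup J) - g (Inf J)) - (?\<Phi> (Sup J) - ?\<Phi> (Inf J))\<bar>
        \<le> c * (2 * \<eta>) powr (?\<theta> - 1) * (Sup J - Inf J)" if mem: "(\<xi>, J) \<in> p" for \<xi> J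
    proof -
      have \<xi>: "\<xi> \<in> J" and sub: "J \<subseteq> {u..v}" using tagged_division_ofD[OF p] that by auto
      obtain r s where J: "J = {r..s}" using tagged_division_ofD(4)[OF p mem] by auto
      have rs: "r \<le> \<xi>" "\<xi> \<le> s" using \<xi> J by auto
      have rsab: "a \<le> r" "r \<le> s" "s \<le> b" using rs sub J assms by auto
      have "J \<subseteq> ball \<xi> \<eta>" using fineD[OF fine mem] by simp
      moreover have "r \<in> J" "s \<in> J" using J rs by auto
      ultimately have "r \<in> ball \<xi> \<eta>" "s \<in> ball \<xi> \<eta>" by blast+
      then have small: "s - r \<le> 2 * \<eta>" using rs by (auto simp: dist_real_def)
      have "\<bar>f \<xi> - f r\<bar> * \<bar>g s - g r\<bar> \<le> (F * (s - r) powr \<gamma>) * (G * (s - r) powr \<kappa>)"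
      proof (rule mult_mono)
        have "\<bar>f \<xi> - f r\<bar> \<le> F * \<bar>\<xi> - r\<bar> powr \<gamma>" using hoelder_onD[OF f_hoelder, of r \<xi>] rs rsab by simp
        also have "\<dots> \<le> F * (s - r) powr \<gamma>" using F \<gamma> rs by (intro mult_left_mono powr_mono2) auto
        finally show "\<bar>f \<xi> - f r\<bar> \<le> F * (s - r) powr \<gamma>" .
        show "\<bar>g s - g r\<bar> \<le> G * (s - r) powr \<kappa>" using hoelder_onD[OF g_hoelder, of r s] rsab by simp
      qed (use F in auto)
      then have e1: "\<bar>f \<xi> * (g s - g r) - f r * (g s - g r)\<bar> \<le> F * G * (s - r) powr ?\<theta>"
        by (simp add: left_diff_distrib[symmetric] abs_mult powr_add mult.assoc mult.left_commute)
      have "\<bar>f \<xi> * (g s - g r) - (?\<Phi> s - ?\<Phi> r)\<bar> \<le> c * (s - r) powr ?\<theta>"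
        using e1 young_primitive_local[OF rsab] by (simp add: c_def algebra_simps)
      also have "(s - r) powr ?\<theta> = (s - r) powr (?\<theta> - 1) * (s - r)"
        using rsab by (cases "s = r") (auto simp: powr_diff)
      also have "c * ((s - r) powr (?\<theta> - 1) * (s - r)) \<le> c * ((2 * \<eta>) powr (?\<theta> - 1) * (s - r))"
        using c0 small rsab sum_gt_1 by (intro mult_left_mono mult_right_mono powr_mono2) auto
      finally show ?thesis using rsab by (simp add: J mult.assoc)
    qed
    have "\<bar>(\<Sum>(\<xi>, J)\<in>p. f \<xi> * (g (Sup J) - g (Inf J))) - (?\<Phi> v - ?\<Phi> u)\<bar>
        = \<bar>\<Sum>(\<xi>, J)\<in>p. f \<xi> * (g (Sup J) - g (Inf J)) - (?\<Phi> (Sup J) - ?\<Phi> (Inf J))\<bar>"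
      unfolding additive_tagged_division_1[OF \<open>u \<le> v\<close> p, symmetric]
      by (simp add: sum_subtractf case_prod_unfold)
    also have "\<dots> \<le> (\<Sum>(\<xi>, J)\<in>p. c * (2 * \<eta>) powr (?\<theta> - 1) * (Sup J - Inf J))"
      using cell by (intro order_trans[OF sum_abs] sum_mono) auto
    also have "\<dots> = c * (2 * \<eta>) powr (?\<theta> - 1) * (v - u)"
      unfolding additive_tagged_division_1[OF \<open>u \<le> v\<close> p, of "\<lambda>x. x", symmetric]
      by (simp add: sum_distrib_left case_prod_unfold)
    also have "\<dots> < \<epsilon>"
    proof -
      have "c * (v - u) * \<epsilon> < \<epsilon> * (2 * (c * (v - u) + 1))"
        using mult_pos_pos[OF \<epsilon> cv] c0 \<epsilon> assms by (simp add: algebra_simps)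
      then show ?thesis unfolding \<eta>(2) using cv by (simp add: field_simps)
    qed
    finally show ?thesis .
  qed
  then show "\<exists>\<eta>>0. \<forall>p. p tagged_division_of {u..v} \<and> (\<lambda>\<xi>. ball \<xi> \<eta>) fine p \<longrightarrow>
      \<bar>(\<Sum>(\<xi>, J)\<in>p. f \<xi> * (g (Sup J) - g (Inf J))) - (young_primitive v - young_primitive u)\<bar> < \<epsilon>"
    using \<eta>(1) by blast
qed

end

section \<open>Uniqueness and linearity of the Riemann-Stieltjes integral, and the Young inequality
  on an interval\<close>

lemma ball_fine_mono:
  assumes "(\<lambda>\<xi>. ball \<xi> d) fine p" "d \<le> e"
  shows "(\<lambda>\<xi>. ball \<xi> e) fine p"
  by (rule fineI) (rule order_trans[OF fineD[OF assms(1)] subset_ball[OF assms(2)]])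

lemma has_RS_integralE:
  assumes "has_RS_integral f g a b I" "0 < \<epsilon>"
  obtains \<eta> where "0 < \<eta>"
    "\<forall>p. p tagged_division_of {a..b} \<and> (\<lambda>\<xi>. ball \<xi> \<eta>) fine p \<longrightarrow>
      \<bar>(\<Sum>(\<xi>, J)\<in>p. f \<xi> * (g (Sup J) - g (Inf J))) - I\<bar> < \<epsilon>"
proof -
  have "\<exists>\<eta>>0. \<forall>p. p tagged_division_of {a..b} \<and> (\<lambda>\<xi>. ball \<xi> \<eta>) fine p \<longrightarrow>
      \<bar>(\<Sum>(\<xi>, J)\<in>p. f \<xi> * (g (Sup J) - g (Inf J))) - I\<bar> < \<epsilon>"
    by (rule assms(1)[unfolded has_RS_integral_def, THEN spec, THEN mp, OF assms(2)])
  then show thesis by (elim exE conjE) (rule that)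
qed

lemma has_RS_integral_unique:
  assumes "has_RS_integral f g a b I1" "has_RS_integral f g a b I2"
  shows "I1 = I2"
proof (rule ccontr)
  assume "I1 \<noteq> I2"
  then have \<epsilon>: "0 < \<bar>I1 - I2\<bar> / 2" by simp
  obtain \<eta> where \<eta>: "\<eta> > 0" and I1: "\<forall>p. p tagged_division_of {a..b} \<and> (\<lambda>\<xi>. ball \<xi> \<eta>) fine p \<longrightarrow>
        \<bar>(\<Sum>(\<xi>, J)\<in>p. f \<xi> * (g (Sup J) - g (Inf J))) - I1\<bar> < \<bar>I1 - I2\<bar> / 2"
    by (rule has_RS_integralE[OF assms(1) \<epsilon>])
  obtain \<eta>' where \<eta>': "\<eta>' > 0" and I2: "\<forall>p. p tagged_division_of {a..b} \<and> (\<lambda>\<xi>. ball \<xi> \<eta>') fine p \<longrightarrow>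
        \<bar>(\<Sum>(\<xi>, J)\<in>p. f \<xi> * (g (Sup J) - g (Inf J))) - I2\<bar> < \<bar>I1 - I2\<bar> / 2"
    by (rule has_RS_integralE[OF assms(2) \<epsilon>])
  have "gauge (\<lambda>\<xi>::real. ball \<xi> (min \<eta> \<eta>'))" using \<eta> \<eta>' by (intro gauge_ball) simp
  then obtain p where p: "p tagged_division_of {a..b}" "(\<lambda>\<xi>. ball \<xi> (min \<eta> \<eta>')) fine p"
    by (rule fine_division_exists_real)
  note I1[THEN spec, THEN mp, OF conjI, OF p(1) ball_fine_mono[OF p(2) min.cobounded1]]
    I2[THEN spec, THEN mp, OF conjI, OF p(1) ball_fine_mono[OF p(2) min.cobounded2]]
  then show False by argo
qed

lemma RS_integral_eq: "has_RS_integral f g a b I \<Longrightarrow> RS_integral f g a b = I"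
  unfolding RS_integral_def by (rule the_equality) (auto dest: has_RS_integral_unique)

lemma has_RS_integral_RS_integral: "RS_integrable f g a b \<Longrightarrow> has_RS_integral f g a b (RS_integral f g a b)"
  unfolding RS_integrable_def by (auto simp: RS_integral_eq)

lemma has_RS_integral_diff:
  assumes "has_RS_integral f1 g a b I1" "has_RS_integral f2 g a b I2"
  shows "has_RS_integral (\<lambda>r. f1 r - f2 r) g a b (I1 - I2)"
  unfolding has_RS_integral_def
proof (rule allI, rule impI)
  fix \<epsilon> :: real assume \<epsilon>: "0 < \<epsilon>"
  obtain \<eta> where \<eta>: "\<eta> > 0" and I1: "\<forall>p. p tagged_division_of {a..b} \<and> (\<lambda>\<xi>. ball \<xi> \<eta>) fine p \<longrightarrow>
        \<bar>(\<Sum>(\<xi>, J)\<in>p. f1 \<xi> * (g (Sup J) - g (Inf J))) - I1\<bar> < \<epsilon> / 2"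
    by (rule has_RS_integralE[OF assms(1) half_gt_zero[OF \<epsilon>]])
  obtain \<eta>' where \<eta>': "\<eta>' > 0" and I2: "\<forall>p. p tagged_division_of {a..b} \<and> (\<lambda>\<xi>. ball \<xi> \<eta>') fine p \<longrightarrow>
        \<bar>(\<Sum>(\<xi>, J)\<in>p. f2 \<xi> * (g (Sup J) - g (Inf J))) - I2\<bar> < \<epsilon> / 2"
    by (rule has_RS_integralE[OF assms(2) half_gt_zero[OF \<epsilon>]])
  show "\<exists>\<eta>>0. \<forall>p. p tagged_division_of {a..b} \<and> (\<lambda>\<xi>. ball \<xi> \<eta>) fine p \<longrightarrow>
      \<bar>(\<Sum>(\<xi>, J)\<in>p. (f1 \<xi> - f2 \<xi>) * (g (Sup J) - g (Inf J))) - (I1 - I2)\<bar> < \<epsilon>"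
  proof (intro exI[of _ "min \<eta> \<eta>'"] conjI allI impI)
    show "0 < min \<eta> \<eta>'" using \<eta> \<eta>' by simp
    fix p assume "p tagged_division_of {a..b} \<and> (\<lambda>\<xi>. ball \<xi> (min \<eta> \<eta>')) fine p"
    then have p: "p tagged_division_of {a..b}" "(\<lambda>\<xi>. ball \<xi> (min \<eta> \<eta>')) fine p" by simp_all
    have "(\<Sum>(\<xi>, J)\<in>p. (f1 \<xi> - f2 \<xi>) * (g (Sup J) - g (Inf J)))
        = (\<Sum>(\<xi>, J)\<in>p. f1 \<xi> * (g (Sup J) - g (Inf J))) - (\<Sum>(\<xi>, J)\<in>p. f2 \<xi> * (g (Sup J) - g (Inf J)))"
      by (simp add: left_diff_distrib sum_subtractf case_prod_unfold)
    then show "\<bar>(\<Sum>(\<xi>, J)\<in>p. (f1 \<xi> - f2 \<xi>) * (g (Sup J) - g (Inf J))) - (I1 - I2)\<bar> < \<epsilon>"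
      using I1[THEN spec, THEN mp, OF conjI, OF p(1) ball_fine_mono[OF p(2) min.cobounded1]]
        I2[THEN spec, THEN mp, OF conjI, OF p(1) ball_fine_mono[OF p(2) min.cobounded2]]
      by argo
  qed
qed

lemma has_RS_integral_point: "has_RS_integral f g a a 0"
  unfolding has_RS_integral_def
proof (intro allI impI)
  fix \<epsilon> :: real assume "0 < \<epsilon>"
  have "(\<Sum>(\<xi>, J)\<in>p. f \<xi> * (g (Sup J) - g (Inf J))) = 0" if "p tagged_division_of {a..a}" for p
  proof (rule sum.neutral, clarify)
    fix \<xi> J assume "(\<xi>, J) \<in> p"
    then have "J \<subseteq> {a}" "\<xi> \<in> J" using tagged_division_ofD[OF that] by auto
    then have "J = {a}" by auto
    then show "f \<xi> * (g (Sup J) - g (Inf J)) = 0" by simp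
  qed
  with \<open>0 < \<epsilon>\<close> show "\<exists>\<eta>>0. \<forall>p. p tagged_division_of {a..a} \<and> (\<lambda>\<xi>. ball \<xi> \<eta>) fine p \<longrightarrow>
      \<bar>(\<Sum>(\<xi>, J)\<in>p. f \<xi> * (g (Sup J) - g (Inf J))) - 0\<bar> < \<epsilon>"
    by (intro exI[of _ 1]) auto
qed

text \<open>These facts no longer mention the primitive: integrals are its increments, so additivity
  is immediate. The degenerate interval is treated by hand, as the dyadic grid requires
  \<open>a < b\<close>.\<close>

lemma young_integral:
  fixes f g :: "real \<Rightarrow> real"
  assumes "a \<le> b" "0 < \<gamma>" "0 < \<kappa>" "1 < \<gamma> + \<kappa>" "0 \<le> F" "0 \<le> G"
    and "hoelder_on \<gamma> F {a..b} f" "hoelder_on \<kappa> G {a..b} g"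
  shows RS_integrable_young: "RS_integrable f g a b"
    and RS_integral_young_le: "\<bar>RS_integral f g a b - f a * (g b - g a)\<bar>
      \<le> young_const (\<gamma> + \<kappa>) * F * G * (b - a) powr (\<gamma> + \<kappa>)"
    and RS_integral_combine: "\<And>c. a \<le> c \<Longrightarrow> c \<le> b \<Longrightarrow>
      RS_integral f g a b = RS_integral f g a c + RS_integral f g c b"
proof -
  have *: "RS_integrable f g a b \<and>
      \<bar>RS_integral f g a b - f a * (g b - g a)\<bar> \<le> young_const (\<gamma> + \<kappa>) * F * G * (b - a) powr (\<gamma> + \<kappa>) \<and>
      (\<forall>c. a \<le> c \<and> c \<le> b \<longrightarrow> RS_integral f g a b = RS_integral f g a c + RS_integral f g c b)"
  proof (cases "a = b")
    case True
    have *: "has_RS_integral f g b b 0" by (rule has_RS_integral_point)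
    have 1: "RS_integrable f g b b" using * by (auto simp: RS_integrable_def)
    have 2: "RS_integral f g b b = 0" by (rule RS_integral_eq[OF *])
    have 3: "RS_integral f g b b = RS_integral f g b c + RS_integral f g c b" if "b \<le> c \<and> c \<le> b" for c
    proof -
      have "c = b" using that by simp
      then show ?thesis using 2 by simp
    qed
    show ?thesis unfolding True using 1 2 3 by simp
  next
    case False
    interpret young_pair f g a b \<gamma> \<kappa> F G using assms False by unfold_locales auto
    have I: "RS_integral f g u v = young_primitive v - young_primitive u" if "a \<le> u" "u \<le> v" "v \<le> b" for u v
      by (rule RS_integral_eq[OF has_RS_integral_young_primitive[OF that]])
    show ?thesis
      using has_RS_integral_young_primitive[of a b] young_primitive_local[of a b] ab
      by (auto simp: I RS_integrable_def)
  qed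
  show "RS_integrable f g a b"
    "\<bar>RS_integral f g a b - f a * (g b - g a)\<bar> \<le> young_const (\<gamma> + \<kappa>) * F * G * (b - a) powr (\<gamma> + \<kappa>)"
    "\<And>c. a \<le> c \<Longrightarrow> c \<le> b \<Longrightarrow> RS_integral f g a b = RS_integral f g a c + RS_integral f g c b"
    using * by blast+
qed

lemma RS_integral_diff:
  assumes "RS_integrable f1 g a b" "RS_integrable f2 g a b"
  shows "RS_integrable (\<lambda>r. f1 r - f2 r) g a b"
    and "RS_integral (\<lambda>r. f1 r - f2 r) g a b = RS_integral f1 g a b - RS_integral f2 g a b"
  using has_RS_integral_diff[OF assms[THEN has_RS_integral_RS_integral]] RS_integral_eq
  by (auto simp: RS_integrable_def)

subsection \<open>Young integrals at a fixed scale\<close>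

text \<open>Normalised so that \<open>c\<close> bounds the oscillation over a distance
  \<open>1 / \<Lambda>\<close>, in the same unit as a supremum bound. Only distances up to
  \<open>1 / \<Lambda>\<close> are constrained; there
  \<open>\<Lambda> * \<bar>t - s\<bar> \<le> 1\<close>, so the exponent can be lowered without
  changing \<open>c\<close>.\<close>

definition scaled_hoelder ::
    "real \<Rightarrow> real \<Rightarrow> real \<Rightarrow> real set \<Rightarrow> (real \<Rightarrow> 'a::real_normed_vector) \<Rightarrow> bool" where
  "scaled_hoelder \<gamma> \<Lambda> c S p \<longleftrightarrow>
     (\<forall>s\<in>S. \<forall>t\<in>S. \<bar>t - s\<bar> \<le> 1 / \<Lambda> \<longrightarrow> norm (p t - p s) \<le> c * (\<Lambda> * \<bar>t - s\<bar>) powr \<gamma>)"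

lemma scaled_hoelderD:
  "scaled_hoelder \<gamma> \<Lambda> c S p \<Longrightarrow> s \<in> S \<Longrightarrow> t \<in> S \<Longrightarrow> \<bar>t - s\<bar> \<le> 1 / \<Lambda> \<Longrightarrow>
    norm (p t - p s) \<le> c * (\<Lambda> * \<bar>t - s\<bar>) powr \<gamma>"
  by (auto simp: scaled_hoelder_def)

lemma scaled_hoelder_subset:
  "scaled_hoelder \<gamma> \<Lambda> c S p \<Longrightarrow> S' \<subseteq> S \<Longrightarrow> scaled_hoelder \<gamma> \<Lambda> c S' p"
  by (auto simp: scaled_hoelder_def)

lemma scaled_hoelder_weaken:
  assumes p: "scaled_hoelder \<gamma> \<Lambda> c S p" and "c \<le> c'" "\<gamma>' \<le> \<gamma>" "0 < \<Lambda>" "0 \<le> c'"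
  shows "scaled_hoelder \<gamma>' \<Lambda> c' S p"
  unfolding scaled_hoelder_def
proof (intro ballI impI)
  fix s t assume st: "s \<in> S" "t \<in> S" "\<bar>t - s\<bar> \<le> 1 / \<Lambda>"
  have "\<Lambda> * \<bar>t - s\<bar> \<le> 1" using st(3) \<open>0 < \<Lambda>\<close> by (simp add: field_simps)
  moreover have "0 \<le> \<Lambda> * \<bar>t - s\<bar>" using \<open>0 < \<Lambda>\<close> by simp
  ultimately have "(\<Lambda> * \<bar>t - s\<bar>) powr \<gamma> \<le> (\<Lambda> * \<bar>t - s\<bar>) powr \<gamma>'"
    using \<open>\<gamma>' \<le> \<gamma>\<close> by (intro powr_mono') auto
  then have "c * (\<Lambda> * \<bar>t - s\<bar>) powr \<gamma> \<le> c' * (\<Lambda> * \<bar>t - s\<bar>) powr \<gamma>'"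
    using \<open>c \<le> c'\<close> \<open>0 \<le> c'\<close> by (meson mult_mono powr_ge_zero)
  with scaled_hoelderD[OF p st] show "norm (p t - p s) \<le> c' * (\<Lambda> * \<bar>t - s\<bar>) powr \<gamma>'" by linarith
qed

text \<open>Over distances beyond \<open>1 / \<Lambda>\<close> the increment is at most
  \<open>2 * M\<close>, while \<open>(\<Lambda> * \<bar>t - s\<bar>) powr \<gamma>\<close> is at
  least 1. The constant is large in \<open>\<Lambda>\<close> and serves only for integrability,
  additivity and continuity, not for quantitative estimates.\<close>

lemma hoelder_on_if_scaled_hoelder:
  assumes p: "scaled_hoelder \<gamma> \<Lambda> c S p" and bound: "\<And>r. r \<in> S \<Longrightarrow> norm (p r) \<le> M"
    and "0 < \<Lambda>" "0 < \<gamma>" "0 \<le> c" "0 \<le> M"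
  shows "hoelder_on \<gamma> ((c + 2 * M) * \<Lambda> powr \<gamma>) S p"
  unfolding hoelder_on_def
proof (intro ballI)
  fix s t assume st: "s \<in> S" "t \<in> S"
  have "norm (p t - p s) \<le> (c + 2 * M) * (\<Lambda> * \<bar>t - s\<bar>) powr \<gamma>"
  proof (cases "\<bar>t - s\<bar> \<le> 1 / \<Lambda>")
    case True
    have "c * (\<Lambda> * \<bar>t - s\<bar>) powr \<gamma> \<le> (c + 2 * M) * (\<Lambda> * \<bar>t - s\<bar>) powr \<gamma>"
      using \<open>0 \<le> M\<close> by (intro mult_right_mono) auto
    with scaled_hoelderD[OF p st True] show ?thesis by linarith
  next
    case False
    then have "1 \<le> \<Lambda> * \<bar>t - s\<bar>" using \<open>0 < \<Lambda>\<close> by (simp add: field_simps)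
    then have "1 \<le> (\<Lambda> * \<bar>t - s\<bar>) powr \<gamma>" using \<open>0 < \<gamma>\<close> by (simp add: ge_one_powr_ge_zero)
    then have "(c + 2 * M) * 1 \<le> (c + 2 * M) * (\<Lambda> * \<bar>t - s\<bar>) powr \<gamma>"
      using \<open>0 \<le> M\<close> \<open>0 \<le> c\<close> by (intro mult_left_mono) auto
    moreover have "norm (p t - p s) \<le> 2 * M"
      using norm_triangle_ineq4[of "p t" "p s"] bound[OF st(1)] bound[OF st(2)] by linarith
    ultimately show ?thesis using \<open>0 \<le> c\<close> by (elim order_trans[rotated]) simp
  qed
  also have "\<dots> = (c + 2 * M) * \<Lambda> powr \<gamma> * \<bar>t - s\<bar> powr \<gamma>"
    using \<open>0 < \<Lambda>\<close> by (simp add: powr_mult)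
  finally show "norm (p t - p s) \<le> (c + 2 * M) * \<Lambda> powr \<gamma> * \<bar>t - s\<bar> powr \<gamma>" .
qed

text \<open>The Hoelder constant \<open>c * \<Lambda> powr \<gamma>\<close> in the Young inequality
  is compensated by \<open>(t - s) powr \<gamma>\<close>, as the interval is no longer than
  \<open>1 / \<Lambda>\<close>. Thus \<open>c\<close> enters on the same footing as
  \<open>M\<close>.\<close>

lemma RS_integral_local_le:
  assumes "0 < \<gamma>" "0 < \<kappa>" "1 < \<gamma> + \<kappa>" "0 < \<Lambda>" "0 \<le> M" "0 \<le> c" "0 \<le> G"
    and st: "s \<le> t" "t - s \<le> 1 / \<Lambda>"
    and p: "\<bar>p s\<bar> \<le> M" "scaled_hoelder \<gamma> \<Lambda> c {s..t} p" and g: "hoelder_on \<kappa> G {s..t} g"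
  shows "\<bar>RS_integral p g s t\<bar> \<le> G * (t - s) powr \<kappa> * (M + young_const (\<gamma> + \<kappa>) * c)"
proof -
  let ?Y = "young_const (\<gamma> + \<kappa>)"
  have Y: "0 \<le> ?Y" using assms by (intro young_const_ge_0)
  have p': "hoelder_on \<gamma> (c * \<Lambda> powr \<gamma>) {s..t} p"
    unfolding hoelder_on_def
  proof (intro ballI)
    fix u v assume uv: "u \<in> {s..t}" "v \<in> {s..t}"
    then have "\<bar>v - u\<bar> \<le> 1 / \<Lambda>" using st by auto
    from scaled_hoelderD[OF p(2) uv this]
    show "norm (p v - p u) \<le> c * \<Lambda> powr \<gamma> * \<bar>v - u\<bar> powr \<gamma>"
      using \<open>0 < \<Lambda>\<close> by (simp add: powr_mult)
  qed
  have "\<bar>RS_integral p g s t - p s * (g t - g s)\<bar> \<le> ?Y * (c * \<Lambda> powr \<gamma>) * G * (t - s) powr (\<gamma> + \<kappa>)"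
    using assms by (intro RS_integral_young_le p' g) auto
  also have "\<dots> = ?Y * c * G * (t - s) powr \<kappa> * (\<Lambda> * (t - s)) powr \<gamma>"
    using \<open>0 < \<Lambda>\<close> st by (simp add: powr_mult powr_add)
  also have "\<dots> \<le> ?Y * c * G * (t - s) powr \<kappa> * 1"
  proof -
    have "\<Lambda> * (t - s) \<le> 1" using st \<open>0 < \<Lambda>\<close> by (simp add: field_simps)
    then have "(\<Lambda> * (t - s)) powr \<gamma> \<le> 1" using st \<open>0 < \<Lambda>\<close> \<open>0 < \<gamma>\<close> by (simp add: powr_le1)
    then show ?thesis using Y assms by (intro mult_left_mono) auto
  qed
  finally have 1: "\<bar>RS_integral p g s t - p s * (g t - g s)\<bar> \<le> ?Y * c * G * (t - s) powr \<kappa>" by simp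
  have "\<bar>p s * (g t - g s)\<bar> \<le> M * (G * (t - s) powr \<kappa>)"
    unfolding abs_mult using hoelder_onD[OF g, of s t] st p(1) assms by (intro mult_mono) auto
  with 1 show ?thesis by (simp add: algebra_simps)
qed

text \<open>Induction on the number of pieces, removing a last piece of length at most
  \<open>1 / \<Lambda>\<close> each time. The total grows like
  \<open>\<Lambda> powr (1 - \<kappa>)\<close>; the Young inequality on the whole interval would
  give \<open>\<Lambda> powr \<gamma>\<close>, a larger power because
  \<open>\<gamma> + \<kappa> > 1\<close>.\<close>

lemma RS_integral_global_le:
  assumes "0 < \<gamma>" "0 < \<kappa>" "1 < \<gamma> + \<kappa>" "0 < \<Lambda>" "0 \<le> M" "0 \<le> c" "0 \<le> G" "0 \<le> s"
    and q: "\<And>r. r \<in> {0..s} \<Longrightarrow> \<bar>q r\<bar> \<le> M" "scaled_hoelder \<gamma> \<Lambda> c {0..s} q"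
    and g: "hoelder_on \<kappa> G {0..s} g"
  shows "\<bar>RS_integral q g 0 s\<bar> \<le> (s * \<Lambda> + 1) * (G * \<Lambda> powr (-\<kappa>) * (M + young_const (\<gamma> + \<kappa>) * c))"
    (is "_ \<le> _ * ?B")
proof -
  have "\<bar>RS_integral q g 0 r\<bar> \<le> real n * ?B" if "0 \<le> r" "r \<le> s" "r * \<Lambda> \<le> real n" for r n
    using that
  proof (induction n arbitrary: r)
    case 0
    then have "r = 0" using \<open>0 < \<Lambda>\<close> by (simp add: mult_le_0_iff)
    then show ?case using RS_integral_eq[OF has_RS_integral_point] by simp
  next
    case (Suc n)
    define r' where "r' = max 0 (r - 1 / \<Lambda>)"
    have r': "0 \<le> r'" "r' \<le> r" "r - r' \<le> 1 / \<Lambda>" using Suc.prems \<open>0 < \<Lambda>\<close> by (auto simp: r'_def)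
    have "r' * \<Lambda> \<le> real n"
      using Suc.prems \<open>0 < \<Lambda>\<close> by (auto simp: r'_def max_def left_diff_distrib)
    then have 1: "\<bar>RS_integral q g 0 r'\<bar> \<le> real n * ?B" using Suc r' by auto
    have "\<bar>RS_integral q g r' r\<bar> \<le> G * (r - r') powr \<kappa> * (M + young_const (\<gamma> + \<kappa>) * c)"
      using assms r' Suc.prems
      by (intro RS_integral_local_le[of \<gamma> \<kappa> \<Lambda>] scaled_hoelder_subset[OF q(2)] hoelder_on_subset[OF g] q(1)) auto
    also have "\<dots> \<le> ?B"
    proof -
      have Y: "0 \<le> young_const (\<gamma> + \<kappa>)" using assms by (intro young_const_ge_0)
      have "(r - r') powr \<kappa> \<le> (1 / \<Lambda>) powr \<kappa>" using r' \<open>0 < \<kappa>\<close> by (intro powr_mono2) auto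
      also have "\<dots> = \<Lambda> powr (-\<kappa>)" using \<open>0 < \<Lambda>\<close> by (simp add: powr_divide powr_minus_divide)
      finally show ?thesis using Y assms by (intro mult_right_mono mult_left_mono) auto
    qed
    finally have 2: "\<bar>RS_integral q g r' r\<bar> \<le> ?B" .
    have "scaled_hoelder \<gamma> \<Lambda> c {0..r} q" using scaled_hoelder_subset[OF q(2)] Suc.prems by auto
    then have "hoelder_on \<gamma> ((c + 2 * M) * \<Lambda> powr \<gamma>) {0..r} q"
      using assms Suc.prems by (intro hoelder_on_if_scaled_hoelder) auto
    then have "RS_integral q g 0 r = RS_integral q g 0 r' + RS_integral q g r' r"
      using assms r' Suc.prems
      by (intro RS_integral_combine[where \<gamma> = \<gamma> and \<kappa> = \<kappa> and G = G] hoelder_on_subset[OF g]) auto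
    with 1 2 show ?case by (simp add: algebra_simps)
  qed
  from this[of s "nat \<lceil>s * \<Lambda>\<rceil>"] have "\<bar>RS_integral q g 0 s\<bar> \<le> real (nat \<lceil>s * \<Lambda>\<rceil>) * ?B"
    using assms by (simp add: of_nat_ceiling)
  also have "\<dots> \<le> (s * \<Lambda> + 1) * ?B"
  proof (rule mult_right_mono)
    show "real (nat \<lceil>s * \<Lambda>\<rceil>) \<le> s * \<Lambda> + 1"
      using assms by (simp add: of_nat_nat ceiling_correct le_of_int_ceiling)
    have "0 \<le> young_const (\<gamma> + \<kappa>)" using assms by (intro young_const_ge_0)
    then show "0 \<le> ?B" using assms by simp
  qed
  finally show ?thesis .
qed

text \<open>Here \<open>p\<close> and \<open>q\<close> are the integrands at the outer times
  \<open>t\<close> and \<open>s\<close>. The difference is the integral of \<open>p\<close> over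
  \<open>[s,t]\<close>, estimated locally, plus that of \<open>p - q\<close> over
  \<open>[0,s]\<close>, estimated globally; the Lipschitz dependence on the outer time supplies the
  factor \<open>t - s\<close> in the latter.\<close>

lemma RS_integral_increment_le:
  assumes "0 < \<gamma>" "0 < \<kappa>" "\<kappa> \<le> 1" "1 < \<gamma> + \<kappa>" "1 \<le> \<Lambda>" "0 \<le> M" "0 \<le> c" "0 \<le> N" "0 \<le> G"
    and st: "0 \<le> s" "s \<le> t" "t \<le> T" "t - s \<le> 1 / \<Lambda>"
    and g: "hoelder_on \<kappa> G {0..T} g"
    and p: "\<And>r. r \<in> {0..t} \<Longrightarrow> \<bar>p r\<bar> \<le> M" "scaled_hoelder \<gamma> \<Lambda> c {0..t} p"
    and q: "RS_integrable q g 0 s"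
    and pq: "\<And>r. r \<in> {0..s} \<Longrightarrow> \<bar>p r - q r\<bar> \<le> N * (t - s)"
      "scaled_hoelder \<gamma> \<Lambda> (N * (t - s)) {0..s} (\<lambda>r. p r - q r)"
  shows "\<bar>RS_integral p g 0 t - RS_integral q g 0 s\<bar>
    \<le> G * (t - s) powr \<kappa> * (M + young_const (\<gamma> + \<kappa>) * c + (T + 1) * ((1 + young_const (\<gamma> + \<kappa>)) * N))"
proof -
  let ?Y = "young_const (\<gamma> + \<kappa>)"
  have \<Lambda>: "0 < \<Lambda>" using assms by simp
  have Y: "0 \<le> ?Y" using assms by (intro young_const_ge_0)
  have g': "hoelder_on \<kappa> G {u..v} g" if "0 \<le> u" "v \<le> T" for u v
    using that by (intro hoelder_on_subset[OF g]) auto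
  have ph: "hoelder_on \<gamma> ((c + 2 * M) * \<Lambda> powr \<gamma>) {0..t} p"
    using assms \<Lambda> by (intro hoelder_on_if_scaled_hoelder) auto
  then have phs: "hoelder_on \<gamma> ((c + 2 * M) * \<Lambda> powr \<gamma>) {0..s} p"
    by (rule hoelder_on_subset) (use st in auto)
  have c0: "0 \<le> (c + 2 * M) * \<Lambda> powr \<gamma>" using assms by simp
  have split: "RS_integral p g 0 t = RS_integral p g 0 s + RS_integral p g s t"
    by (rule RS_integral_combine[of 0 t \<gamma> \<kappa> "(c + 2 * M) * \<Lambda> powr \<gamma>" G]) (use assms c0 ph g'[of 0 t] in auto)
  have "RS_integrable p g 0 s"
    by (rule RS_integrable_young[of 0 s \<gamma> \<kappa> "(c + 2 * M) * \<Lambda> powr \<gamma>" G]) (use assms c0 phs g'[of 0 s] in auto)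
  then have diff: "RS_integral (\<lambda>r. p r - q r) g 0 s = RS_integral p g 0 s - RS_integral q g 0 s"
    using q by (rule RS_integral_diff)
  have "\<bar>RS_integral p g s t\<bar> \<le> G * (t - s) powr \<kappa> * (M + ?Y * c)"
    using assms \<Lambda> g'[of s t] by (intro RS_integral_local_le[of \<gamma> \<kappa> \<Lambda>] scaled_hoelder_subset[OF p(2)] p(1)) auto
  moreover have "\<bar>RS_integral (\<lambda>r. p r - q r) g 0 s\<bar> \<le> G * (t - s) powr \<kappa> * ((T + 1) * ((1 + ?Y) * N))"
  proof -
    have "\<bar>RS_integral (\<lambda>r. p r - q r) g 0 s\<bar>
        \<le> (s * \<Lambda> + 1) * (G * \<Lambda> powr (-\<kappa>) * (N * (t - s) + ?Y * (N * (t - s))))"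
      using assms \<Lambda> g'[of 0 s] by (intro RS_integral_global_le) auto
    also have "\<dots> = G * ((1 + ?Y) * N) * ((s * \<Lambda> + 1) * (\<Lambda> powr (-\<kappa>) * (t - s)))"
      by (simp add: algebra_simps)
    also have "\<dots> \<le> G * ((1 + ?Y) * N) * ((T + 1) * (t - s) powr \<kappa>)"
    proof (rule mult_left_mono)
      \<comment> \<open>From \<open>\<Lambda> * (t - s) \<le> 1\<close>. The gained
        \<open>1 / \<Lambda>\<close> cancels the number \<open>s * \<Lambda> + 1\<close> of pieces
        and leaves \<open>s + 1 / \<Lambda>\<close>, at most \<open>T + 1\<close>.\<close>
      have "\<Lambda> powr (-\<kappa>) * (t - s) \<le> (t - s) powr \<kappa> / \<Lambda>"
      proof -
        have "\<Lambda> * (t - s) \<le> 1" using st \<Lambda> by (simp add: field_simps)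
        then have "(\<Lambda> * (t - s)) powr 1 \<le> (\<Lambda> * (t - s)) powr \<kappa>"
          using \<Lambda> st assms by (intro powr_mono') auto
        then have "\<Lambda> * (t - s) \<le> \<Lambda> powr \<kappa> * (t - s) powr \<kappa>" using \<Lambda> st by (simp add: powr_mult)
        then have "\<Lambda> powr (-\<kappa>) * (\<Lambda> * (t - s)) \<le> \<Lambda> powr (-\<kappa>) * (\<Lambda> powr \<kappa> * (t - s) powr \<kappa>)"
          by (intro mult_left_mono) auto
        also have "\<dots> = (t - s) powr \<kappa>" using \<Lambda> by (simp add: powr_minus field_simps)
        finally show ?thesis using \<Lambda> by (simp add: le_divide_eq algebra_simps)
      qed
      then have "(s * \<Lambda> + 1) * (\<Lambda> powr (-\<kappa>) * (t - s)) \<le> (s * \<Lambda> + 1) * ((t - s) powr \<kappa> / \<Lambda>)"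
        using st \<Lambda> by (intro mult_left_mono) auto
      also have "\<dots> = (s + 1 / \<Lambda>) * (t - s) powr \<kappa>" using \<Lambda> by (simp add: field_simps)
      also have "\<dots> \<le> (T + 1) * (t - s) powr \<kappa>"
      proof (rule mult_right_mono)
        have "1 / \<Lambda> \<le> 1" using assms by simp
        then show "s + 1 / \<Lambda> \<le> T + 1" using st by linarith
      qed simp
      finally show "(s * \<Lambda> + 1) * (\<Lambda> powr (-\<kappa>) * (t - s)) \<le> (T + 1) * (t - s) powr \<kappa>" .
      show "0 \<le> G * ((1 + ?Y) * N)" using Y assms by simp
    qed
    finally show ?thesis by (simp add: algebra_simps)
  qed
  ultimately have "\<bar>RS_integral p g 0 t - RS_integral q g 0 s\<bar>
      \<le> G * (t - s) powr \<kappa> * (M + ?Y * c) + G * (t - s) powr \<kappa> * ((T + 1) * ((1 + ?Y) * N))"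
    unfolding split diff by linarith
  then show ?thesis by (simp add: distrib_left)
qed

subsection \<open>Kernels satisfying (H1)\<close>

text \<open>Space and time increments are read off from (H1) with \<open>\<mu> = 1\<close>. For the
  mixed increment, the difference of the kernel at two fixed points \<open>(r,y)\<close> and
  \<open>(r',y')\<close> is a differentiable function of the outer time, and (H1) bounds its
  derivative; the mean value inequality does the rest.\<close>

lemma H1_kernel:
  fixes \<sigma> :: "real \<Rightarrow> real \<Rightarrow> real ^ 'd \<Rightarrow> 'e::euclidean_space"
  assumes H: "H1 T \<beta> 1 \<delta> K \<sigma>"
    and times: "t \<in> {0..T}" "s \<in> {0..T}" "r \<in> {0..T}" "r' \<in> {0..T}"
  shows H1_kernel_space: "norm (\<sigma> t r y - \<sigma> t r' y') \<le> K * (\<bar>r - r'\<bar> powr \<beta> + norm (y - y'))"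
    and H1_kernel_time: "norm (\<sigma> t r y - \<sigma> s r y) \<le> K * \<bar>t - s\<bar>"
    and H1_kernel_mixed: "norm ((\<sigma> t r y - \<sigma> s r y) - (\<sigma> t r' y' - \<sigma> s r' y'))
      \<le> K * \<bar>t - s\<bar> * (\<bar>r - r'\<bar> powr \<beta> + norm (y - y'))"
proof -
  have diff: "has_partial_t T \<sigma>"
    using H unfolding H1_def by (elim conjE)
  have lip: "\<forall>t\<in>{0..T}. \<forall>s\<in>{0..T}. \<forall>x y.
        norm (\<sigma> t s x - \<sigma> t s y) + norm (partial_t T \<sigma> t s x - partial_t T \<sigma> t s y) \<le> K * norm (x - y)"
    using H unfolding H1_def by (elim conjE)
  have time: "\<forall>t1\<in>{0..T}. \<forall>t2\<in>{0..T}. \<forall>s\<in>{0..T}. \<forall>i x.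
        norm (\<sigma> t1 s x - \<sigma> t2 s x) + norm (partial_x i \<sigma> t1 s x - partial_x i \<sigma> t2 s x)
          \<le> K * \<bar>t1 - t2\<bar> powr 1"
    using H unfolding H1_def by (elim conjE)
  have space: "\<forall>t\<in>{0..T}. \<forall>s1\<in>{0..T}. \<forall>s2\<in>{0..T}. \<forall>x.
        norm (\<sigma> t s1 x - \<sigma> t s2 x) + norm (partial_t T \<sigma> t s1 x - partial_t T \<sigma> t s2 x)
          \<le> K * \<bar>s1 - s2\<bar> powr \<beta>"
    using H unfolding H1_def by (elim conjE)
  note lip = lip[rule_format] and time = time[rule_format] and space = space[rule_format]
  have both: "norm (\<sigma> t r y - \<sigma> t r' y') \<le> K * (\<bar>r - r'\<bar> powr \<beta> + norm (y - y'))"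
     "norm (partial_t T \<sigma> t r y - partial_t T \<sigma> t r' y') \<le> K * (\<bar>r - r'\<bar> powr \<beta> + norm (y - y'))"
    if "t \<in> {0..T}" for t
  proof -
    note sp = space[OF that times(3,4), of y] and li = lip[OF that times(4), of y y']
    have "norm (\<sigma> t r y - \<sigma> t r' y') \<le> norm (\<sigma> t r y - \<sigma> t r' y) + norm (\<sigma> t r' y - \<sigma> t r' y')"
      using norm_triangle_ineq[of "\<sigma> t r y - \<sigma> t r' y" "\<sigma> t r' y - \<sigma> t r' y'"] by simp
    then show "norm (\<sigma> t r y - \<sigma> t r' y') \<le> K * (\<bar>r - r'\<bar> powr \<beta> + norm (y - y'))"
      using sp li norm_ge_zero[of "partial_t T \<sigma> t r y - partial_t T \<sigma> t r' y"]
        norm_ge_zero[of "partial_t T \<sigma> t r' y - partial_t T \<sigma> t r' y'"]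
      unfolding distrib_left by linarith
    have "norm (partial_t T \<sigma> t r y - partial_t T \<sigma> t r' y')
        \<le> norm (partial_t T \<sigma> t r y - partial_t T \<sigma> t r' y) + norm (partial_t T \<sigma> t r' y - partial_t T \<sigma> t r' y')"
      using norm_triangle_ineq[of "partial_t T \<sigma> t r y - partial_t T \<sigma> t r' y"
          "partial_t T \<sigma> t r' y - partial_t T \<sigma> t r' y'"] by simp
    then show "norm (partial_t T \<sigma> t r y - partial_t T \<sigma> t r' y') \<le> K * (\<bar>r - r'\<bar> powr \<beta> + norm (y - y'))"
      using sp li norm_ge_zero[of "\<sigma> t r y - \<sigma> t r' y"] norm_ge_zero[of "\<sigma> t r' y - \<sigma> t r' y'"]
      unfolding distrib_left by linarith
  qed
  show "norm (\<sigma> t r y - \<sigma> t r' y') \<le> K * (\<bar>r - r'\<bar> powr \<beta> + norm (y - y'))"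
    by (rule both(1)[OF times(1)])
  show "norm (\<sigma> t r y - \<sigma> s r y) \<le> K * \<bar>t - s\<bar>"
  proof -
    have "\<bar>t - s\<bar> powr 1 = \<bar>t - s\<bar>" by simp
    \<comment> \<open>The clause is quantified over directions \<open>i\<close>; any one will do,
      since its summand is nonnegative and is dropped.\<close>
    from time[OF times(1,2,3), of y undefined, unfolded this] show ?thesis
      using norm_ge_zero[of "partial_x undefined \<sigma> t r y - partial_x undefined \<sigma> s r y"] by linarith
  qed
  have vd: "((\<lambda>\<tau>. \<sigma> \<tau> r y) has_vector_derivative partial_t T \<sigma> \<tau> r y) (at \<tau> within {0..T})"
    if "\<tau> \<in> {0..T}" "r \<in> {0..T}" for \<tau> r y
    using diff that unfolding has_partial_t_def partial_t_def
    by (simp add: vector_derivative_works)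
  have "norm ((\<sigma> t r y - \<sigma> t r' y') - (\<sigma> s r y - \<sigma> s r' y'))
      \<le> K * (\<bar>r - r'\<bar> powr \<beta> + norm (y - y')) * norm (t - s)"
  proof (rule differentiable_bound[where S = "{0..T}"])
    fix \<tau> assume \<tau>: "\<tau> \<in> {0..T}"
    show "((\<lambda>\<tau>. \<sigma> \<tau> r y - \<sigma> \<tau> r' y') has_derivative
        (\<lambda>h. h *\<^sub>R (partial_t T \<sigma> \<tau> r y - partial_t T \<sigma> \<tau> r' y'))) (at \<tau> within {0..T})"
      using has_vector_derivative_diff[OF vd[OF \<tau> times(3)] vd[OF \<tau> times(4)]]
      by (simp add: has_vector_derivative_def)
    show "onorm (\<lambda>h. h *\<^sub>R (partial_t T \<sigma> \<tau> r y - partial_t T \<sigma> \<tau> r' y'))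
        \<le> K * (\<bar>r - r'\<bar> powr \<beta> + norm (y - y'))"
      using both(2)[OF \<tau>] by (intro onorm_le) (simp add: mult.commute[of "\<bar>_\<bar>"] mult_right_mono)
  qed (use times in auto)
  then show "norm ((\<sigma> t r y - \<sigma> s r y) - (\<sigma> t r' y' - \<sigma> s r' y'))
      \<le> K * \<bar>t - s\<bar> * (\<bar>r - r'\<bar> powr \<beta> + norm (y - y'))"
    by (simp add: algebra_simps)
qed

lemma scaled_hoelder_nth:
  "scaled_hoelder \<gamma> \<Lambda> c S p \<Longrightarrow> scaled_hoelder \<gamma> \<Lambda> c S (\<lambda>r. p r $ i)"
  unfolding scaled_hoelder_def
  by (metis Finite_Cartesian_Product.norm_nth_le order_trans vector_minus_component)

lemma scaled_hoelder_mult: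
  fixes p q :: "real \<Rightarrow> real"
  assumes "scaled_hoelder \<gamma> \<Lambda> c S p" "scaled_hoelder \<gamma> \<Lambda> c' S q"
    and "\<And>r. r \<in> S \<Longrightarrow> \<bar>p r\<bar> \<le> M" "\<And>r. r \<in> S \<Longrightarrow> \<bar>q r\<bar> \<le> M'" "0 \<le> c"
  shows "scaled_hoelder \<gamma> \<Lambda> (M * c' + c * M') S (\<lambda>r. p r * q r)"
  unfolding scaled_hoelder_def
proof (intro ballI impI)
  fix s t assume st: "s \<in> S" "t \<in> S" "\<bar>t - s\<bar> \<le> 1 / \<Lambda>"
  let ?X = "(\<Lambda> * \<bar>t - s\<bar>) powr \<gamma>"
  have p: "\<bar>p t - p s\<bar> \<le> c * ?X" and q: "\<bar>q t - q s\<bar> \<le> c' * ?X"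
    using scaled_hoelderD[OF assms(1) st] scaled_hoelderD[OF assms(2) st] by simp_all
  have "0 \<le> M" using assms(3)[OF st(1)] by linarith
  have "p t * q t - p s * q s = p t * (q t - q s) + (p t - p s) * q s" by (simp add: algebra_simps)
  then have "\<bar>p t * q t - p s * q s\<bar> \<le> \<bar>p t\<bar> * \<bar>q t - q s\<bar> + \<bar>p t - p s\<bar> * \<bar>q s\<bar>"
    by (metis abs_mult abs_triangle_ineq)
  also have "\<dots> \<le> M * (c' * ?X) + (c * ?X) * M'"
    using p q assms(3)[OF st(2)] assms(4)[OF st(1)] \<open>0 \<le> M\<close> \<open>0 \<le> c\<close>
    by (intro add_mono mult_mono) auto
  finally show "norm (p t * q t - p s * q s) \<le> (M * c' + c * M') * ?X" by (simp add: algebra_simps)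
qed

text \<open>In \<open>1 + q\<close> the 1 comes from the explicit dependence on the integration time
  and \<open>q\<close> from the path. Both are brought to the common exponent
  \<open>\<gamma>\<close> without a constant, since \<open>\<bar>r - r'\<bar> \<le> \<Lambda> *
  \<bar>r - r'\<bar> \<le> 1\<close>.\<close>

lemma H1_along_path:
  fixes \<sigma> :: "real \<Rightarrow> real \<Rightarrow> real ^ 'd \<Rightarrow> 'e::euclidean_space"
  assumes H: "H1 T \<beta> 1 \<delta> K \<sigma>" and x: "scaled_hoelder \<kappa> \<Lambda> q {0..T} x"
    and "1 \<le> \<Lambda>" "\<gamma> \<le> \<beta>" "\<gamma> \<le> \<kappa>" "0 \<le> q" and ts: "t \<in> {0..T}" "s \<in> {0..T}"
  shows "scaled_hoelder \<gamma> \<Lambda> (K * (1 + q)) {0..T} (\<lambda>r. \<sigma> t r (x r))"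
    and "scaled_hoelder \<gamma> \<Lambda> (K * \<bar>t - s\<bar> * (1 + q)) {0..T} (\<lambda>r. \<sigma> t r (x r) - \<sigma> s r (x r))"
proof -
  have K: "0 < K" and \<beta>: "0 < \<beta>" using H by (auto simp: H1_def)
  have *: "\<bar>r - r'\<bar> powr \<beta> + norm (x r - x r') \<le> (1 + q) * (\<Lambda> * \<bar>r - r'\<bar>) powr \<gamma>"
    if r: "r' \<in> {0..T}" "r \<in> {0..T}" "\<bar>r - r'\<bar> \<le> 1 / \<Lambda>" for r r'
  proof -
    have le: "\<bar>r - r'\<bar> \<le> \<Lambda> * \<bar>r - r'\<bar>" "\<Lambda> * \<bar>r - r'\<bar> \<le> 1"
      using r(3) \<open>1 \<le> \<Lambda>\<close> mult_right_mono[of 1 \<Lambda> "\<bar>r - r'\<bar>"] by (auto simp: field_simps)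
    have "\<bar>r - r'\<bar> powr \<beta> \<le> (\<Lambda> * \<bar>r - r'\<bar>) powr \<beta>" using le \<beta> by (intro powr_mono2) auto
    also have "\<dots> \<le> (\<Lambda> * \<bar>r - r'\<bar>) powr \<gamma>" using le \<open>\<gamma> \<le> \<beta>\<close> \<open>1 \<le> \<Lambda>\<close> by (intro powr_mono') auto
    finally have 1: "\<bar>r - r'\<bar> powr \<beta> \<le> (\<Lambda> * \<bar>r - r'\<bar>) powr \<gamma>" .
    have "scaled_hoelder \<gamma> \<Lambda> q {0..T} x"
      using x \<open>\<gamma> \<le> \<kappa>\<close> \<open>0 \<le> q\<close> \<open>1 \<le> \<Lambda>\<close> by (intro scaled_hoelder_weaken[OF x]) auto
    from scaled_hoelderD[OF this r] 1 show ?thesis by (simp add: algebra_simps)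
  qed
  show "scaled_hoelder \<gamma> \<Lambda> (K * (1 + q)) {0..T} (\<lambda>r. \<sigma> t r (x r))"
    unfolding scaled_hoelder_def
  proof (intro ballI impI)
    fix r' r assume r: "r' \<in> {0..T}" "r \<in> {0..T}" "\<bar>r - r'\<bar> \<le> 1 / \<Lambda>"
    have "norm (\<sigma> t r (x r) - \<sigma> t r' (x r')) \<le> K * (\<bar>r - r'\<bar> powr \<beta> + norm (x r - x r'))"
      by (rule H1_kernel_space[OF H ts r(2,1)])
    also have "\<dots> \<le> K * ((1 + q) * (\<Lambda> * \<bar>r - r'\<bar>) powr \<gamma>)"
      using *[OF r] K by (intro mult_left_mono) auto
    finally show "norm (\<sigma> t r (x r) - \<sigma> t r' (x r')) \<le> K * (1 + q) * (\<Lambda> * \<bar>r - r'\<bar>) powr \<gamma>"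
      by simp
  qed
  show "scaled_hoelder \<gamma> \<Lambda> (K * \<bar>t - s\<bar> * (1 + q)) {0..T} (\<lambda>r. \<sigma> t r (x r) - \<sigma> s r (x r))"
    unfolding scaled_hoelder_def
  proof (intro ballI impI)
    fix r' r assume r: "r' \<in> {0..T}" "r \<in> {0..T}" "\<bar>r - r'\<bar> \<le> 1 / \<Lambda>"
    have "norm ((\<sigma> t r (x r) - \<sigma> s r (x r)) - (\<sigma> t r' (x r') - \<sigma> s r' (x r')))
        \<le> K * \<bar>t - s\<bar> * (\<bar>r - r'\<bar> powr \<beta> + norm (x r - x r'))"
      by (rule H1_kernel_mixed[OF H ts r(2,1)])
    also have "\<dots> \<le> K * \<bar>t - s\<bar> * ((1 + q) * (\<Lambda> * \<bar>r - r'\<bar>) powr \<gamma>)"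
      using *[OF r] K by (intro mult_left_mono) auto
    finally show "norm ((\<sigma> t r (x r) - \<sigma> s r (x r)) - (\<sigma> t r' (x r') - \<sigma> s r' (x r')))
        \<le> K * \<bar>t - s\<bar> * (1 + q) * (\<Lambda> * \<bar>r - r'\<bar>) powr \<gamma>"
      by simp
  qed
qed

subsection \<open>Lebesgue integrals along paths\<close>

lemma hoelder_on_imp_continuous_on:
  assumes "hoelder_on \<gamma> c S p" "0 < \<gamma>"
  shows "continuous_on S p"
  unfolding continuous_on_def
proof
  fix s assume s: "s \<in> S"
  have "((\<lambda>t. p t - p s) \<longlongrightarrow> 0) (at s within S)"
  proof (rule Lim_null_comparison)
    show "\<forall>\<^sub>F t in at s within S. norm (p t - p s) \<le> c * \<bar>t - s\<bar> powr \<gamma>"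
      using hoelder_onD[OF assms(1) s] by (auto simp: eventually_at_filter)
    have "((\<lambda>t. \<bar>t - s\<bar>) \<longlongrightarrow> 0) (at s within S)"
      by (rule tendsto_eq_intros refl | simp)+
    then have "((\<lambda>t. \<bar>t - s\<bar> powr \<gamma>) \<longlongrightarrow> 0) (at s within S)"
      using \<open>0 < \<gamma>\<close> by (auto intro!: tendsto_zero_powrI[where b = \<gamma>])
    then show "((\<lambda>t. c * \<bar>t - s\<bar> powr \<gamma>) \<longlongrightarrow> 0) (at s within S)"
      by (rule tendsto_mult_right_zero)
  qed
  then show "(p \<longlongrightarrow> p s) (at s within S)" by (rule Lim_null[THEN iffD2])
qed

lemma norm_matrix_vector_mult_le:
  fixes A :: "real ^ 'n ^ 'm"
  shows "norm (A *v v) \<le> norm A * norm v"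
proof -
  have "norm (A *v v) = L2_set (\<lambda>i. norm (A $ i \<bullet> v)) UNIV"
    by (simp add: norm_vec_def matrix_vector_mul_component)
  also have "\<dots> \<le> L2_set (\<lambda>i. norm (A $ i) * norm v) UNIV"
    by (intro L2_set_mono) (auto intro: Cauchy_Schwarz_ineq2)
  also have "\<dots> = norm A * norm v"
    by (simp add: norm_vec_def[of A] L2_set_left_distrib)
  finally show ?thesis .
qed

lemma bounded_bilinear_matrix_vector_mult:
  "bounded_bilinear (\<lambda>(A :: real ^ 'n ^ 'm) v. A *v v)"
proof
  show "\<exists>K. \<forall>(A :: real ^ 'n ^ 'm) v. norm (A *v v) \<le> norm A * norm v * K"
    by (rule exI[of _ 1]) (simp add: norm_matrix_vector_mult_le)
qed (simp_all add: matrix_vector_mult_add_rdistrib matrix_vector_right_distrib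
       scaleR_matrix_vector_assoc[symmetric] matrix_vector_mult_scaleR)

lemma set_integral_norm_le:
  fixes p :: "real \<Rightarrow> 'e::euclidean_space"
  assumes "set_integrable lborel {s..t} p" "s \<le> t" "\<And>r. r \<in> {s..t} \<Longrightarrow> norm (p r) \<le> M"
  shows "norm (LINT r:{s..t}|lborel. p r) \<le> M * (t - s)"
proof -
  have "norm (LINT r:{s..t}|lborel. p r) \<le> (LINT r:{s..t}|lborel. norm (p r))"
    by (rule set_integral_norm_bound[OF assms(1)])
  also have "\<dots> \<le> (LINT r:{s..t}|lborel. M)"
  proof (rule set_integral_mono)
    show "set_integrable lborel {s..t} (\<lambda>r. norm (p r))" using assms(1) by (rule set_integrable_norm)
    show "set_integrable lborel {s..t} (\<lambda>r. M)" by (auto simp: set_integrable_def emeasure_lborel_Icc_eq intro!: integrable_real_indicator)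
  qed (use assms in auto)
  also have "\<dots> = M * (t - s)" using \<open>s \<le> t\<close> by (simp add: set_lebesgue_integral_def)
  finally show ?thesis .
qed

lemma set_integral_point:
  fixes p :: "real \<Rightarrow> 'e::euclidean_space"
  shows "(LINT r:{a..a}|lborel. p r) = 0"
  unfolding set_lebesgue_integral_def
  by (rule integral_eq_zero_AE) (use AE_lborel_singleton[of a] in \<open>eventually_elim; simp\<close>)

text \<open>The Lebesgue counterpart of the splitting in \<open>RS_integral_increment_le\<close>:
  new interval of integration plus change of the kernel.\<close>

lemma set_integral_split_diff:
  fixes p q :: "real \<Rightarrow> 'e::euclidean_space"
  assumes p: "set_integrable lborel {0..t} p" and q: "set_integrable lborel {0..s} q" and st: "0 \<le> s" "s \<le> t"
  shows "(LINT r:{0..t}|lborel. p r) - (LINT r:{0..s}|lborel. q r)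
    = (LINT r:{s..t}|lborel. p r) + (LINT r:{0..s}|lborel. p r - q r)"
proof -
  have p0: "set_integrable lborel {0..s} p" "set_integrable lborel {s..t} p"
    using st by (auto intro: set_integrable_subset[OF p])
  have "(LINT r:{0..s} \<union> {s..t}|lborel. p r) = (LINT r:{0..s}|lborel. p r) + (LINT r:{s..t}|lborel. p r)"
  proof (rule set_integral_Un_AE)
    show "AE r in lborel. \<not> (r \<in> {0..s} \<and> r \<in> {s..t})"
      using AE_lborel_singleton[of s] by eventually_elim auto
  qed (use p0 in auto)
  moreover have "{0..s} \<union> {s..t} = {0..t}" using st by auto
  ultimately show ?thesis using set_integral_diff(2)[OF p0(1) q] by simp
qed

lemma set_integrable_bounded_interval:
  fixes p :: "real \<Rightarrow> 'e::euclidean_space"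
  assumes "p \<in> borel_measurable (restrict_space borel {a..b})" "\<And>r. r \<in> {a..b} \<Longrightarrow> norm (p r) \<le> M"
  shows "set_integrable lborel {a..b} p"
  unfolding set_integrable_def
proof (rule integrableI_bounded_set[where A = "{a..b}" and B = M])
  show "(\<lambda>r. indicator {a..b} r *\<^sub>R p r) \<in> borel_measurable lborel"
    using assms(1) by (subst (asm) borel_measurable_restrict_space_iff) (auto simp: measurable_lborel1)
  show "AE r\<in>{a..b} in lborel. norm (indicator {a..b} r *\<^sub>R p r) \<le> M"
    using assms(2) by (auto simp: indicator_def)
qed (auto simp: emeasure_lborel_Icc_eq)

lemma measurable3_along_path:
  assumes "measurable3 T \<phi>" "continuous_on {0..T} x" "t \<in> {0..T}"
  shows "(\<lambda>r. \<phi> t r (x r)) \<in> borel_measurable (restrict_space borel {0..T})"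
proof -
  have "(\<lambda>r. (t, r, x r)) \<in> borel_measurable (restrict_space borel {0..T})"
    using assms(2) by (intro borel_measurable_continuous_on_restrict continuous_intros)
  then have "(\<lambda>r. (t, r, x r)) \<in> restrict_space borel {0..T} \<rightarrow>\<^sub>M restrict_space borel ({0..T} \<times> {0..T} \<times> UNIV)"
    using assms(3) by (intro measurable_restrict_space2) (auto simp: space_restrict_space)
  from measurable_compose[OF this assms(1)[unfolded measurable3_def]] show ?thesis by simp
qed

subsection \<open>The linear equation\<close>

text \<open>The left side of \<open>small\<close> is what the increments of the Volterra operator
  cost for a path of size 1: the drift, and \<open>d * d * m\<close> scalar Young integrals with
  integrand of supremum \<open>Fb\<close>, oscillation \<open>Fb + 2 * K\<close> and dependence
  \<open>3 * K\<close> on the outer time. The factor \<open>2 * K\<close> is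
  \<open>K * (1 + q)\<close> with \<open>q = 1\<close>, which is why \<open>x_hoelder\<close> has
  the constant 1. The quarter leaves room for a supremum bound by one half.\<close>

locale linear_young =
  fixes T \<alpha> \<beta> \<delta> K L G \<Lambda> Hb Fb :: real
    and h :: "real \<Rightarrow> real \<Rightarrow> real ^ 'd \<Rightarrow> real ^ 'd ^ 'd"
    and f :: "real \<Rightarrow> real \<Rightarrow> real ^ 'd \<Rightarrow> real ^ 'm ^ 'd ^ 'd"
    and g :: "real \<Rightarrow> real ^ 'm" and x :: "real \<Rightarrow> real ^ 'd"
  assumes T: "0 < T" and \<alpha>: "0 < \<alpha>" "\<alpha> < 1 / 2" "\<alpha> < \<beta>" and L: "0 \<le> L" and G: "0 \<le> G"
    and \<Lambda>: "1 \<le> \<Lambda>"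
    and f_H1: "H1 T \<beta> 1 \<delta> K f"
    and f_bound: "\<And>t s y. t \<in> {0..T} \<Longrightarrow> s \<in> {0..T} \<Longrightarrow> norm (f t s y) \<le> Fb"
    and h_meas: "measurable3 T h"
    and h_bound: "\<And>t s y. t \<in> {0..T} \<Longrightarrow> s \<in> {0..T} \<Longrightarrow> norm (h t s y) \<le> Hb"
    and h_lipschitz: "\<And>t t' s y. t \<in> {0..T} \<Longrightarrow> t' \<in> {0..T} \<Longrightarrow> s \<in> {0..T} \<Longrightarrow>
      norm (h t s y - h t' s y) \<le> L * \<bar>t - t'\<bar>"
    and g_hoelder: "hoelder_on (1 - \<alpha>) G {0..T} g"
    and x_continuous_on: "continuous_on {0..T} x"
    and x_hoelder: "scaled_hoelder (1 - \<alpha>) \<Lambda> 1 {0..T} x"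
    and small: "Hb + L * T + real CARD('d) * real CARD('d) * real CARD('m) * G *
        (Fb + young_const (min \<beta> (1 - \<alpha>) + (1 - \<alpha>)) * (Fb + 2 * K)
          + (T + 1) * ((1 + young_const (min \<beta> (1 - \<alpha>) + (1 - \<alpha>))) * (3 * K)))
      \<le> \<Lambda> powr (1 - \<alpha>) / 4"
begin

abbreviation \<kappa> :: real where "\<kappa> \<equiv> 1 - \<alpha>"

abbreviation \<gamma> :: real where "\<gamma> \<equiv> min \<beta> (1 - \<alpha>)"

definition growth :: "real \<Rightarrow> real" where "growth t = exp (\<Lambda> * t)"

definition volterra :: "(real \<Rightarrow> real ^ 'd) \<Rightarrow> real \<Rightarrow> real ^ 'd" where
  "volterra u t = (LINT r:{0..t}|lborel. h t r (x r) *v u r) +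
     (\<chi> i. \<Sum>k\<in>UNIV. \<Sum>l\<in>UNIV.
        RS_integral (\<lambda>r. f t r (x r) $ i $ k $ l * u r $ k) (\<lambda>r. g r $ l) 0 t)"

text \<open>A ball of radius \<open>B\<close> in a weighted Hoelder norm. The weight of an increment
  is taken at the right end of \<open>[0,t]\<close>, so that estimates at time \<open>t\<close>
  involve the path up to \<open>t\<close> only.\<close>

definition controlled :: "real \<Rightarrow> (real \<Rightarrow> real ^ 'd) \<Rightarrow> bool" where
  "controlled B u \<longleftrightarrow> (\<forall>t\<in>{0..T}. norm (u t) \<le> B * growth t \<and> scaled_hoelder \<kappa> \<Lambda> (B * growth t) {0..t} u)"

lemma exponents: "0 < \<gamma>" "0 < \<kappa>" "\<kappa> \<le> 1" "1 < \<gamma> + \<kappa>" "\<gamma> \<le> \<beta>" "\<gamma> \<le> \<kappa>"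
  using \<alpha> by (auto simp: min_def)

lemma K_pos: "0 < K"
  using f_H1 by (simp add: H1_def)

lemma bounds_nonneg: "0 \<le> Hb" "0 \<le> Fb"
  using order_trans[OF norm_ge_zero h_bound[of 0 0]] order_trans[OF norm_ge_zero f_bound[of 0 0]] T by auto

lemma growth_pos: "0 < growth t"
  by (simp add: growth_def)

lemma growth_mono: "s \<le> t \<Longrightarrow> growth s \<le> growth t"
  using \<Lambda> by (simp add: growth_def)

lemma controlledI:
  assumes "0 \<le> B" "\<And>t. t \<in> {0..T} \<Longrightarrow> norm (u t) \<le> B * growth t"
    and "\<And>s t. 0 \<le> s \<Longrightarrow> s \<le> t \<Longrightarrow> t \<le> T \<Longrightarrow> t - s \<le> 1 / \<Lambda> \<Longrightarrow>
      norm (u t - u s) \<le> B * growth t * (\<Lambda> * (t - s)) powr \<kappa>"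
  shows "controlled B u"
  unfolding controlled_def scaled_hoelder_def
proof (intro ballI conjI impI)
  fix \<tau> s t assume \<tau>: "\<tau> \<in> {0..T}" and st: "s \<in> {0..\<tau>}" "t \<in> {0..\<tau>}" "\<bar>t - s\<bar> \<le> 1 / \<Lambda>"
  have "norm (u t - u s) \<le> B * growth (max s t) * (\<Lambda> * \<bar>t - s\<bar>) powr \<kappa>"
    using assms(3)[of s t] assms(3)[of t s] \<tau> st
    by (cases "s \<le> t") (auto simp: max_def norm_minus_commute abs_if split: if_splits)
  also have "\<dots> \<le> B * growth \<tau> * (\<Lambda> * \<bar>t - s\<bar>) powr \<kappa>"
    using \<open>0 \<le> B\<close> st by (intro mult_right_mono mult_left_mono growth_mono) auto
  finally show "norm (u t - u s) \<le> B * growth \<tau> * (\<Lambda> * \<bar>t - s\<bar>) powr \<kappa>" .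
qed (use assms in auto)

lemma controlled_norm: "controlled B u \<Longrightarrow> t \<in> {0..T} \<Longrightarrow> norm (u t) \<le> B * growth t"
  by (auto simp: controlled_def)

lemma controlled_scaled:
  "controlled B u \<Longrightarrow> t \<in> {0..T} \<Longrightarrow> scaled_hoelder \<kappa> \<Lambda> (B * growth t) {0..t} u"
  by (auto simp: controlled_def)

lemma controlled_norm_le: "controlled B u \<Longrightarrow> 0 \<le> B \<Longrightarrow> t \<in> {0..T} \<Longrightarrow> r \<in> {0..t} \<Longrightarrow> norm (u r) \<le> B * growth t"
  using controlled_norm[of B u r] growth_mono[of r t] mult_left_mono[of "growth r" "growth t" B] by auto

lemma controlled_diff_le:
  assumes "controlled B u" "0 \<le> s" "s \<le> t" "t \<le> T" "t - s \<le> 1 / \<Lambda>"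
  shows "norm (u t - u s) \<le> B * growth t * (\<Lambda> * (t - s)) powr \<kappa>"
  using scaled_hoelderD[OF controlled_scaled[OF assms(1), of t], of s t] assms by auto

lemma controlled_hoelder_on:
  assumes "controlled B u" "0 \<le> B"
  shows "hoelder_on \<kappa> (3 * B * growth T * \<Lambda> powr \<kappa>) {0..T} u"
proof -
  have "hoelder_on \<kappa> ((B * growth T + 2 * (B * growth T)) * \<Lambda> powr \<kappa>) {0..T} u"
    using controlled_scaled[OF assms(1), of T] controlled_norm_le[OF assms, of T] T assms(2) \<Lambda> exponents growth_pos[of T]
    by (intro hoelder_on_if_scaled_hoelder) auto
  then show ?thesis by (simp add: algebra_simps)
qed

lemma controlled_continuous_on: "controlled B u \<Longrightarrow> 0 \<le> B \<Longrightarrow> continuous_on {0..T} u"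
  using controlled_hoelder_on exponents hoelder_on_imp_continuous_on by blast

text \<open>The outer time of the kernel and the end of the interval are independent, because the
  memory part integrates the kernel of time \<open>t\<close> over \<open>[0,s]\<close>.\<close>

lemma drift_integrable:
  assumes u: "controlled B u" "0 \<le> B" and t: "t \<in> {0..T}" and s: "s \<in> {0..T}"
  shows "set_integrable lborel {0..s} (\<lambda>r. h t r (x r) *v u r)"
proof -
  have meas: "(\<lambda>r. h t r (x r) *v u r) \<in> borel_measurable (restrict_space borel {0..T})"
  proof (rule borel_measurable_continuous_Pair[where H = "(*v)"])
    show "(\<lambda>r. h t r (x r)) \<in> borel_measurable (restrict_space borel {0..T})"
      by (rule measurable3_along_path[OF h_meas x_continuous_on t])
    show "u \<in> borel_measurable (restrict_space borel {0..T})"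
      by (rule borel_measurable_continuous_on_restrict[OF controlled_continuous_on[OF u]])
    show "continuous_on UNIV (\<lambda>p :: (real ^ 'd ^ 'd) \<times> (real ^ 'd). fst p *v snd p)"
      by (intro bounded_bilinear.continuous_on[OF bounded_bilinear_matrix_vector_mult] continuous_intros)
  qed
  have "set_integrable lborel {0..T} (\<lambda>r. h t r (x r) *v u r)"
  proof (rule set_integrable_bounded_interval[OF meas])
    fix r assume r: "r \<in> {0..T}"
    have "norm (h t r (x r) *v u r) \<le> norm (h t r (x r)) * norm (u r)" by (rule norm_matrix_vector_mult_le)
    also have "\<dots> \<le> Hb * (B * growth T)"
      using h_bound[OF t r] controlled_norm_le[OF u, of T r] r T bounds_nonneg by (intro mult_mono) auto
    finally show "norm (h t r (x r) *v u r) \<le> Hb * (B * growth T)" .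
  qed
  then show ?thesis using s by (auto intro: set_integrable_subset)
qed

lemma drift_increment_le:
  assumes u: "controlled B u" "0 \<le> B" and st: "0 \<le> s" "s \<le> t" "t \<le> T" "t - s \<le> 1 / \<Lambda>"
  shows "norm ((LINT r:{0..t}|lborel. h t r (x r) *v u r) - (LINT r:{0..s}|lborel. h s r (x r) *v u r))
    \<le> (Hb + L * T) * (B * growth t) * (t - s) powr \<kappa>"
proof -
  have t: "t \<in> {0..T}" and s: "s \<in> {0..T}" using st by auto
  define E where "E = B * growth t"
  have E: "0 \<le> E" using u growth_pos[of t] by (simp add: E_def)
  have uE: "norm (u r) \<le> E" if "r \<in> {0..t}" for r unfolding E_def by (rule controlled_norm_le[OF u t that])
  have it: "set_integrable lborel {0..t} (\<lambda>r. h t r (x r) *v u r)"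
    and itt: "set_integrable lborel {0..s} (\<lambda>r. h t r (x r) *v u r)"
    and is': "set_integrable lborel {0..s} (\<lambda>r. h s r (x r) *v u r)"
    using drift_integrable[OF u] s t by blast+
  have "norm (LINT r:{s..t}|lborel. h t r (x r) *v u r) \<le> Hb * E * (t - s)"
  proof (rule set_integral_norm_le)
    show "set_integrable lborel {s..t} (\<lambda>r. h t r (x r) *v u r)"
      using st by (intro set_integrable_subset[OF it]) auto
    fix r assume r: "r \<in> {s..t}"
    have "norm (h t r (x r) *v u r) \<le> norm (h t r (x r)) * norm (u r)" by (rule norm_matrix_vector_mult_le)
    also have "\<dots> \<le> Hb * E" using h_bound[OF t, of r] uE[of r] r st bounds_nonneg by (intro mult_mono) auto
    finally show "norm (h t r (x r) *v u r) \<le> Hb * E" .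
  qed (use st in auto)
  moreover have "norm (LINT r:{0..s}|lborel. h t r (x r) *v u r - h s r (x r) *v u r) \<le> (L * (t - s) * E) * (s - 0)"
  proof (rule set_integral_norm_le)
    show "set_integrable lborel {0..s} (\<lambda>r. h t r (x r) *v u r - h s r (x r) *v u r)"
      by (rule set_integral_diff(1)[OF itt is'])
    fix r assume r: "r \<in> {0..s}"
    have "norm (h t r (x r) *v u r - h s r (x r) *v u r) \<le> norm (h t r (x r) - h s r (x r)) * norm (u r)"
      by (metis matrix_vector_mult_diff_rdistrib norm_matrix_vector_mult_le)
    also have "\<dots> \<le> L * (t - s) * E"
      using h_lipschitz[OF t s, of r] uE[of r] r st L by (intro mult_mono) auto
    finally show "norm (h t r (x r) *v u r - h s r (x r) *v u r) \<le> L * (t - s) * E" .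
  qed (use st in auto)
  moreover have "(L * (t - s) * E) * (s - 0) \<le> L * T * E * (t - s)"
  proof -
    have "(L * (t - s) * E) * s \<le> (L * (t - s) * E) * T" using st L E by (intro mult_left_mono) auto
    then show ?thesis by (simp add: algebra_simps)
  qed
  ultimately have "norm ((LINT r:{0..t}|lborel. h t r (x r) *v u r) - (LINT r:{0..s}|lborel. h s r (x r) *v u r))
      \<le> Hb * E * (t - s) + L * T * E * (t - s)"
    unfolding set_integral_split_diff[OF it is' st(1,2)]
    by (intro order_trans[OF norm_triangle_ineq]) linarith
  also have "\<dots> = (Hb + L * T) * E * (t - s)" by (simp add: algebra_simps)
  also have "\<dots> \<le> (Hb + L * T) * E * (t - s) powr \<kappa>"
  proof (rule mult_left_mono)
    have "1 / \<Lambda> \<le> 1" using \<Lambda> by simp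
    then have "t - s \<le> 1" using st by linarith
    then have "(t - s) powr 1 \<le> (t - s) powr \<kappa>" using st exponents by (intro powr_mono') auto
    then show "t - s \<le> (t - s) powr \<kappa>" using st by simp
    show "0 \<le> (Hb + L * T) * E" using bounds_nonneg L T E by simp
  qed
  finally show ?thesis by (simp add: E_def)
qed

abbreviation Y :: real where "Y \<equiv> young_const (\<gamma> + \<kappa>)"

lemma kernel_component_le: "norm (F $ i $ k $ l :: real) \<le> norm (F :: real ^ 'm ^ 'd ^ 'd)"
  by (meson Finite_Cartesian_Product.norm_nth_le order_trans)

text \<open>The four inputs of \<open>RS_integral_increment_le\<close>. The product rule gives the
  oscillation \<open>Fb + 2 * K\<close> for the kernel, and \<open>K + 2 * K\<close> for its
  increment in the outer time.\<close>

lemma kernel_scaled: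
  assumes u: "controlled B u" "0 \<le> B" and t: "t \<in> {0..T}" "s \<in> {0..T}" "t \<le> \<tau>" "\<tau> \<in> {0..T}"
  shows "\<And>r. r \<in> {0..\<tau>} \<Longrightarrow> \<bar>f t r (x r) $ i $ k $ l * u r $ k\<bar> \<le> Fb * (B * growth \<tau>)"
    and "scaled_hoelder \<gamma> \<Lambda> ((Fb + 2 * K) * (B * growth \<tau>)) {0..\<tau>} (\<lambda>r. f t r (x r) $ i $ k $ l * u r $ k)"
    and "\<And>r. r \<in> {0..\<tau>} \<Longrightarrow> \<bar>f t r (x r) $ i $ k $ l * u r $ k - f s r (x r) $ i $ k $ l * u r $ k\<bar>
      \<le> 3 * K * (B * growth \<tau>) * \<bar>t - s\<bar>"
    and "scaled_hoelder \<gamma> \<Lambda> (3 * K * (B * growth \<tau>) * \<bar>t - s\<bar>) {0..\<tau>}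
      (\<lambda>r. f t r (x r) $ i $ k $ l * u r $ k - f s r (x r) $ i $ k $ l * u r $ k)"
proof -
  define E where "E = B * growth \<tau>"
  have E: "0 \<le> E" using u growth_pos[of \<tau>] by (simp add: E_def)
  have sub: "{0..\<tau>} \<subseteq> {0..T}" using t by auto
  have uE: "\<bar>u r $ k\<bar> \<le> E" if "r \<in> {0..\<tau>}" for r
    using controlled_norm_le[OF u t(4) that] component_le_norm_cart[of "u r" k] by (simp add: E_def)
  have us: "scaled_hoelder \<gamma> \<Lambda> E {0..\<tau>} (\<lambda>r. u r $ k)"
    using scaled_hoelder_weaken[OF controlled_scaled[OF u(1) t(4)], of E \<gamma>] E \<Lambda> exponents
    by (intro scaled_hoelder_nth) (auto simp: E_def)
  note path = H1_along_path[OF f_H1 x_hoelder \<Lambda> exponents(5,6) _ t(1,2), simplified]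
  have F: "scaled_hoelder \<gamma> \<Lambda> (K * 2) {0..\<tau>} (\<lambda>r. f t r (x r) $ i $ k $ l)"
    by (intro scaled_hoelder_nth scaled_hoelder_subset[OF path(1) sub])
  have "scaled_hoelder \<gamma> \<Lambda> (K * \<bar>t - s\<bar> * 2) {0..\<tau>} (\<lambda>r. (f t r (x r) - f s r (x r)) $ i $ k $ l)"
    by (intro scaled_hoelder_nth scaled_hoelder_subset[OF path(2) sub])
  then have dF: "scaled_hoelder \<gamma> \<Lambda> (K * \<bar>t - s\<bar> * 2) {0..\<tau>} (\<lambda>r. f t r (x r) $ i $ k $ l - f s r (x r) $ i $ k $ l)"
    by simp
  have Fb: "\<bar>f t r (x r) $ i $ k $ l\<bar> \<le> Fb" if "r \<in> {0..\<tau>}" for r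
    using f_bound[OF t(1), of r "x r"] kernel_component_le[of "f t r (x r)" i k l] that sub by auto
  have dFb: "\<bar>f t r (x r) $ i $ k $ l - f s r (x r) $ i $ k $ l\<bar> \<le> K * \<bar>t - s\<bar>" if "r \<in> {0..\<tau>}" for r
  proof -
    have r: "r \<in> {0..T}" using that sub by auto
    show ?thesis using H1_kernel_time[OF f_H1 t(1,2) r r, of "x r"]
        kernel_component_le[of "f t r (x r) - f s r (x r)" i k l] by simp
  qed
  show "\<bar>f t r (x r) $ i $ k $ l * u r $ k\<bar> \<le> Fb * (B * growth \<tau>)" if "r \<in> {0..\<tau>}" for r
    using Fb[OF that] uE[OF that] bounds_nonneg unfolding abs_mult E_def by (intro mult_mono) auto
  have "scaled_hoelder \<gamma> \<Lambda> (Fb * E + K * 2 * E) {0..\<tau>} (\<lambda>r. f t r (x r) $ i $ k $ l * u r $ k)"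
    using K_pos by (intro scaled_hoelder_mult F us Fb uE) auto
  then show "scaled_hoelder \<gamma> \<Lambda> ((Fb + 2 * K) * (B * growth \<tau>)) {0..\<tau>} (\<lambda>r. f t r (x r) $ i $ k $ l * u r $ k)"
    by (simp add: E_def algebra_simps)
  show "\<bar>f t r (x r) $ i $ k $ l * u r $ k - f s r (x r) $ i $ k $ l * u r $ k\<bar>
      \<le> 3 * K * (B * growth \<tau>) * \<bar>t - s\<bar>" if "r \<in> {0..\<tau>}" for r
  proof -
    have "\<bar>(f t r (x r) $ i $ k $ l - f s r (x r) $ i $ k $ l) * u r $ k\<bar> \<le> (K * \<bar>t - s\<bar>) * E"
      unfolding abs_mult using dFb[OF that] uE[OF that] K_pos by (intro mult_mono) auto
    \<comment> \<open>Enlarged to the constant of the oscillation, since supremum and oscillation of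
      the kernel increment share one \<open>N\<close> in
      \<open>RS_integral_increment_le\<close>.\<close>
    also have "\<dots> \<le> 3 * (K * \<bar>t - s\<bar> * E)" using K_pos E by simp
    finally show ?thesis unfolding left_diff_distrib by (simp add: E_def mult_ac)
  qed
  have "scaled_hoelder \<gamma> \<Lambda> (K * \<bar>t - s\<bar> * E + K * \<bar>t - s\<bar> * 2 * E) {0..\<tau>}
      (\<lambda>r. (f t r (x r) $ i $ k $ l - f s r (x r) $ i $ k $ l) * u r $ k)"
    using K_pos by (intro scaled_hoelder_mult dF us dFb uE) auto
  moreover have "K * \<bar>t - s\<bar> * E + K * \<bar>t - s\<bar> * 2 * E = 3 * K * (B * growth \<tau>) * \<bar>t - s\<bar>"
    by (simp add: E_def)
  ultimately show "scaled_hoelder \<gamma> \<Lambda> (3 * K * (B * growth \<tau>) * \<bar>t - s\<bar>) {0..\<tau>}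
      (\<lambda>r. f t r (x r) $ i $ k $ l * u r $ k - f s r (x r) $ i $ k $ l * u r $ k)"
    by (simp add: left_diff_distrib)
qed

lemma g_nth_hoelder: "hoelder_on \<kappa> G S (\<lambda>r. g r $ l)" if "S \<subseteq> {0..T}"
  using hoelder_on_subset[OF g_hoelder that] unfolding hoelder_on_def
  by (metis Finite_Cartesian_Product.norm_nth_le order_trans vector_minus_component)

lemma kernel_RS_integrable:
  assumes u: "controlled B u" "0 \<le> B" and t: "t \<in> {0..T}"
  shows "RS_integrable (\<lambda>r. f t r (x r) $ i $ k $ l * u r $ k) (\<lambda>r. g r $ l) 0 t"
proof -
  note ks = kernel_scaled[OF u t t order_refl t, where i = i and k = k and l = l]
  have E: "0 \<le> B * growth t" using u growth_pos[of t] by simp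
  have c: "0 \<le> ((Fb + 2 * K) * (B * growth t) + 2 * (Fb * (B * growth t))) * \<Lambda> powr \<gamma>"
    using E bounds_nonneg K_pos by simp
  have "hoelder_on \<gamma> (((Fb + 2 * K) * (B * growth t) + 2 * (Fb * (B * growth t))) * \<Lambda> powr \<gamma>) {0..t}
      (\<lambda>r. f t r (x r) $ i $ k $ l * u r $ k)"
    by (rule hoelder_on_if_scaled_hoelder[OF ks(2)]) (use ks(1) E bounds_nonneg K_pos \<Lambda> exponents in auto)
  then show ?thesis
    by (rule RS_integrable_young[rotated 6, where \<kappa> = \<kappa> and G = G]) (use t exponents c G g_nth_hoelder in auto)
qed

lemma volterra_diff:
  assumes u: "controlled B u" "0 \<le> B" and v: "controlled B' v" "0 \<le> B'" and t: "t \<in> {0..T}"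
  shows "volterra (\<lambda>r. u r - v r) t = volterra u t - volterra v t"
proof -
  have "(LINT r:{0..t}|lborel. h t r (x r) *v (u r - v r))
      = (LINT r:{0..t}|lborel. h t r (x r) *v u r) - (LINT r:{0..t}|lborel. h t r (x r) *v v r)"
    using set_integral_diff(2)[OF drift_integrable[OF u t t] drift_integrable[OF v t t]]
    by (simp add: matrix_vector_mult_diff_distrib)
  moreover have "RS_integral (\<lambda>r. f t r (x r) $ i $ k $ l * (u r - v r) $ k) (\<lambda>r. g r $ l) 0 t
      = RS_integral (\<lambda>r. f t r (x r) $ i $ k $ l * u r $ k) (\<lambda>r. g r $ l) 0 t
        - RS_integral (\<lambda>r. f t r (x r) $ i $ k $ l * v r $ k) (\<lambda>r. g r $ l) 0 t" for i k l
    using RS_integral_diff(2)[OF kernel_RS_integrable[OF u t] kernel_RS_integrable[OF v t], of i k l]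
    by (simp add: right_diff_distrib)
  ultimately show ?thesis
    unfolding volterra_def by (simp add: sum_subtractf vec_eq_iff)
qed

text \<open>Drift and Young integrals are all bounded by a multiple of
  \<open>(t - s) powr \<kappa>\<close> and the size of \<open>u\<close>. Assumption
  \<open>small\<close> trades the multiple for \<open>\<Lambda> powr \<kappa> / 4\<close>, which
  turns the power into one of \<open>\<Lambda> * (t - s)\<close>.\<close>

lemma volterra_increment_le:
  assumes u: "controlled B u" "0 \<le> B" and st: "0 \<le> s" "s \<le> t" "t \<le> T" "t - s \<le> 1 / \<Lambda>"
  shows "norm (volterra u t - volterra u s) \<le> B / 4 * growth t * (\<Lambda> * (t - s)) powr \<kappa>"
proof -
  have t: "t \<in> {0..T}" and s: "s \<in> {0..T}" using st by auto
  define E where "E = B * growth t"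
  have E: "0 \<le> E" using u growth_pos[of t] by (simp add: E_def)
  define I where "I \<tau> i k l = RS_integral (\<lambda>r. f \<tau> r (x r) $ i $ k $ l * u r $ k) (\<lambda>r. g r $ l) 0 \<tau>"
    for \<tau> and i k :: 'd and l :: 'm
  define A where "A = Fb + Y * (Fb + 2 * K) + (T + 1) * ((1 + Y) * (3 * K))"
  have one: "\<bar>I t i k l - I s i k l\<bar> \<le> G * (t - s) powr \<kappa> * (A * E)" for i k l
  proof -
    note ks = kernel_scaled[OF u t s order_refl t, where i = i and k = k and l = l, folded E_def]
    have "\<bar>I t i k l - I s i k l\<bar> \<le> G * (t - s) powr \<kappa> *
        (Fb * E + Y * ((Fb + 2 * K) * E) + (T + 1) * ((1 + Y) * (3 * K * E)))"
      unfolding I_def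
    proof (rule RS_integral_increment_le[where \<gamma> = \<gamma> and \<Lambda> = \<Lambda>])
      show "RS_integrable (\<lambda>r. f s r (x r) $ i $ k $ l * u r $ k) (\<lambda>r. g r $ l) 0 s"
        by (rule kernel_RS_integrable[OF u s])
      have "\<bar>t - s\<bar> = t - s" using st by simp
      note ks = ks[unfolded this]
      show "\<bar>f t r (x r) $ i $ k $ l * u r $ k\<bar> \<le> Fb * E" if "r \<in> {0..t}" for r by (rule ks(1)[OF that])
      show "scaled_hoelder \<gamma> \<Lambda> ((Fb + 2 * K) * E) {0..t} (\<lambda>r. f t r (x r) $ i $ k $ l * u r $ k)" by (rule ks(2))
      show "\<bar>f t r (x r) $ i $ k $ l * u r $ k - f s r (x r) $ i $ k $ l * u r $ k\<bar> \<le> 3 * K * E * (t - s)"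
        if "r \<in> {0..s}" for r by (rule ks(3)) (use that st in auto)
      show "scaled_hoelder \<gamma> \<Lambda> (3 * K * E * (t - s)) {0..s}
          (\<lambda>r. f t r (x r) $ i $ k $ l * u r $ k - f s r (x r) $ i $ k $ l * u r $ k)"
        by (rule scaled_hoelder_subset[OF ks(4)]) (use st in auto)
    qed (use exponents \<Lambda> bounds_nonneg E K_pos G st g_nth_hoelder in auto)
    then show ?thesis by (simp add: A_def algebra_simps)
  qed
  have "norm ((\<chi> i. \<Sum>k\<in>UNIV. \<Sum>l\<in>UNIV. I t i k l) - (\<chi> i. \<Sum>k\<in>UNIV. \<Sum>l\<in>UNIV. I s i k l) :: real ^ 'd)
      \<le> (\<Sum>i\<in>(UNIV :: 'd set). \<Sum>k\<in>(UNIV :: 'd set). \<Sum>l\<in>(UNIV :: 'm set). G * (t - s) powr \<kappa> * (A * E))"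
  proof (rule order_trans[OF norm_le_l1_cart], rule sum_mono)
    fix i :: 'd
    have "\<bar>\<Sum>k\<in>UNIV. \<Sum>l\<in>UNIV. I t i k l - I s i k l\<bar> \<le> (\<Sum>k\<in>(UNIV :: 'd set). \<Sum>l\<in>(UNIV :: 'm set). \<bar>I t i k l - I s i k l\<bar>)"
      by (intro order_trans[OF sum_abs] sum_mono sum_abs)
    also have "\<dots> \<le> (\<Sum>k\<in>(UNIV :: 'd set). \<Sum>l\<in>(UNIV :: 'm set). G * (t - s) powr \<kappa> * (A * E))"
      by (intro sum_mono one)
    finally show "\<bar>((\<chi> i. \<Sum>k\<in>UNIV. \<Sum>l\<in>UNIV. I t i k l) - (\<chi> i. \<Sum>k\<in>UNIV. \<Sum>l\<in>UNIV. I s i k l)) $ i\<bar>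
        \<le> (\<Sum>k\<in>(UNIV :: 'd set). \<Sum>l\<in>(UNIV :: 'm set). G * (t - s) powr \<kappa> * (A * E))"
      by (simp add: sum_subtractf)
  qed
  also have "\<dots> = real CARD('d) * real CARD('d) * real CARD('m) * G * A * E * (t - s) powr \<kappa>" by simp
  finally have "norm (volterra u t - volterra u s) \<le> (Hb + L * T) * E * (t - s) powr \<kappa>
      + real CARD('d) * real CARD('d) * real CARD('m) * G * A * E * (t - s) powr \<kappa>"
    unfolding volterra_def I_def[symmetric] add_diff_add
    by (intro norm_triangle_mono drift_increment_le[OF u st, folded E_def])
  also have "\<dots> = (Hb + L * T + real CARD('d) * real CARD('d) * real CARD('m) * G * A) * (E * (t - s) powr \<kappa>)"
    by (simp add: algebra_simps)
  also have "\<dots> \<le> \<Lambda> powr \<kappa> / 4 * (E * (t - s) powr \<kappa>)"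
    using small E by (intro mult_right_mono) (auto simp: A_def)
  also have "\<dots> = B / 4 * growth t * (\<Lambda> * (t - s)) powr \<kappa>"
    using \<Lambda> st by (simp add: E_def powr_mult)
  finally show ?thesis .
qed

lemma volterra_0: "volterra u 0 = 0"
proof -
  show ?thesis
    unfolding volterra_def set_integral_point
    by (simp add: RS_integral_eq[OF has_RS_integral_point] vec_eq_iff)
qed

text \<open>The supremum bound follows from the increment bound by steps of length
  \<open>1 / \<Lambda>\<close>, starting from the value 0 at time 0. A step adds a quarter; the half
  inherited from the previous time becomes a quarter as well, because the weight has meanwhile grown
  by \<open>exp 1 \<ge> 2\<close>. This is where the exponential weight is needed.\<close>

lemma volterra_contraction:
  assumes u: "controlled B u" "0 \<le> B"
  shows "controlled (B / 2) (volterra u)"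
proof (rule controlledI)
  show "norm (volterra u t) \<le> B / 2 * growth t" if "t \<in> {0..T}" for t
  proof -
    have "norm (volterra u t) \<le> B / 2 * growth t" if "0 \<le> t" "t \<le> T" "t * \<Lambda> \<le> real n" for t n
      using that
    proof (induction n arbitrary: t)
      case 0
      then have "t = 0" using \<Lambda> by (simp add: mult_le_0_iff)
      then show ?case using u growth_pos[of 0] by (simp add: volterra_0)
    next
      case (Suc n)
      define s where "s = max 0 (t - 1 / \<Lambda>)"
      have s: "0 \<le> s" "s \<le> t" "t - s \<le> 1 / \<Lambda>" using Suc.prems \<Lambda> by (auto simp: s_def)
      have "(\<Lambda> * (t - s)) powr \<kappa> \<le> 1" using s \<Lambda> exponents by (intro powr_le1) (auto simp: field_simps)
      then have "B / 4 * growth t * (\<Lambda> * (t - s)) powr \<kappa> \<le> B / 4 * growth t * 1"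
        using u growth_pos[of t] by (intro mult_left_mono) auto
      then have inc: "norm (volterra u t - volterra u s) \<le> B / 4 * growth t"
        using volterra_increment_le[OF u s(1,2) Suc.prems(2) s(3)] by simp
      have "norm (volterra u s) \<le> B / 4 * growth t"
      \<comment> \<open>The first step may be shorter than \<open>1 / \<Lambda>\<close>, so the
        weight need not double, but then the value at \<open>s\<close> is 0.\<close>
      proof (cases "s = 0")
        case True
        then show ?thesis using u growth_pos[of t] by (simp add: volterra_0)
      next
        case False
        then have s_eq: "s = t - 1 / \<Lambda>" by (auto simp: s_def max_def split: if_splits)
        then have "s * \<Lambda> \<le> real n" using Suc.prems \<Lambda> by (simp add: left_diff_distrib)
        then have "norm (volterra u s) \<le> B / 2 * growth s" using Suc s by auto
        also have "\<dots> \<le> B / 2 * (growth t / 2)"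
        proof (rule mult_left_mono)
          have "growth s = growth t / exp 1"
            using \<Lambda> by (simp add: growth_def s_eq right_diff_distrib exp_diff)
          also have "\<dots> \<le> growth t / 2"
            using exp_ge_add_one_self[of 1] growth_pos[of t] by (intro divide_left_mono) auto
          finally show "growth s \<le> growth t / 2" .
        qed (use u in auto)
        finally show ?thesis by simp
      qed
      with inc show ?case
        using norm_triangle_ineq[of "volterra u t - volterra u s" "volterra u s"] by simp
    qed
    from this[of t "nat \<lceil>t * \<Lambda>\<rceil>"] show ?thesis using that by (simp add: of_nat_ceiling)
  qed
  show "norm (volterra u t - volterra u s) \<le> B / 2 * growth t * (\<Lambda> * (t - s)) powr \<kappa>"
    if "0 \<le> s" "s \<le> t" "t \<le> T" "t - s \<le> 1 / \<Lambda>" for s t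
  proof -
    have "B / 4 * growth t * (\<Lambda> * (t - s)) powr \<kappa> \<le> B / 2 * growth t * (\<Lambda> * (t - s)) powr \<kappa>"
      using u growth_pos[of t] by (intro mult_right_mono) auto
    with volterra_increment_le[OF u that] show ?thesis by linarith
  qed
qed (use u in simp)

end

section \<open>Existence, uniqueness and the a priori bound by contraction\<close>

lemma halving_tendsto: "(\<lambda>n. c + B / 2 ^ n) \<longlonglongrightarrow> (c :: real)"
proof -
  have "(\<lambda>n. c + B * (1 / 2) ^ n) \<longlonglongrightarrow> c + B * 0" by (intro tendsto_intros) auto
  then show ?thesis by (simp add: power_divide)
qed

context linear_young
begin

lemma controlled_mono: "controlled B u \<Longrightarrow> B \<le> B' \<Longrightarrow> 0 \<le> B \<Longrightarrow> controlled B' u"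
proof (rule controlledI)
  assume u: "controlled B u" "B \<le> B'" "0 \<le> B"
  show "norm (u t) \<le> B' * growth t" if "t \<in> {0..T}" for t
    using controlled_norm[OF u(1) that] mult_right_mono[OF u(2), of "growth t"] growth_pos[of t] by linarith
  show "norm (u t - u s) \<le> B' * growth t * (\<Lambda> * (t - s)) powr \<kappa>"
    if "0 \<le> s" "s \<le> t" "t \<le> T" "t - s \<le> 1 / \<Lambda>" for s t
  proof -
    have "B * growth t * (\<Lambda> * (t - s)) powr \<kappa> \<le> B' * growth t * (\<Lambda> * (t - s)) powr \<kappa>"
      using u(2) growth_pos[of t] by (intro mult_right_mono) auto
    with controlled_diff_le[OF u(1) that] show ?thesis by linarith
  qed
qed auto

lemma controlled_add:
  assumes u: "controlled B u" "0 \<le> B" and v: "controlled B' v" "0 \<le> B'"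
  shows "controlled (B + B') (\<lambda>t. u t + v t)"
proof (rule controlledI)
  show "norm (u t + v t) \<le> (B + B') * growth t" if "t \<in> {0..T}" for t
    using norm_triangle_ineq[of "u t" "v t"] controlled_norm[OF u(1) that] controlled_norm[OF v(1) that]
    by (simp add: distrib_right)
  show "norm (u t + v t - (u s + v s)) \<le> (B + B') * growth t * (\<Lambda> * (t - s)) powr \<kappa>"
    if st: "0 \<le> s" "s \<le> t" "t \<le> T" "t - s \<le> 1 / \<Lambda>" for s t
    unfolding add_diff_add distrib_right
    by (rule norm_triangle_mono[OF controlled_diff_le[OF u(1) st] controlled_diff_le[OF v(1) st]])
qed (use u v in auto)

lemma controlled_uminus: "controlled B u \<Longrightarrow> controlled B (\<lambda>t. - u t)"
  by (simp add: controlled_def scaled_hoelder_def norm_minus_commute)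

lemma controlled_diff:
  "controlled B u \<Longrightarrow> 0 \<le> B \<Longrightarrow> controlled B' v \<Longrightarrow> 0 \<le> B' \<Longrightarrow> controlled (B + B') (\<lambda>t. u t - v t)"
  using controlled_add[of B u B' "\<lambda>t. - v t"] controlled_uminus[of B' v] by simp

lemma controlled_cong:
  assumes "controlled B u" "\<And>t. t \<in> {0..T} \<Longrightarrow> u t = v t"
  shows "controlled B v"
  unfolding controlled_def scaled_hoelder_def
proof (intro ballI conjI impI)
  fix \<tau> assume \<tau>: "\<tau> \<in> {0..T}"
  show "norm (v \<tau>) \<le> B * growth \<tau>" using controlled_norm[OF assms(1) \<tau>] assms(2)[OF \<tau>] by simp
  fix s t assume st: "s \<in> {0..\<tau>}" "t \<in> {0..\<tau>}" "\<bar>t - s\<bar> \<le> 1 / \<Lambda>"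
  have "u s = v s" "u t = v t" using assms(2) \<tau> st by auto
  then show "norm (v t - v s) \<le> B * growth \<tau> * (\<Lambda> * \<bar>t - s\<bar>) powr \<kappa>"
    using scaled_hoelderD[OF controlled_scaled[OF assms(1) \<tau>] st] by simp
qed

text \<open>The control consists of inequalities between values at one or two times, so it passes to
  pointwise limits, even with varying radius.\<close>

lemma controlled_limit:
  assumes u: "\<And>n::nat. controlled (b n) (u n)" and b: "b \<longlonglongrightarrow> B"
    and lim: "\<And>t. t \<in> {0..T} \<Longrightarrow> (\<lambda>n. u n t) \<longlonglongrightarrow> v t"
  shows "controlled B v"
  unfolding controlled_def scaled_hoelder_def
proof (intro ballI conjI impI)
  fix \<tau> assume \<tau>: "\<tau> \<in> {0..T}"
  show "norm (v \<tau>) \<le> B * growth \<tau>"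
    by (rule LIMSEQ_le[OF tendsto_norm[OF lim[OF \<tau>]] tendsto_mult[OF b tendsto_const]])
      (use controlled_norm[OF u \<tau>] in auto)
  fix s t assume st: "s \<in> {0..\<tau>}" "t \<in> {0..\<tau>}" "\<bar>t - s\<bar> \<le> 1 / \<Lambda>"
  have T: "t \<in> {0..T}" "s \<in> {0..T}" using st \<tau> by auto
  show "norm (v t - v s) \<le> B * growth \<tau> * (\<Lambda> * \<bar>t - s\<bar>) powr \<kappa>"
    by (rule LIMSEQ_le[OF tendsto_norm[OF tendsto_diff[OF lim[OF T(1)] lim[OF T(2)]]]
          tendsto_mult[OF tendsto_mult[OF b tendsto_const] tendsto_const]])
      (use scaled_hoelderD[OF controlled_scaled[OF u \<tau>] st] in auto)
qed

text \<open>A control by \<open>B\<close> improves to one by \<open>W + B / 2\<close>. Iteration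
  forgets the initial radius and tends to the fixed point \<open>2 * W\<close>, so any finite
  control suffices to start.\<close>

lemma solution_controlled:
  assumes w: "controlled W w" "0 \<le> W" and z: "controlled B z" "0 \<le> B"
    and eq: "\<And>t. t \<in> {0..T} \<Longrightarrow> z t = w t + volterra z t"
  shows "controlled (2 * W) z"
proof (rule controlled_limit)
  show "controlled (2 * W + B / 2 ^ n) z" for n
  proof (induction n)
    case 0
    show ?case using controlled_mono[OF z(1), of "2 * W + B"] z w by simp
  next
    case (Suc n)
    have "controlled (W + (2 * W + B / 2 ^ n) / 2) (\<lambda>t. w t + volterra z t)"
      using w z by (intro controlled_add volterra_contraction Suc) auto
    then have "controlled (W + (2 * W + B / 2 ^ n) / 2) z"
      by (rule controlled_cong) (simp add: eq)
    then show ?case by (simp add: add_divide_distrib mult.commute)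
  qed
qed (auto intro: halving_tendsto)

text \<open>The difference solves the homogeneous equation, to which the a priori bound applies with
  \<open>W = 0\<close>.\<close>

lemma solution_unique:
  assumes z: "controlled B z" "0 \<le> B" and z': "controlled B' z'" "0 \<le> B'"
    and eq: "\<And>t. t \<in> {0..T} \<Longrightarrow> z t = w t + volterra z t"
      "\<And>t. t \<in> {0..T} \<Longrightarrow> z' t = w t + volterra z' t"
    and t: "t \<in> {0..T}"
  shows "z' t = z t"
proof -
  have "controlled (2 * 0) (\<lambda>t. z' t - z t)"
  proof (rule solution_controlled)
    show "controlled 0 (\<lambda>t. 0)" by (simp add: controlled_def scaled_hoelder_def)
    show "controlled (B' + B) (\<lambda>t. z' t - z t)" by (rule controlled_diff[OF z' z])
    show "z' t - z t = 0 + volterra (\<lambda>t. z' t - z t) t" if "t \<in> {0..T}" for t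
      using eq[OF that] volterra_diff[OF z' z that] by simp
  qed (use z z' in auto)
  from controlled_norm[OF this t] show ?thesis by simp
qed

text \<open>Picard iteration from \<open>w\<close>; successive differences halve in the weighted
  norm, so the iterates are Cauchy at each time.\<close>

lemma solution_exists:
  assumes w: "controlled W w" "0 \<le> W"
  obtains z where "controlled (2 * W) z" "\<forall>t\<in>{0..T}. z t = w t + volterra z t"
proof -
  define Z where "Z n = ((\<lambda>u t. w t + volterra u t) ^^ n) w" for n
  have Z_Suc: "Z (Suc n) = (\<lambda>t. w t + volterra (Z n) t)" and Z_0: "Z 0 = w" for n
    by (simp_all add: Z_def)
  have Zc: "controlled (2 * W) (Z n)" for n
  proof (induction n)
    case 0
    show ?case using controlled_mono[OF w(1), of "2 * W"] w by (simp add: Z_0)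
  next
    case (Suc n)
    show ?case using controlled_add[OF w volterra_contraction[OF Suc]] w by (simp add: Z_Suc)
  qed
  have W2: "0 \<le> 2 * W" using w by simp
  have step: "controlled (W / 2 ^ Suc n) (\<lambda>t. Z (Suc n) t - Z n t)" for n
  proof (induction n)
    case 0
    show ?case using volterra_contraction[OF w] by (simp add: Z_Suc Z_0)
  next
    case (Suc n)
    have "controlled (W / 2 ^ Suc n / 2) (volterra (\<lambda>t. Z (Suc n) t - Z n t))"
      using w by (intro volterra_contraction Suc) auto
    then have "controlled (W / 2 ^ Suc n / 2) (\<lambda>t. Z (Suc (Suc n)) t - Z (Suc n) t)"
    proof (rule controlled_cong)
      fix t assume t: "t \<in> {0..T}"
      have eqs: "Z (Suc (Suc n)) t = w t + volterra (Z (Suc n)) t" "Z (Suc n) t = w t + volterra (Z n) t"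
        by (rule fun_cong[OF Z_Suc])+
      have "volterra (\<lambda>t. Z (Suc n) t - Z n t) t = volterra (Z (Suc n)) t - volterra (Z n) t"
        by (rule volterra_diff[OF Zc W2 Zc W2 t])
      also have "\<dots> = Z (Suc (Suc n)) t - Z (Suc n) t" unfolding eqs by simp
      finally show "volterra (\<lambda>t. Z (Suc n) t - Z n t) t = Z (Suc (Suc n)) t - Z (Suc n) t" .
    qed
    then show ?case by simp
  qed
  \<comment> \<open>The radius is the exact sum of the radii of the \<open>k\<close> steps, which
    makes the induction close; afterwards it is weakened to \<open>W / 2 ^ n\<close>.\<close>
  have tail: "controlled (W / 2 ^ n - W / 2 ^ (n + k)) (\<lambda>t. Z (n + k) t - Z n t)" for n k
  proof (induction k)
    case 0
    show ?case by (simp add: controlled_def scaled_hoelder_def)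
  next
    case (Suc k)
    have "W / 2 ^ (n + k) \<le> W / 2 ^ n" using w by (intro divide_left_mono) auto
    then have "controlled ((W / 2 ^ n - W / 2 ^ (n + k)) + W / 2 ^ Suc (n + k))
        (\<lambda>t. (Z (n + k) t - Z n t) + (Z (Suc (n + k)) t - Z (n + k) t))"
      using w by (intro controlled_add Suc step) auto
    then show ?case by simp
  qed
  have tail_norm: "norm (Z (n + k) t - Z n t) \<le> W * growth T / 2 ^ n" if "t \<in> {0..T}" for n k t
  proof -
    have "norm (Z (n + k) t - Z n t) \<le> (W / 2 ^ n - W / 2 ^ (n + k)) * growth t"
      by (rule controlled_norm[OF tail that])
    also have "\<dots> \<le> W / 2 ^ n * growth T"
      using w growth_pos[of t] growth_mono[of t T] that by (intro mult_mono) auto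
    finally show ?thesis by simp
  qed
  have conv: "convergent (\<lambda>n. Z n t)" if t: "t \<in> {0..T}" for t
  proof (rule Cauchy_convergent, rule CauchyI')
    fix e :: real assume "0 < e"
    then have "\<forall>\<^sub>F n in sequentially. 0 + W * growth T / 2 ^ n < e"
      by (intro order_tendstoD(2)[OF halving_tendsto])
    then obtain N where N: "\<And>n. n \<ge> N \<Longrightarrow> W * growth T / 2 ^ n < e"
      by (auto simp: eventually_sequentially)
    show "\<exists>M. \<forall>m\<ge>M. \<forall>n>m. dist (Z m t) (Z n t) < e"
    proof (intro exI[of _ N] allI impI)
      fix m n :: nat assume "N \<le> m" "m < n"
      then show "dist (Z m t) (Z n t) < e"
        using tail_norm[OF t, of m "n - m"] N[of m] by (simp add: dist_norm norm_minus_commute)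
    qed
  qed
  define z where "z t = lim (\<lambda>n. Z n t)" for t
  have z: "(\<lambda>n. Z n t) \<longlonglongrightarrow> z t" if "t \<in> {0..T}" for t
    using conv[OF that] by (simp add: z_def convergent_LIMSEQ_iff)
  have zc: "controlled (2 * W) z" by (rule controlled_limit[OF Zc tendsto_const z])
  \<comment> \<open>Pointwise convergence does not control Young integrals. Letting \<open>k\<close>
    tend to infinity keeps the full weighted norm of \<open>z - Z n\<close>, to which the
    contraction can be applied.\<close>
  have zZ: "controlled (W / 2 ^ n) (\<lambda>t. z t - Z n t)" for n
  proof (rule controlled_limit)
    show "controlled (W / 2 ^ n) (\<lambda>t. Z (n + k) t - Z n t)" for k
    proof (rule controlled_mono[OF tail])
      show "0 \<le> W / 2 ^ n - W / 2 ^ (n + k)" using w by (auto intro: divide_left_mono)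
    qed (use w in auto)
    show "(\<lambda>k. Z (n + k) t - Z n t) \<longlonglongrightarrow> z t - Z n t" if "t \<in> {0..T}" for t
      using LIMSEQ_ignore_initial_segment[OF z[OF that], of n]
      by (intro tendsto_diff tendsto_const) (simp add: add.commute)
  qed auto
  have "z t = w t + volterra z t" if t: "t \<in> {0..T}" for t
  proof -
    have "(\<lambda>n. w t + volterra (Z n) t) \<longlonglongrightarrow> w t + volterra z t"
    proof (rule tendsto_add[OF tendsto_const], rule Lim_null[THEN iffD2], rule Lim_null_comparison)
      show "\<forall>\<^sub>F n in sequentially. norm (volterra (Z n) t - volterra z t) \<le> 0 + W * growth t / 2 ^ n"
      proof (rule always_eventually, rule allI)
        fix n
        have "controlled (W / 2 ^ n / 2) (volterra (\<lambda>t. z t - Z n t))"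
          using w by (intro volterra_contraction zZ) auto
        then have "norm (volterra z t - volterra (Z n) t) \<le> W / 2 ^ n / 2 * growth t"
          unfolding volterra_diff[OF zc W2 Zc W2 t, symmetric] by (rule controlled_norm) (rule t)
        also have "\<dots> \<le> W / 2 ^ n * growth t"
        proof (rule mult_right_mono)
          have half: "y / 2 \<le> y" if "0 \<le> y" for y :: real using that by simp
          show "W / 2 ^ n / 2 \<le> W / 2 ^ n" by (rule half) (use w in simp)
        qed (use growth_pos[of t] in simp)
        finally show "norm (volterra (Z n) t - volterra z t) \<le> 0 + W * growth t / 2 ^ n"
          by (simp add: norm_minus_commute)
      qed
    qed (rule halving_tendsto)
    moreover have "(\<lambda>n. w t + volterra (Z n) t) \<longlonglongrightarrow> z t"
      using LIMSEQ_Suc[OF z[OF t]] by (simp add: Z_Suc)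
    ultimately show ?thesis by (rule LIMSEQ_unique[symmetric])
  qed
  then show thesis by (intro that[OF zc] ballI)
qed

text \<open>For controlled paths the integrability demanded of a solution is automatic, so only the
  fixed point equation remains.\<close>

lemma solves_z_iff:
  assumes "controlled B z" "0 \<le> B"
  shows "solves_z T h f g w x z \<longleftrightarrow> (\<forall>t\<in>{0..T}. z t = w t + volterra z t)"
  using drift_integrable[OF assms] kernel_RS_integrable[OF assms]
  unfolding solves_z_def volterra_def by (simp add: add.assoc)

lemma growth_ge_1: "0 \<le> t \<Longrightarrow> 1 \<le> growth t"
  using \<Lambda> by (simp add: growth_def)

lemma controlled_if_hoelder_on:
  assumes "hoelder_on \<kappa> c {0..T} u" "\<And>t. t \<in> {0..T} \<Longrightarrow> norm (u t) \<le> B" "c \<le> B * \<Lambda> powr \<kappa>" "0 \<le> B"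
  shows "controlled B u"
proof (rule controlledI)
  show "norm (u t) \<le> B * growth t" if "t \<in> {0..T}" for t
    using assms(2)[OF that] growth_ge_1[of t] mult_left_mono[of 1 "growth t" B] that assms(4) by auto
  show "norm (u t - u s) \<le> B * growth t * (\<Lambda> * (t - s)) powr \<kappa>"
    if st: "0 \<le> s" "s \<le> t" "t \<le> T" "t - s \<le> 1 / \<Lambda>" for s t
  proof -
    have "norm (u t - u s) \<le> c * (t - s) powr \<kappa>" using hoelder_onD[OF assms(1), of s t] st by simp
    also have "\<dots> \<le> (B * \<Lambda> powr \<kappa>) * (t - s) powr \<kappa>" using assms(3) by (intro mult_right_mono) auto
    also have "\<dots> = B * 1 * (\<Lambda> * (t - s)) powr \<kappa>" using \<Lambda> st by (simp add: powr_mult)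
    also have "\<dots> \<le> B * growth t * (\<Lambda> * (t - s)) powr \<kappa>"
      using growth_ge_1[of t] st assms(4) by (intro mult_right_mono mult_left_mono) auto
    finally show ?thesis .
  qed
qed (use assms in auto)

end

subsection \<open>Hoelder spaces\<close>

lemma hoelder_spaceI:
  assumes "hoelder_on \<gamma> c {0..T} p" "bounded (p ` {0..T})"
  shows "p \<in> hoelder_space \<gamma> T"
proof -
  have "bdd_above (hoelder_quotients \<gamma> T p)"
  proof (rule bdd_aboveI[of _ c])
    fix y assume "y \<in> hoelder_quotients \<gamma> T p"
    then obtain s t where st: "0 \<le> s" "s < t" "t \<le> T" "y = norm (p t - p s) / \<bar>t - s\<bar> powr \<gamma>"
      by (auto simp: hoelder_quotients_def)
    then show "y \<le> c" using hoelder_onD[OF assms(1), of s t] by (simp add: divide_le_eq)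
  qed
  with assms(2) show ?thesis by (simp add: hoelder_space_def)
qed

lemma hoelder_on_Sup:
  assumes "bdd_above (hoelder_quotients \<gamma> T p)"
  shows "hoelder_on \<gamma> (Sup (hoelder_quotients \<gamma> T p)) {0..T} p"
proof -
  have *: "norm (p t - p s) \<le> Sup (hoelder_quotients \<gamma> T p) * \<bar>t - s\<bar> powr \<gamma>" if "0 \<le> s" "s < t" "t \<le> T" for s t
  proof -
    have "norm (p t - p s) / \<bar>t - s\<bar> powr \<gamma> \<le> Sup (hoelder_quotients \<gamma> T p)"
    proof (rule cSup_upper[OF _ assms])
      show "norm (p t - p s) / \<bar>t - s\<bar> powr \<gamma> \<in> hoelder_quotients \<gamma> T p"
        unfolding hoelder_quotients_def mem_Collect_eq using that by blast
    qed
    then show ?thesis using that by (simp add: divide_le_eq)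
  qed
  show ?thesis
    unfolding hoelder_on_def
  proof (intro ballI)
    fix s t assume "s \<in> {0..T}" "t \<in> {0..T}"
    then show "norm (p t - p s) \<le> Sup (hoelder_quotients \<gamma> T p) * \<bar>t - s\<bar> powr \<gamma>"
      using *[of s t] *[of t s] by (cases s t rule: linorder_cases) (auto simp: norm_minus_commute abs_minus_commute)
  qed
qed

lemma hoelder_quotients_Sup_nonneg:
  assumes "bdd_above (hoelder_quotients \<gamma> T p)" "0 < T"
  shows "0 \<le> Sup (hoelder_quotients \<gamma> T p)"
proof -
  have "norm (p T - p 0) / \<bar>T - 0\<bar> powr \<gamma> \<in> hoelder_quotients \<gamma> T p"
    unfolding hoelder_quotients_def mem_Collect_eq using assms(2) by (intro exI[of _ 0] exI[of _ T]) simp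
  then have "norm (p T - p 0) / \<bar>T - 0\<bar> powr \<gamma> \<le> Sup (hoelder_quotients \<gamma> T p)"
    by (rule cSup_upper) (rule assms(1))
  then show ?thesis by (rule order_trans[rotated]) simp
qed

lemma sup_norm_upper: "bounded (p ` {0..T}) \<Longrightarrow> t \<in> {0..T} \<Longrightarrow> norm (p t) \<le> sup_norm T p"
  unfolding sup_norm_def by (rule cSUP_upper) (auto simp: bounded_iff bdd_above_def)

lemma sup_norm3_upper:
  assumes "bounded3 T \<phi>" "t \<in> {0..T}" "s \<in> {0..T}"
  shows "norm (\<phi> t s y) \<le> sup_norm3 T \<phi>"
proof -
  have "bdd_above ((\<lambda>(t, s, x). norm (\<phi> t s x)) ` ({0..T} \<times> {0..T} \<times> UNIV))"
    using assms(1) by (fastforce simp: bounded3_def bounded_iff bdd_above_def)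
  from cSUP_upper[OF _ this, of "(t, s, y)"] assms(2,3) show ?thesis by (simp add: sup_norm3_def)
qed

lemma bounded_if_hoelder_on:
  assumes "hoelder_on \<gamma> c {0..T} p" "0 < \<gamma>"
  shows "bounded (p ` {0..T})"
  by (intro compact_imp_bounded compact_continuous_image hoelder_on_imp_continuous_on[OF assms]) auto

lemma W2_space_imp_bdd_above:
  assumes "g \<in> W2_space \<alpha> T"
  shows "bdd_above (hoelder_quotients (1 - \<alpha>) T g)"
proof -
  have fin: "W2_norm \<alpha> T g < top" using assms by (simp add: W2_space_def)
  show ?thesis
  proof (rule bdd_aboveI[of _ "enn2real (W2_norm \<alpha> T g)"])
    fix y assume "y \<in> hoelder_quotients (1 - \<alpha>) T g"
    then obtain s t where st: "0 \<le> s" "s < t" "t \<le> T" "y = norm (g t - g s) / \<bar>t - s\<bar> powr (1 - \<alpha>)"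
      by (auto simp: hoelder_quotients_def)
    have "ennreal y \<le> ennreal (norm (g t - g s) / \<bar>t - s\<bar> powr (1 - \<alpha>)) +
        (\<integral>\<^sup>+y\<in>{s..t}. ennreal (norm (g y - g s) / \<bar>y - s\<bar> powr (2 - \<alpha>)) \<partial>lborel)"
      using st(4) by (simp add: add_increasing2)
    also have "\<dots> \<le> W2_norm \<alpha> T g"
      unfolding W2_norm_def by (rule SUP_upper2[of "(s, t)"]) (use st in auto)
    finally show "y \<le> enn2real (W2_norm \<alpha> T g)"
      using fin by (metis enn2real_mono enn2real_ennreal st(4) norm_ge_zero divide_nonneg_nonneg powr_ge_zero ennreal_less_top less_imp_le)
  qed
qed

subsection \<open>The first equation\<close>

text \<open>Hoelder's inequality for the functions 1 and \<open>c\<close> with exponents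
  \<open>1 / (1 - \<alpha>)\<close> and \<open>1 / \<alpha>\<close>, obtained by integrating Young's
  inequality for products with a constant weight. The two terms contribute the shares
  \<open>\<alpha>\<close> and \<open>1 - \<alpha>\<close> of
  \<open>P * (t - s) powr (1 - \<alpha>)\<close>. The condition \<open>t - s \<le> 1\<close> serves
  the term with \<open>L0\<close>.\<close>

lemma norm_set_integral_le_Hoelder:
  fixes p :: "real \<Rightarrow> 'e::euclidean_space" and c :: "real \<Rightarrow> real"
  assumes \<alpha>: "0 < \<alpha>" "\<alpha> < 1" and st: "s < t" "t - s \<le> 1" and P: "0 < P" and L0: "0 \<le> L0"
    and p: "set_integrable lborel {s..t} p" "\<And>r. r \<in> {s..t} \<Longrightarrow> norm (p r) \<le> L0 + c r"
    and c: "set_integrable lborel {s..t} (\<lambda>r. \<bar>c r\<bar> powr (1 / \<alpha>))"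
      "(LINT r:{s..t}|lborel. \<bar>c r\<bar> powr (1 / \<alpha>)) \<le> P powr (1 / \<alpha>)"
  shows "norm (LINT r:{s..t}|lborel. p r) \<le> (L0 + P) * (t - s) powr (1 - \<alpha>)"
proof -
  \<comment> \<open>The weight that turns both terms of Young's inequality into multiples of
    \<open>P * (t - s) powr (1 - \<alpha>)\<close>.\<close>
  define \<tau> where "\<tau> = P powr (\<alpha> - 1) * (t - s) powr (\<alpha> * (1 - \<alpha>))"
  have \<tau>: "0 < \<tau>" using P st by (simp add: \<tau>_def)
  have \<tau>1: "\<tau> powr (1 / \<alpha>) = P powr ((\<alpha> - 1) / \<alpha>) * (t - s) powr (1 - \<alpha>)"
    using \<alpha> P st by (simp add: \<tau>_def powr_mult powr_powr)
  have \<tau>2: "(1 / \<tau>) powr (1 / (1 - \<alpha>)) = P * (t - s) powr (- \<alpha>)"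
  proof -
    have "(1 / \<tau>) powr (1 / (1 - \<alpha>)) = \<tau> powr (- (1 / (1 - \<alpha>)))"
      using \<tau> by (simp add: powr_divide powr_minus_divide)
    also have "\<dots> = P powr ((\<alpha> - 1) * - (1 / (1 - \<alpha>))) * (t - s) powr (\<alpha> * (1 - \<alpha>) * - (1 / (1 - \<alpha>)))"
      using P st by (simp only: \<tau>_def powr_mult powr_powr)
    also have "(\<alpha> - 1) * - (1 / (1 - \<alpha>)) = 1" using \<alpha> by (simp add: field_simps)
    also have "\<alpha> * (1 - \<alpha>) * - (1 / (1 - \<alpha>)) = - \<alpha>" using \<alpha> by (simp add: field_simps)
    finally show ?thesis using P by simp
  qed
  define c1 where "c1 = \<alpha> * \<tau> powr (1 / \<alpha>)"
  define c2 where "c2 = (1 - \<alpha>) * (P * (t - s) powr (- \<alpha>))"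
  have c1: "0 \<le> c1" using \<alpha> by (simp add: c1_def)
  have young: "\<bar>y\<bar> \<le> c1 * \<bar>y\<bar> powr (1 / \<alpha>) + c2" for y
  proof -
    have "(\<bar>y\<bar> * \<tau>) * (1 / \<tau>) \<le> (\<bar>y\<bar> * \<tau>) powr (1 / \<alpha>) / (1 / \<alpha>) + (1 / \<tau>) powr (1 / (1 - \<alpha>)) / (1 / (1 - \<alpha>))"
      using \<alpha> \<tau> by (intro Youngs_inequality) auto
    then show ?thesis using \<tau> unfolding \<tau>2 by (simp add: c1_def c2_def powr_mult mult_ac)
  qed
  have const: "set_integrable lborel {s..t} (\<lambda>r. a :: real)" for a
    by (auto simp: set_integrable_def emeasure_lborel_Icc_eq intro!: integrable_real_indicator)
  have const_val: "(LINT r:{s..t}|lborel. a :: real) = a * (t - s)" for a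
    using st by (simp add: set_lebesgue_integral_def)
  have maj: "set_integrable lborel {s..t} (\<lambda>r. c1 * \<bar>c r\<bar> powr (1 / \<alpha>))" using c(1) by simp
  have "norm (LINT r:{s..t}|lborel. p r) \<le> (LINT r:{s..t}|lborel. norm (p r))"
    by (rule set_integral_norm_bound[OF p(1)])
  also have "\<dots> \<le> (LINT r:{s..t}|lborel. (L0 + c2) + c1 * \<bar>c r\<bar> powr (1 / \<alpha>))"
  proof (rule set_integral_mono)
    show "set_integrable lborel {s..t} (\<lambda>r. norm (p r))" using p(1) by (rule set_integrable_norm)
    show "set_integrable lborel {s..t} (\<lambda>r. (L0 + c2) + c1 * \<bar>c r\<bar> powr (1 / \<alpha>))"
      by (rule set_integral_add(1)[OF const maj])
    show "norm (p r) \<le> (L0 + c2) + c1 * \<bar>c r\<bar> powr (1 / \<alpha>)" if "r \<in> {s..t}" for r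
      using p(2)[OF that] young[of "c r"] by linarith
  qed
  also have "\<dots> = (L0 + c2) * (t - s) + c1 * (LINT r:{s..t}|lborel. \<bar>c r\<bar> powr (1 / \<alpha>))"
    using set_integral_add(2)[OF const maj, of "L0 + c2"] const_val[of "L0 + c2"] by simp
  also have "\<dots> \<le> (L0 + c2) * (t - s) + c1 * P powr (1 / \<alpha>)"
    using c(2) c1 by (intro add_left_mono mult_left_mono)
  also have "c1 * P powr (1 / \<alpha>) = \<alpha> * P * (t - s) powr (1 - \<alpha>)"
  proof -
    have "P powr ((\<alpha> - 1) / \<alpha>) * P powr (1 / \<alpha>) = P powr ((\<alpha> - 1) / \<alpha> + 1 / \<alpha>)"
      by (rule powr_add[symmetric])
    also have "(\<alpha> - 1) / \<alpha> + 1 / \<alpha> = 1" using \<alpha> by (simp add: field_simps)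
    finally have "P powr ((\<alpha> - 1) / \<alpha>) * P powr (1 / \<alpha>) = P" using P by simp
    then show ?thesis unfolding c1_def \<tau>1 by (simp add: mult.assoc mult.left_commute)
  qed
  also have "(L0 + c2) * (t - s) = L0 * (t - s) + (1 - \<alpha>) * P * (t - s) powr (1 - \<alpha>)"
  proof -
    have "(t - s) powr (- \<alpha>) * (t - s) = (t - s) powr (1 - \<alpha>)"
      using st powr_add[of "t - s" "- \<alpha>" 1] by simp
    then show ?thesis unfolding c2_def distrib_right mult.assoc by simp
  qed
  also have "L0 * (t - s) \<le> L0 * (t - s) powr (1 - \<alpha>)"
  proof (rule mult_left_mono)
    have "(t - s) powr 1 \<le> (t - s) powr (1 - \<alpha>)" using st \<alpha> by (intro powr_mono') auto
    then show "t - s \<le> (t - s) powr (1 - \<alpha>)" using st by simp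
  qed (rule L0)
  finally show ?thesis by (simp add: algebra_simps)
qed

lemma B_const_nonneg:
  assumes "B_const_finite T \<alpha> b0" "0 \<le> T"
  shows "0 \<le> B_const T \<alpha> b0"
proof -
  have bdd: "bdd_above ((\<lambda>t. (LINT u:{0..t}|lborel. \<bar>b0 t u\<bar> powr (1 / \<alpha>)) powr \<alpha>) ` {0..T})"
    using assms(1) by (auto simp: B_const_finite_def)
  have "(LINT u:{0..0}|lborel. \<bar>b0 0 u\<bar> powr (1 / \<alpha>)) powr \<alpha> \<le> B_const T \<alpha> b0"
    unfolding B_const_def by (rule cSUP_upper[OF _ bdd]) (use assms(2) in simp)
  then show ?thesis by (rule order_trans[OF powr_ge_zero])
qed

text \<open>With the outer time frozen at \<open>t\<close>, the integral of the power of
  \<open>b0\<close> over \<open>[s,t]\<close> is at most that over \<open>[0,t]\<close>, which is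
  the one occurring in \<open>B_const\<close>.\<close>

lemma drift_x_local_le:
  fixes p :: "real \<Rightarrow> 'e::euclidean_space"
  assumes \<alpha>: "0 < \<alpha>" "\<alpha> < 1" and st: "0 \<le> s" "s \<le> t" "t \<le> T" "t - s \<le> 1" and L0: "0 < L0"
    and fin: "B_const_finite T \<alpha> b0"
    and p: "set_integrable lborel {0..t} p" "\<And>r. r \<in> {0..t} \<Longrightarrow> norm (p r) \<le> L0 + b0 t r"
  shows "norm (LINT r:{s..t}|lborel. p r) \<le> (2 * L0 + B_const T \<alpha> b0) * (t - s) powr (1 - \<alpha>)"
proof (cases "s = t")
  case True
  then show ?thesis by (simp only: set_integral_point) simp
next
  case False
  have t: "t \<in> {0..T}" using st by auto
  define I where "I = (LINT u:{0..t}|lborel. \<bar>b0 t u\<bar> powr (1 / \<alpha>))"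
  have int: "set_integrable lborel {0..t} (\<lambda>u. \<bar>b0 t u\<bar> powr (1 / \<alpha>))"
    and bdd: "bdd_above ((\<lambda>t. (LINT u:{0..t}|lborel. \<bar>b0 t u\<bar> powr (1 / \<alpha>)) powr \<alpha>) ` {0..T})"
    using fin t by (auto simp: B_const_finite_def)
  have IB: "I powr \<alpha> \<le> B_const T \<alpha> b0"
    unfolding B_const_def I_def by (rule cSUP_upper[OF t bdd])
  have I0: "0 \<le> I" unfolding I_def set_lebesgue_integral_def by (rule integral_nonneg_AE) auto
  have B0: "0 \<le> B_const T \<alpha> b0" by (rule order_trans[OF powr_ge_zero IB])
  have "(LINT r:{s..t}|lborel. \<bar>b0 t r\<bar> powr (1 / \<alpha>)) \<le> I"
    unfolding I_def set_lebesgue_integral_def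
  proof (rule integral_mono)
    show "integrable lborel (\<lambda>r. indicator {s..t} r *\<^sub>R (\<bar>b0 t r\<bar> powr (1 / \<alpha>)))"
      using set_integrable_subset[OF int, of "{s..t}"] st by (auto simp: set_integrable_def)
    show "integrable lborel (\<lambda>r. indicator {0..t} r *\<^sub>R (\<bar>b0 t r\<bar> powr (1 / \<alpha>)))"
      using int by (simp add: set_integrable_def)
  qed (use st in \<open>auto simp: indicator_def\<close>)
  also have "I = (I powr \<alpha>) powr (1 / \<alpha>)" using I0 \<alpha> by (simp add: powr_powr)
  also have "\<dots> \<le> (L0 + B_const T \<alpha> b0) powr (1 / \<alpha>)"
    using IB L0 \<alpha> by (intro powr_mono2) auto
  finally have J: "(LINT r:{s..t}|lborel. \<bar>b0 t r\<bar> powr (1 / \<alpha>)) \<le> (L0 + B_const T \<alpha> b0) powr (1 / \<alpha>)" .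
  \<comment> \<open>\<open>L0\<close> is added to \<open>B_const T \<alpha> b0\<close>, which may vanish, to have a positive \<open>P\<close>.\<close>
  have "norm (LINT r:{s..t}|lborel. p r) \<le> (L0 + (L0 + B_const T \<alpha> b0)) * (t - s) powr (1 - \<alpha>)"
  proof (rule norm_set_integral_le_Hoelder[OF \<alpha>, where c = "b0 t"])
    show "set_integrable lborel {s..t} p" "set_integrable lborel {s..t} (\<lambda>r. \<bar>b0 t r\<bar> powr (1 / \<alpha>))"
      using st by (auto intro: set_integrable_subset[OF p(1)] set_integrable_subset[OF int])
    show "norm (p r) \<le> L0 + b0 t r" if "r \<in> {s..t}" for r using p(2)[of r] that st by auto
  qed (use False st L0 B0 J in auto)
  then show ?thesis by simp
qed

text \<open>The equation is not linear, but since \<open>\<sigma>\<close> is bounded,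
  \<open>q\<close> enters the estimate only through the oscillation \<open>K * (1 + q)\<close>,
  hence affinely. Under \<open>small\<close> a constant \<open>q\<close> improves to
  \<open>1 / 2 + q / 2\<close>; starting from the given Hoelder constant, however large, the
  iteration tends to 1. The factor 2 in \<open>small\<close> is \<open>1 + q\<close> at this fixed
  point.\<close>

lemma solution_x_scaled_hoelder:
  fixes b :: "real \<Rightarrow> real \<Rightarrow> real ^ 'd \<Rightarrow> real ^ 'd"
    and \<sigma> :: "real \<Rightarrow> real \<Rightarrow> real ^ 'd \<Rightarrow> real ^ 'm ^ 'd"
    and \<alpha> \<beta> :: real
  defines "Y \<equiv> young_const (min \<beta> (1 - \<alpha>) + (1 - \<alpha>))"
  assumes T: "0 < T" and \<alpha>: "0 < \<alpha>" "\<alpha> < 1 / 2" "\<alpha> < \<beta>" and \<Lambda>: "1 \<le> \<Lambda>" and G: "0 \<le> G"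
    and \<sigma>: "H1 T \<beta> 1 \<delta> K \<sigma>" "\<And>t s y. t \<in> {0..T} \<Longrightarrow> s \<in> {0..T} \<Longrightarrow> norm (\<sigma> t s y) \<le> Sb"
    and b: "class_B0 T 1 (1 / \<alpha>) b0 L L0 b" "B_const_finite T \<alpha> b0"
    and g: "hoelder_on (1 - \<alpha>) G {0..T} g"
    and x: "solves_x T b \<sigma> g x0 x" "hoelder_on (1 - \<alpha>) c {0..T} x"
    and small: "2 * L0 + B_const T \<alpha> b0 + L * T + real CARD('d) * real CARD('m) * G *
        (Sb + 2 * (Y * K + (T + 1) * ((1 + Y) * K))) \<le> \<Lambda> powr (1 - \<alpha>) / 4"
  shows "scaled_hoelder (1 - \<alpha>) \<Lambda> 1 {0..T} x"
proof -
  define \<kappa> where "\<kappa> = 1 - \<alpha>"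
  define \<gamma> where "\<gamma> = min \<beta> \<kappa>"
  have Y_eq: "Y = young_const (\<gamma> + \<kappa>)" by (simp add: Y_def \<gamma>_def \<kappa>_def)
  have exponents: "0 < \<gamma>" "0 < \<kappa>" "\<kappa> \<le> 1" "1 < \<gamma> + \<kappa>" "\<gamma> \<le> \<beta>" "\<gamma> \<le> \<kappa>"
    using \<alpha> by (auto simp: \<gamma>_def \<kappa>_def min_def)
  have Y_nonneg: "0 \<le> Y" unfolding Y_eq by (rule young_const_ge_0[OF exponents(4)])
  have K: "0 < K" using \<sigma>(1) by (simp add: H1_def)
  have L: "0 < L" "0 < L0" using b(1) by (auto simp: class_B0_def)
  have Sb: "0 \<le> Sb" using order_trans[OF norm_ge_zero \<sigma>(2)[of 0 0]] T by auto
  have b_time: "norm (b t1 s z - b t2 s z) \<le> L * \<bar>t1 - t2\<bar>"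
    if "t1 \<in> {0..T}" "t2 \<in> {0..T}" "s \<in> {0..T}" for t1 t2 s z
  proof -
    have "\<forall>t1\<in>{0..T}. \<forall>t2\<in>{0..T}. \<forall>s\<in>{0..T}. \<forall>x. norm (b t1 s x - b t2 s x) \<le> L * \<bar>t1 - t2\<bar> powr 1"
      using b(1) unfolding class_B0_def by (elim conjE)
    from this[rule_format, OF that, of z] show ?thesis by simp
  qed
  have b_bound: "norm (b t s z) \<le> L0 + b0 t s" if "t \<in> {0..T}" "s \<in> {0..T}" for t s z
  proof -
    have "\<forall>t\<in>{0..T}. \<forall>s\<in>{0..T}. \<forall>x. norm (b t s x) \<le> L0 + b0 t s"
      using b(1) unfolding class_B0_def by (elim conjE)
    from this[rule_format, OF that] show ?thesis .
  qed
  have g': "hoelder_on \<kappa> G {0..T} (\<lambda>r. g r $ l)" for l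
    using g unfolding hoelder_on_def \<kappa>_def
    by (metis Finite_Cartesian_Product.norm_nth_le order_trans vector_minus_component)
  define D where "D = real CARD('d) * real CARD('m)"
  define V where "V = Y * K + (T + 1) * ((1 + Y) * K)"
  have V: "0 \<le> V" using Y_nonneg K T by (simp add: V_def)
  have D: "0 \<le> D" by (simp add: D_def)
  have improve: "scaled_hoelder \<kappa> \<Lambda> (1 / 2 + q / 2) {0..T} x"
    if xq: "scaled_hoelder \<kappa> \<Lambda> q {0..T} x" and q: "0 \<le> q" for q
  proof -
    have *: "norm (x t - x s) \<le> (1 / 2 + q / 2) * (\<Lambda> * (t - s)) powr \<kappa>"
      if st: "0 \<le> s" "s \<le> t" "t \<le> T" "t - s \<le> 1 / \<Lambda>" for s t
    proof -
      have t: "t \<in> {0..T}" and s: "s \<in> {0..T}" using st by auto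
      have ts: "\<bar>t - s\<bar> = t - s" using st by simp
      have "1 / \<Lambda> \<le> 1" using \<Lambda> by simp
      then have ts1: "t - s \<le> 1" using st by linarith
      have ib: "set_integrable lborel {0..\<tau>} (\<lambda>r. b \<tau> r (x r))"
        and i\<sigma>: "RS_integrable (\<lambda>r. \<sigma> \<tau> r (x r) $ i $ l) (\<lambda>r. g r $ l) 0 \<tau>"
        and eq: "x \<tau> = x0 + (LINT r:{0..\<tau>}|lborel. b \<tau> r (x r)) +
          (\<chi> i. \<Sum>l\<in>UNIV. RS_integral (\<lambda>r. \<sigma> \<tau> r (x r) $ i $ l) (\<lambda>r. g r $ l) 0 \<tau>)"
        if "\<tau> \<in> {0..T}" for \<tau> i l
        using x(1) that unfolding solves_x_def by blast+
      have path: "scaled_hoelder \<gamma> \<Lambda> (K * (1 + q)) {0..T} (\<lambda>r. \<sigma> t r (x r))"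
        "scaled_hoelder \<gamma> \<Lambda> (K * (t - s) * (1 + q)) {0..T} (\<lambda>r. \<sigma> t r (x r) - \<sigma> s r (x r))"
        using H1_along_path[OF \<sigma>(1) xq \<Lambda> exponents(5,6) q t s] unfolding ts by blast+
      define I where "I \<tau> i l = RS_integral (\<lambda>r. \<sigma> \<tau> r (x r) $ i $ l) (\<lambda>r. g r $ l) 0 \<tau>" for \<tau> i l
      have one: "\<bar>I t i l - I s i l\<bar> \<le> G * (t - s) powr \<kappa> * (Sb + (1 + q) * V)" for i l
      proof -
        have "\<bar>I t i l - I s i l\<bar> \<le> G * (t - s) powr \<kappa> *
            (Sb + young_const (\<gamma> + \<kappa>) * (K * (1 + q)) + (T + 1) * ((1 + young_const (\<gamma> + \<kappa>)) * (K * (1 + q))))"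
          unfolding I_def
        proof (rule RS_integral_increment_le[where \<Lambda> = \<Lambda>])
          show "RS_integrable (\<lambda>r. \<sigma> s r (x r) $ i $ l) (\<lambda>r. g r $ l) 0 s" by (rule i\<sigma>[OF s])
          show "\<bar>\<sigma> t r (x r) $ i $ l\<bar> \<le> Sb" if "r \<in> {0..t}" for r
          proof -
            have "norm (\<sigma> t r (x r) $ i $ l) \<le> norm (\<sigma> t r (x r))"
              by (meson Finite_Cartesian_Product.norm_nth_le order_trans)
            then show ?thesis using \<sigma>(2)[OF t, of r "x r"] that st by auto
          qed
          show "scaled_hoelder \<gamma> \<Lambda> (K * (1 + q)) {0..t} (\<lambda>r. \<sigma> t r (x r) $ i $ l)"
            using st by (intro scaled_hoelder_nth scaled_hoelder_subset[OF path(1)]) auto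
          show "\<bar>\<sigma> t r (x r) $ i $ l - \<sigma> s r (x r) $ i $ l\<bar> \<le> K * (1 + q) * (t - s)" if "r \<in> {0..s}" for r
          proof -
            have r: "r \<in> {0..T}" using that st by auto
            have "norm ((\<sigma> t r (x r) - \<sigma> s r (x r)) $ i $ l) \<le> norm (\<sigma> t r (x r) - \<sigma> s r (x r))"
              by (meson Finite_Cartesian_Product.norm_nth_le order_trans)
            also have "\<dots> \<le> K * (t - s)"
              using H1_kernel_time[OF \<sigma>(1) t s r r, of "x r"] unfolding ts .
            also have "\<dots> \<le> K * (1 + q) * (t - s)" using K q st by (intro mult_right_mono) auto
            finally show ?thesis by simp
          qed
          have "scaled_hoelder \<gamma> \<Lambda> (K * (t - s) * (1 + q)) {0..s} (\<lambda>r. (\<sigma> t r (x r) - \<sigma> s r (x r)) $ i $ l)"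
            using st by (intro scaled_hoelder_nth scaled_hoelder_subset[OF path(2)]) auto
          then show "scaled_hoelder \<gamma> \<Lambda> (K * (1 + q) * (t - s)) {0..s}
              (\<lambda>r. \<sigma> t r (x r) $ i $ l - \<sigma> s r (x r) $ i $ l)"
            by (simp add: mult_ac)
        qed (use exponents \<Lambda> Sb K q G st g' in auto)
        then show ?thesis unfolding Y_eq[symmetric] V_def by (simp add: algebra_simps)
      qed
      have "norm ((\<chi> i. \<Sum>l\<in>UNIV. I t i l) - (\<chi> i. \<Sum>l\<in>UNIV. I s i l) :: real ^ 'd)
          \<le> (\<Sum>i\<in>(UNIV :: 'd set). \<Sum>l\<in>(UNIV :: 'm set). G * (t - s) powr \<kappa> * (Sb + (1 + q) * V))"
      proof (rule order_trans[OF norm_le_l1_cart], rule sum_mono)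
        fix i :: 'd
        have "\<bar>\<Sum>l\<in>UNIV. I t i l - I s i l\<bar> \<le> (\<Sum>l\<in>(UNIV :: 'm set). G * (t - s) powr \<kappa> * (Sb + (1 + q) * V))"
          by (intro order_trans[OF sum_abs] sum_mono one)
        then show "\<bar>((\<chi> i. \<Sum>l\<in>UNIV. I t i l) - (\<chi> i. \<Sum>l\<in>UNIV. I s i l)) $ i\<bar>
            \<le> (\<Sum>l\<in>(UNIV :: 'm set). G * (t - s) powr \<kappa> * (Sb + (1 + q) * V))"
          by (simp add: sum_subtractf)
      qed
      also have "\<dots> = D * G * (Sb + (1 + q) * V) * (t - s) powr \<kappa>" by (simp add: D_def)
      finally have N1: "norm ((\<chi> i. \<Sum>l\<in>UNIV. I t i l) - (\<chi> i. \<Sum>l\<in>UNIV. I s i l) :: real ^ 'd)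
          \<le> D * G * (Sb + (1 + q) * V) * (t - s) powr \<kappa>" .
      have N2: "norm (LINT r:{s..t}|lborel. b t r (x r)) \<le> (2 * L0 + B_const T \<alpha> b0) * (t - s) powr \<kappa>"
        unfolding \<kappa>_def
        by (rule drift_x_local_le[OF _ _ st(1-3) ts1 L(2) b(2) ib[OF t]]) (use \<alpha> b_bound t in auto)
      have ibs: "set_integrable lborel {0..s} (\<lambda>r. b t r (x r))"
        using st by (intro set_integrable_subset[OF ib[OF t]]) auto
      have "norm (LINT r:{0..s}|lborel. b t r (x r) - b s r (x r)) \<le> L * (t - s) * (s - 0)"
        using b_time[OF t s] st unfolding ts
        by (intro set_integral_norm_le set_integral_diff(1)[OF ibs ib[OF s]]) auto
      also have "\<dots> \<le> L * (t - s) * T" using L st by (intro mult_left_mono) auto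
      also have "\<dots> = L * T * (t - s)" by simp
      also have "\<dots> \<le> L * T * (t - s) powr \<kappa>"
      proof (rule mult_left_mono)
        have "(t - s) powr 1 \<le> (t - s) powr \<kappa>" using st ts1 exponents by (intro powr_mono') auto
        then show "t - s \<le> (t - s) powr \<kappa>" using st by simp
      qed (use L T in auto)
      finally have N3: "norm (LINT r:{0..s}|lborel. b t r (x r) - b s r (x r)) \<le> L * T * (t - s) powr \<kappa>" .
      have "x t - x s = ((LINT r:{0..t}|lborel. b t r (x r)) - (LINT r:{0..s}|lborel. b s r (x r)))
          + ((\<chi> i. \<Sum>l\<in>UNIV. I t i l) - (\<chi> i. \<Sum>l\<in>UNIV. I s i l))"
        unfolding I_def eq[OF t] eq[OF s] by simp
      also have "\<dots> = (LINT r:{s..t}|lborel. b t r (x r)) + (LINT r:{0..s}|lborel. b t r (x r) - b s r (x r))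
          + ((\<chi> i. \<Sum>l\<in>UNIV. I t i l) - (\<chi> i. \<Sum>l\<in>UNIV. I s i l))"
        unfolding set_integral_split_diff[OF ib[OF t] ib[OF s] st(1,2)] ..
      finally have "norm (x t - x s) \<le> (2 * L0 + B_const T \<alpha> b0) * (t - s) powr \<kappa> + L * T * (t - s) powr \<kappa>
          + D * G * (Sb + (1 + q) * V) * (t - s) powr \<kappa>"
        using norm_triangle_mono[OF norm_triangle_mono[OF N2 N3] N1] by simp
      also have "\<dots> = (2 * L0 + B_const T \<alpha> b0 + L * T + D * G * (Sb + (1 + q) * V)) * (t - s) powr \<kappa>"
        by (simp add: algebra_simps)
      also have "\<dots> \<le> ((1 / 2 + q / 2) * \<Lambda> powr \<kappa>) * (t - s) powr \<kappa>"
      \<comment> \<open>Write \<open>(1 + q) * V\<close> as \<open>2 * V + (q - 1) * V\<close>. The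
        first part is covered by \<open>small\<close>, and the second costs at most
        \<open>q / 8\<close> of \<open>\<Lambda> powr \<kappa>\<close>, so the sum stays below
        \<open>1 / 2 + q / 2\<close>.\<close>
      proof (rule mult_right_mono)
        have sm: "2 * L0 + B_const T \<alpha> b0 + L * T + D * G * (Sb + 2 * V) \<le> \<Lambda> powr \<kappa> / 4"
          using small by (simp add: D_def V_def \<kappa>_def)
        have "0 \<le> 2 * L0 + B_const T \<alpha> b0 + L * T + D * G * Sb"
          using B_const_nonneg[OF b(2)] L T D G Sb by simp
        then have DV: "D * G * (2 * V) \<le> \<Lambda> powr \<kappa> / 4" using sm by (simp add: distrib_left)
        have "D * G * (Sb + (1 + q) * V) = D * G * (Sb + 2 * V) + (q - 1) / 2 * (D * G * (2 * V))"
          by (simp add: field_simps)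
        also have "\<dots> \<le> D * G * (Sb + 2 * V) + q / 2 * (D * G * (2 * V))"
          using D G V by (intro add_left_mono mult_right_mono) auto
        also have "\<dots> \<le> D * G * (Sb + 2 * V) + q / 2 * (\<Lambda> powr \<kappa> / 4)"
          using DV q by (intro add_left_mono mult_left_mono) auto
        finally have "2 * L0 + B_const T \<alpha> b0 + L * T + D * G * (Sb + (1 + q) * V)
            \<le> \<Lambda> powr \<kappa> / 4 + q / 2 * (\<Lambda> powr \<kappa> / 4)" using sm by linarith
        also have "\<dots> \<le> (1 / 2 + q / 2) * \<Lambda> powr \<kappa>"
        proof -
          have "0 \<le> q * \<Lambda> powr \<kappa>" "0 \<le> \<Lambda> powr \<kappa>" using q by simp_all
          moreover have "(1 / 2 + q / 2) * \<Lambda> powr \<kappa> = \<Lambda> powr \<kappa> / 2 + (q * \<Lambda> powr \<kappa>) / 2"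
            by (simp add: distrib_right)
          moreover have "q / 2 * (\<Lambda> powr \<kappa> / 4) = (q * \<Lambda> powr \<kappa>) / 8" by simp
          ultimately show ?thesis by linarith
        qed
        finally show "2 * L0 + B_const T \<alpha> b0 + L * T + D * G * (Sb + (1 + q) * V)
            \<le> (1 / 2 + q / 2) * \<Lambda> powr \<kappa>" .
      qed simp
      also have "\<dots> = (1 / 2 + q / 2) * (\<Lambda> * (t - s)) powr \<kappa>" using \<Lambda> st by (simp add: powr_mult)
      finally show ?thesis .
    qed
    show ?thesis
      unfolding scaled_hoelder_def
    proof (intro ballI impI)
      fix s t assume "s \<in> {0..T}" "t \<in> {0..T}" "\<bar>t - s\<bar> \<le> 1 / \<Lambda>"
      then show "norm (x t - x s) \<le> (1 / 2 + q / 2) * (\<Lambda> * \<bar>t - s\<bar>) powr \<kappa>"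
        using *[of s t] *[of t s] by (cases "s \<le> t") (auto simp: norm_minus_commute abs_if)
    qed
  qed
  have iter: "scaled_hoelder \<kappa> \<Lambda> (1 + \<bar>c\<bar> / 2 ^ n) {0..T} x" for n
  proof (induction n)
    case 0
    show ?case
      unfolding scaled_hoelder_def
    proof (intro ballI impI)
      fix s t assume st: "s \<in> {0..T}" "t \<in> {0..T}" "\<bar>t - s\<bar> \<le> 1 / \<Lambda>"
      have "norm (x t - x s) \<le> c * \<bar>t - s\<bar> powr \<kappa>" using hoelder_onD[OF x(2) st(1,2)] by (simp add: \<kappa>_def)
      also have "\<dots> \<le> (1 + \<bar>c\<bar> / 2 ^ 0) * (\<Lambda> * \<bar>t - s\<bar>) powr \<kappa>"
      proof (rule mult_mono)
        show "\<bar>t - s\<bar> powr \<kappa> \<le> (\<Lambda> * \<bar>t - s\<bar>) powr \<kappa>"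
          using \<Lambda> exponents mult_right_mono[of 1 \<Lambda> "\<bar>t - s\<bar>"] by (intro powr_mono2) auto
      qed auto
      finally show "norm (x t - x s) \<le> (1 + \<bar>c\<bar> / 2 ^ 0) * (\<Lambda> * \<bar>t - s\<bar>) powr \<kappa>" .
    qed
  next
    case (Suc n)
    have "scaled_hoelder \<kappa> \<Lambda> (1 / 2 + (1 + \<bar>c\<bar> / 2 ^ n) / 2) {0..T} x"
      by (rule improve[OF Suc]) simp
    moreover have "1 / 2 + (1 + \<bar>c\<bar> / 2 ^ n) / 2 = 1 + \<bar>c\<bar> / 2 ^ Suc n"
      by (simp add: add_divide_distrib mult.commute)
    ultimately show ?case by simp
  qed
  have lim: "(\<lambda>n. (1 + \<bar>c\<bar> / 2 ^ n) * a) \<longlonglongrightarrow> 1 * a" for a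
    by (intro tendsto_intros halving_tendsto)
  show ?thesis
    unfolding scaled_hoelder_def \<kappa>_def[symmetric]
  proof (intro ballI impI)
    fix s t assume st: "s \<in> {0..T}" "t \<in> {0..T}" "\<bar>t - s\<bar> \<le> 1 / \<Lambda>"
    show "norm (x t - x s) \<le> 1 * (\<Lambda> * \<bar>t - s\<bar>) powr \<kappa>"
      by (rule LIMSEQ_le_const[OF lim]) (use scaled_hoelderD[OF iter st] in blast)
  qed
qed

section \<open>Passage between Hoelder norms and a given scale\<close>

lemma le_powr_if_root_le:
  fixes m :: real
  assumes "0 \<le> m" "0 < \<kappa>" "m powr (1 / \<kappa>) \<le> \<Lambda>"
  shows "m \<le> \<Lambda> powr \<kappa>"
proof -
  have "(m powr (1 / \<kappa>)) powr \<kappa> \<le> \<Lambda> powr \<kappa>" using assms by (intro powr_mono2) auto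
  then show ?thesis using assms by (simp add: powr_powr)
qed

lemma scaled_hoelder_if_hoelder_on:
  assumes "hoelder_on \<gamma> c S p" "c \<le> q * \<Lambda> powr \<gamma>" "0 < \<Lambda>"
  shows "scaled_hoelder \<gamma> \<Lambda> q S p"
  unfolding scaled_hoelder_def
proof (intro ballI impI)
  fix s t assume st: "s \<in> S" "t \<in> S"
  have "norm (p t - p s) \<le> c * \<bar>t - s\<bar> powr \<gamma>" by (rule hoelder_onD[OF assms(1) st])
  also have "\<dots> \<le> q * \<Lambda> powr \<gamma> * \<bar>t - s\<bar> powr \<gamma>" using assms(2) by (intro mult_right_mono) auto
  finally show "norm (p t - p s) \<le> q * (\<Lambda> * \<bar>t - s\<bar>) powr \<gamma>"
    using assms(3) by (simp add: powr_mult)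
qed

context linear_young
begin

text \<open>Since \<open>\<Lambda> \<ge> 1\<close> and the weight is at least 1, every Hoelder
  function lies in some ball, at whatever scale. Hence uniqueness holds in the whole Hoelder space,
  and a solution found at one scale can be estimated at another.\<close>

lemma hoelder_space_imp_controlled:
  assumes "u \<in> hoelder_space \<kappa> T"
  obtains B where "controlled B u" "0 \<le> B"
proof -
  have u: "bdd_above (hoelder_quotients \<kappa> T u)" "bounded (u ` {0..T})"
    using assms by (auto simp: hoelder_space_def)
  let ?c = "Sup (hoelder_quotients \<kappa> T u)"
  have c: "0 \<le> ?c" by (rule hoelder_quotients_Sup_nonneg[OF u(1) T])
  have s: "0 \<le> sup_norm T u" using order_trans[OF norm_ge_zero sup_norm_upper[OF u(2), of 0]] T by simp
  have "1 \<le> \<Lambda> powr \<kappa>" using \<Lambda> exponents by (simp add: ge_one_powr_ge_zero)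
  then have "?c \<le> (sup_norm T u + ?c) * \<Lambda> powr \<kappa>"
    using mult_left_mono[of 1 "\<Lambda> powr \<kappa>" "sup_norm T u + ?c"] c s by simp
  then have "controlled (sup_norm T u + ?c) u"
    using c s sup_norm_upper[OF u(2)]
    by (intro controlled_if_hoelder_on[OF hoelder_on_Sup[OF u(1)]]) (auto intro: add_increasing2)
  then show thesis by (rule that) (use c s in simp)
qed

lemma controlled_imp_hoelder_space:
  assumes "controlled B u" "0 \<le> B"
  shows "u \<in> hoelder_space \<kappa> T"
  by (rule hoelder_spaceI[OF controlled_hoelder_on[OF assms]])
    (rule bounded_if_hoelder_on[OF controlled_hoelder_on[OF assms] exponents(2)])

end

text \<open>The order of quantifiers lets \<open>C\<close> depend on \<open>\<alpha>\<close>,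
  \<open>\<beta>\<close>, \<open>K\<close> and, through the types, on both dimensions, but not on
  \<open>T\<close>, \<open>\<delta>\<close> or any of the functions. Uniqueness means equality on
  \<open>{0..T}\<close>, as functions are total. Finiteness of the constant of \<open>b0\<close> is
  a premise of the bound only.\<close>

theorem theorem3p6:
  fixes \<alpha> \<beta> K :: real
  shows "\<exists>C>0. \<forall>(T::real) (\<delta>::real)
      (b :: real \<Rightarrow> real \<Rightarrow> real ^ 'd \<Rightarrow> real ^ 'd)
      (\<sigma> :: real \<Rightarrow> real \<Rightarrow> real ^ 'd \<Rightarrow> real ^ 'm ^ 'd)
      (h :: real \<Rightarrow> real \<Rightarrow> real ^ 'd \<Rightarrow> real ^ 'd ^ 'd)
      (f :: real \<Rightarrow> real \<Rightarrow> real ^ 'd \<Rightarrow> real ^ 'm ^ 'd ^ 'd)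
      (w :: real \<Rightarrow> real ^ 'd) (x0 :: real ^ 'd) (g :: real \<Rightarrow> real ^ 'm)
      (b0 :: real \<Rightarrow> real \<Rightarrow> real) (L::real) (L0::real) (x :: real \<Rightarrow> real ^ 'd).
    0 < T \<and> 0 < \<beta> \<and> \<beta> \<le> 1 \<and> 0 < \<delta> \<and> \<delta> \<le> 1 \<and>
    0 < \<alpha> \<and> \<alpha> < Min {1 / 2, \<beta>, \<delta> / (1 + \<delta>)} \<and>
    bounded3 T \<sigma> \<and> H1 T \<beta> 1 \<delta> K \<sigma> \<and>
    class_B0 T 1 (1 / \<alpha>) b0 L L0 b \<and>
    measurable3 T h \<and> bounded3 T h \<and>
    (\<forall>s\<in>{0..T}. \<forall>y. L-lipschitz_on {0..T} (\<lambda>t. h t s y)) \<and>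
    bounded3 T f \<and> H1 T \<beta> 1 \<delta> K f \<and>
    w \<in> hoelder_space (1 - \<alpha>) T \<and> K-lipschitz_on {0..T} w \<and> bounded (w ` {0..T}) \<and>
    g \<in> W2_space \<alpha> T \<and>
    x \<in> hoelder_space (1 - \<alpha>) T \<and> solves_x T b \<sigma> g x0 x
    \<longrightarrow>
    (\<exists>z \<in> hoelder_space (1 - \<alpha>) T.
       solves_z T h f g w x z \<and>
       (\<forall>z' \<in> hoelder_space (1 - \<alpha>) T. solves_z T h f g w x z' \<longrightarrow> (\<forall>t\<in>{0..T}. z' t = z t)) \<and>
       (B_const_finite T \<alpha> b0 \<longrightarrow>
         (let K5 = 16 * (K + sup_norm3 T h + L + L0 + B_const T \<alpha> b0) * exp T * (T + 1);
              K6 = C * (sup_norm3 T f + sup_norm3 T \<sigma> + 1) * exp T * (T + 1)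
          in sup_norm T z \<le> 2 * (1 + sup_norm T w) *
               exp (max (T * (K5 + K6 * hoelder_norm (1 - \<alpha>) T g) powr (1 / (1 - \<alpha>)))
                        (max 1 T)))))"
proof -
  define Y where "Y = young_const (min \<beta> (1 - \<alpha>) + (1 - \<alpha>))"
  define D where "D = real CARD('d) * real CARD('d) * real CARD('m)"
  \<comment> \<open>The factor \<open>1 + 5 * \<bar>K\<bar>\<close>, multiplied by the norms of
    \<open>f\<close> and \<open>\<sigma>\<close> plus 1, dominates both \<open>Fb + 5 * K\<close>
    and \<open>Sb + 4 * K\<close>, which arise in the two smallness conditions. Absolute values make
    \<open>C\<close> positive before anything is known about \<open>Y\<close> and
    \<open>K\<close>.\<close>
  define C where "C = 8 * D * (1 + \<bar>Y\<bar>) * (1 + 5 * \<bar>K\<bar>)"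
  have D: "0 < D" by (simp add: D_def)
  have C: "0 < C" using D by (simp add: C_def add_pos_nonneg)
  show ?thesis
  proof (intro exI[of _ C] conjI C allI impI, elim conjE)
    fix T \<delta> :: real
      and b :: "real \<Rightarrow> real \<Rightarrow> real ^ 'd \<Rightarrow> real ^ 'd"
      and \<sigma> :: "real \<Rightarrow> real \<Rightarrow> real ^ 'd \<Rightarrow> real ^ 'm ^ 'd"
      and h :: "real \<Rightarrow> real \<Rightarrow> real ^ 'd \<Rightarrow> real ^ 'd ^ 'd"
      and f :: "real \<Rightarrow> real \<Rightarrow> real ^ 'd \<Rightarrow> real ^ 'm ^ 'd ^ 'd"
      and w :: "real \<Rightarrow> real ^ 'd" and x0 :: "real ^ 'd" and g :: "real \<Rightarrow> real ^ 'm"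
      and b0 :: "real \<Rightarrow> real \<Rightarrow> real" and L L0 :: real and x :: "real \<Rightarrow> real ^ 'd"
    assume T: "0 < T" and \<alpha>0: "0 < \<alpha>" and \<alpha>_less: "\<alpha> < Min {1 / 2, \<beta>, \<delta> / (1 + \<delta>)}"
      and \<sigma>: "bounded3 T \<sigma>" "H1 T \<beta> 1 \<delta> K \<sigma>" and b: "class_B0 T 1 (1 / \<alpha>) b0 L L0 b"
      and h: "measurable3 T h" "bounded3 T h" "\<forall>s\<in>{0..T}. \<forall>y. L-lipschitz_on {0..T} (\<lambda>t. h t s y)"
      and f: "bounded3 T f" "H1 T \<beta> 1 \<delta> K f"
      and w: "w \<in> hoelder_space (1 - \<alpha>) T" "K-lipschitz_on {0..T} w" "bounded (w ` {0..T})"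
      and g: "g \<in> W2_space \<alpha> T"
      and x: "x \<in> hoelder_space (1 - \<alpha>) T" "solves_x T b \<sigma> g x0 x"
    define \<kappa> where "\<kappa> = 1 - \<alpha>"
    have \<alpha>: "0 < \<alpha>" "\<alpha> < 1 / 2" "\<alpha> < \<beta>" using \<alpha>0 \<alpha>_less by auto
    have \<kappa>: "0 < \<kappa>" "\<kappa> \<le> 1" using \<alpha> by (auto simp: \<kappa>_def)
    have K: "0 < K" using f(2) by (simp add: H1_def)
    have L: "0 < L" "0 < L0" using b by (auto simp: class_B0_def)
    have Y: "0 \<le> Y" unfolding Y_def using \<alpha> by (intro young_const_ge_0) (auto simp: min_def)
    define G where "G = Sup (hoelder_quotients \<kappa> T g)"
    have g_bdd: "bdd_above (hoelder_quotients \<kappa> T g)"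
      unfolding \<kappa>_def by (rule W2_space_imp_bdd_above[OF g])
    have g_hoelder: "hoelder_on \<kappa> G {0..T} g" unfolding G_def by (rule hoelder_on_Sup[OF g_bdd])
    have G: "0 \<le> G" unfolding G_def by (rule hoelder_quotients_Sup_nonneg[OF g_bdd T])
    define Ng where "Ng = hoelder_norm (1 - \<alpha>) T g"
    have GN: "G \<le> Ng"
    proof -
      have "0 \<le> sup_norm T g"
        using order_trans[OF norm_ge_zero sup_norm_upper[OF bounded_if_hoelder_on[OF g_hoelder \<kappa>(1)], of 0]] T by simp
      then show ?thesis by (simp add: Ng_def hoelder_norm_def G_def \<kappa>_def)
    qed
    define Fb where "Fb = sup_norm3 T f"
    define Sb where "Sb = sup_norm3 T \<sigma>"
    define Hb where "Hb = sup_norm3 T h"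
    have f_le: "norm (f t s y) \<le> Fb" and \<sigma>_le: "norm (\<sigma> t s y) \<le> Sb" and h_le: "norm (h t s y) \<le> Hb"
      if "t \<in> {0..T}" "s \<in> {0..T}" for t s y
      unfolding Fb_def Sb_def Hb_def using that by (auto intro: sup_norm3_upper f \<sigma> h)
    have nonneg: "0 \<le> Fb" "0 \<le> Sb" "0 \<le> Hb"
      using order_trans[OF norm_ge_zero f_le[of 0 0]] order_trans[OF norm_ge_zero \<sigma>_le[of 0 0]]
        order_trans[OF norm_ge_zero h_le[of 0 0]] T by auto
    define cx where "cx = Sup (hoelder_quotients \<kappa> T x)"
    have x_bdd: "bdd_above (hoelder_quotients \<kappa> T x)" using x(1) by (simp add: hoelder_space_def \<kappa>_def)
    have x_hoelder: "hoelder_on \<kappa> cx {0..T} x" unfolding cx_def by (rule hoelder_on_Sup[OF x_bdd])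
    \<comment> \<open>The left side of \<open>small\<close> in \<open>linear_young\<close>.\<close>
    define R where "R = Hb + L * T + D * G * (Fb + Y * (Fb + 2 * K) + (T + 1) * ((1 + Y) * (3 * K)))"
    have linear: "linear_young T \<alpha> \<beta> \<delta> K L G \<Lambda> Hb Fb h f g x"
      if "1 \<le> \<Lambda>" "scaled_hoelder \<kappa> \<Lambda> 1 {0..T} x" "R \<le> \<Lambda> powr \<kappa> / 4" for \<Lambda>
    proof
      show "continuous_on {0..T} x" by (rule hoelder_on_imp_continuous_on[OF x_hoelder \<kappa>(1)])
      show "norm (h t s y - h t' s y) \<le> L * \<bar>t - t'\<bar>"
        if "t \<in> {0..T}" "t' \<in> {0..T}" "s \<in> {0..T}" for t t' s y
        using lipschitz_onD[of L "{0..T}" "\<lambda>t. h t s y" t t'] h(3) that by (simp add: dist_norm)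
    qed (use T \<alpha> L G f h f_le h_le g_hoelder that in \<open>auto simp: \<kappa>_def R_def D_def Y_def\<close>)
    show "\<exists>z\<in>hoelder_space (1 - \<alpha>) T. solves_z T h f g w x z \<and>
        (\<forall>z'\<in>hoelder_space (1 - \<alpha>) T. solves_z T h f g w x z' \<longrightarrow> (\<forall>t\<in>{0..T}. z' t = z t)) \<and>
        (B_const_finite T \<alpha> b0 \<longrightarrow>
         (let K5 = 16 * (K + sup_norm3 T h + L + L0 + B_const T \<alpha> b0) * exp T * (T + 1);
              K6 = C * (sup_norm3 T f + sup_norm3 T \<sigma> + 1) * exp T * (T + 1)
          in sup_norm T z \<le> 2 * (1 + sup_norm T w) *
               exp (max (T * (K5 + K6 * hoelder_norm (1 - \<alpha>) T g) powr (1 / (1 - \<alpha>))) (max 1 T))))"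
    proof -
      \<comment> \<open>For existence the scale may depend on the Hoelder constant \<open>cx\<close>
        of \<open>x\<close>, which makes the condition on \<open>x\<close> immediate and involves no
        constant of \<open>b0\<close>.\<close>
      define m where "m = max 0 (max cx (4 * R))"
      define \<Lambda> where "\<Lambda> = max 1 (m powr (1 / \<kappa>))"
      have \<Lambda>: "1 \<le> \<Lambda>" by (simp add: \<Lambda>_def)
      have m: "m \<le> \<Lambda> powr \<kappa>" by (rule le_powr_if_root_le[OF _ \<kappa>(1)]) (auto simp: m_def \<Lambda>_def)
      have "scaled_hoelder \<kappa> \<Lambda> 1 {0..T} x"
        using m \<Lambda> by (intro scaled_hoelder_if_hoelder_on[OF x_hoelder]) (auto simp: m_def)
      then interpret E: linear_young T \<alpha> \<beta> \<delta> K L G \<Lambda> Hb Fb h f g x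
        using m \<Lambda> by (intro linear) (auto simp: m_def)
      obtain W where W: "E.controlled W w" "0 \<le> W" using E.hoelder_space_imp_controlled[OF w(1)] .
      obtain z where z: "E.controlled (2 * W) z" and "\<forall>t\<in>{0..T}. z t = w t + E.volterra z t"
        using E.solution_exists[OF W] .
      then have z_eq: "z t = w t + E.volterra z t" if "t \<in> {0..T}" for t using that by blast
      have W2: "0 \<le> 2 * W" using W by simp
      have z_space: "z \<in> hoelder_space (1 - \<alpha>) T" by (rule E.controlled_imp_hoelder_space[OF z W2])
      have z_solves: "solves_z T h f g w x z" using E.solves_z_iff[OF z W2] z_eq by blast
      have unique: "z' t = z t" if z': "z' \<in> hoelder_space (1 - \<alpha>) T" "solves_z T h f g w x z'" and t: "t \<in> {0..T}" for z' t
      proof -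
        obtain B where B: "E.controlled B z'" "0 \<le> B" using E.hoelder_space_imp_controlled[OF z'(1)] .
        show ?thesis using E.solution_unique[OF z W2 B z_eq _ t] E.solves_z_iff[OF B] z'(2) by blast
      qed
      have bound: "sup_norm T z \<le> 2 * (1 + sup_norm T w) *
               exp (max (T * (K5 + K6 * Ng) powr (1 / (1 - \<alpha>))) (max 1 T))"
        if fin: "B_const_finite T \<alpha> b0"
          and K5: "K5 = 16 * (K + Hb + L + L0 + B_const T \<alpha> b0) * exp T * (T + 1)"
          and K6: "K6 = C * (Fb + Sb + 1) * exp T * (T + 1)" for K5 K6
      proof -
        define Bc where "Bc = B_const T \<alpha> b0"
        have Bc: "0 \<le> Bc" unfolding Bc_def by (rule B_const_nonneg[OF fin]) (use T in simp)
        have N: "0 \<le> Ng" using G GN by simp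
        \<comment> \<open>\<open>P\<close> collects the drift terms and the Lipschitz constant of
          \<open>w\<close>, \<open>Q\<close> the terms with \<open>g\<close>. Each smallness
          condition has a left side of at most \<open>2 * P + Q\<close>, so
          \<open>16 * P + 8 * Q\<close> below \<open>\<Lambda>' powr \<kappa>\<close> gives the
          required quarter.\<close>
        define P where "P = (T + 1) * (K + Hb + L + L0 + Bc)"
        define Q where "Q = D * (1 + Y) * (T + 1) * (Fb + Sb + 1) * (1 + 5 * K) * Ng"
        have PQ: "0 \<le> P" "0 \<le> Q"
          using T K L Bc nonneg D Y N by (auto simp: P_def Q_def intro!: mult_nonneg_nonneg)
        have "16 * P \<le> K5"
        proof -
          have "16 * P * 1 \<le> 16 * P * exp T" using PQ T by (intro mult_left_mono) auto
          then show ?thesis by (simp add: K5 P_def Bc_def mult_ac)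
        qed
        moreover have "8 * Q \<le> K6 * Ng"
        proof -
          have "8 * Q * 1 \<le> 8 * Q * exp T" using PQ T by (intro mult_left_mono) auto
          also have "8 * Q * exp T = K6 * Ng"
            unfolding K6 C_def Q_def abs_of_nonneg[OF Y] abs_of_pos[OF K] by (simp only: mult_ac)
          finally show ?thesis by simp
        qed
        ultimately have PQ_le: "16 * P + 8 * Q \<le> K5 + K6 * Ng" by simp
        \<comment> \<open>The second scale, given by the data alone and matched to the exponent in
          the assertion.\<close>
        define \<Lambda>' where "\<Lambda>' = max 1 ((K5 + K6 * Ng) powr (1 / \<kappa>))"
        have \<Lambda>': "1 \<le> \<Lambda>'" by (simp add: \<Lambda>'_def)
        have "K5 + K6 * Ng \<le> \<Lambda>' powr \<kappa>"
          by (rule le_powr_if_root_le[OF _ \<kappa>(1)]) (use PQ PQ_le in \<open>auto simp: \<Lambda>'_def\<close>)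
        with PQ_le have PQ': "16 * P + 8 * Q \<le> \<Lambda>' powr \<kappa>" by simp
        have Q_ge: "D * G * ((T + 1) * ((1 + Y) * ((Fb + Sb + 1) * (1 + 5 * K)))) \<le> Q"
        proof -
          have "(D * ((T + 1) * ((1 + Y) * ((Fb + Sb + 1) * (1 + 5 * K))))) * G
              \<le> (D * ((T + 1) * ((1 + Y) * ((Fb + Sb + 1) * (1 + 5 * K))))) * Ng"
            using GN D T Y nonneg K by (intro mult_left_mono) auto
          then show ?thesis by (simp add: Q_def mult_ac)
        qed
        have T1: "a \<le> (T + 1) * a" if "0 \<le> a" for a :: real using that T by (simp add: distrib_right)
        have Y1: "a \<le> (1 + Y) * a" "Y * a \<le> (1 + Y) * a" if "0 \<le> a" for a :: real
          using that Y by (auto simp: distrib_right)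
        have prod_ge: "Fb + 5 * K \<le> (Fb + Sb + 1) * (1 + 5 * K)" "Sb + 4 * K \<le> (Fb + Sb + 1) * (1 + 5 * K)"
        proof -
          have "(Fb + Sb + 1) * (1 + 5 * K) = Fb + Sb + 1 + 5 * K + (Fb + Sb) * (5 * K)"
            by (simp add: algebra_simps)
          moreover have "0 \<le> (Fb + Sb) * (5 * K)" using nonneg K by simp
          ultimately show "Fb + 5 * K \<le> (Fb + Sb + 1) * (1 + 5 * K)" "Sb + 4 * K \<le> (Fb + Sb + 1) * (1 + 5 * K)"
            using nonneg K by linarith+
        qed
        have R_le: "R \<le> \<Lambda>' powr \<kappa> / 4"
        proof -
          have "Fb + Y * (Fb + 2 * K) + (T + 1) * ((1 + Y) * (3 * K)) \<le> (T + 1) * ((1 + Y) * (Fb + 5 * K))"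
          proof -
            have "Fb + Y * (Fb + 2 * K) \<le> (1 + Y) * (Fb + 2 * K)" using K by (simp add: distrib_right)
            also have "\<dots> \<le> (T + 1) * ((1 + Y) * (Fb + 2 * K))" using Y nonneg K by (intro T1) simp
            finally show ?thesis by (simp add: algebra_simps)
          qed
          also have "\<dots> \<le> (T + 1) * ((1 + Y) * ((Fb + Sb + 1) * (1 + 5 * K)))"
            using T Y prod_ge(1) by (intro mult_left_mono) auto
          finally have "D * G * (Fb + Y * (Fb + 2 * K) + (T + 1) * ((1 + Y) * (3 * K))) \<le> Q"
            using D G by (intro order_trans[OF mult_left_mono Q_ge]) auto
          moreover have "Hb + L * T \<le> P"
          proof -
            have "Hb + L * T \<le> (T + 1) * (Hb + L)" using T L nonneg by (simp add: algebra_simps)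
            also have "\<dots> \<le> P" unfolding P_def using T K L Bc by (intro mult_left_mono) auto
            finally show ?thesis .
          qed
          ultimately show ?thesis unfolding R_def using PQ PQ' by linarith
        qed
        have x_scaled: "scaled_hoelder (1 - \<alpha>) \<Lambda>' 1 {0..T} x"
        proof (rule solution_x_scaled_hoelder[OF T \<alpha> \<Lambda>' G \<sigma>(2) \<sigma>_le b fin _ x(2)])
          show "hoelder_on (1 - \<alpha>) G {0..T} g" "hoelder_on (1 - \<alpha>) cx {0..T} x"
            using g_hoelder x_hoelder by (simp_all add: \<kappa>_def)
          have "Sb + 2 * (Y * K + (T + 1) * ((1 + Y) * K)) \<le> (T + 1) * ((1 + Y) * (Sb + 4 * K))"
          proof -
            have "Y * K \<le> (T + 1) * ((1 + Y) * K)"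
              by (rule order_trans[OF Y1(2) T1]) (use K Y in auto)
            moreover have "Sb \<le> (T + 1) * ((1 + Y) * Sb)"
              by (rule order_trans[OF Y1(1) T1]) (use nonneg Y in auto)
            ultimately show ?thesis by (simp add: algebra_simps)
          qed
          also have "\<dots> \<le> (T + 1) * ((1 + Y) * ((Fb + Sb + 1) * (1 + 5 * K)))"
            using T Y prod_ge(2) by (intro mult_left_mono) auto
          finally have "D * G * (Sb + 2 * (Y * K + (T + 1) * ((1 + Y) * K))) \<le> Q"
            using D G by (intro order_trans[OF mult_left_mono Q_ge]) auto
          moreover have "real CARD('d) * real CARD('m) * G * (Sb + 2 * (Y * K + (T + 1) * ((1 + Y) * K)))
              \<le> D * G * (Sb + 2 * (Y * K + (T + 1) * ((1 + Y) * K)))"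
          proof (intro mult_right_mono)
            have "1 * (real CARD('d) * real CARD('m)) \<le> real CARD('d) * (real CARD('d) * real CARD('m))"
              by (intro mult_right_mono) (auto simp: Suc_leI)
            then show "real CARD('d) * real CARD('m) \<le> D" by (simp add: D_def)
          qed (use G nonneg Y T K in auto)
          moreover have "2 * L0 + Bc + L * T \<le> 2 * P"
          proof -
            have "2 * L0 + Bc + L * T \<le> 2 * ((T + 1) * (L + L0 + Bc))"
              using T L Bc by (simp add: algebra_simps add_nonneg_nonneg)
            also have "\<dots> \<le> 2 * P" unfolding P_def using T K L nonneg by (intro mult_left_mono) auto
            finally show ?thesis .
          qed
          ultimately have "2 * L0 + Bc + L * T + real CARD('d) * real CARD('m) * G *
              (Sb + 2 * (Y * K + (T + 1) * ((1 + Y) * K))) \<le> \<Lambda>' powr \<kappa> / 4"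
            using PQ PQ' by linarith
          then show "2 * L0 + B_const T \<alpha> b0 + L * T + real CARD('d) * real CARD('m) * G *
              (Sb + 2 * (young_const (min \<beta> (1 - \<alpha>) + (1 - \<alpha>)) * K
                + (T + 1) * ((1 + young_const (min \<beta> (1 - \<alpha>) + (1 - \<alpha>))) * K))) \<le> \<Lambda>' powr (1 - \<alpha>) / 4"
            by (simp add: Bc_def Y_def \<kappa>_def)
        qed
        interpret S: linear_young T \<alpha> \<beta> \<delta> K L G \<Lambda>' Hb Fb h f g x
          using x_scaled by (intro linear \<Lambda>' R_le) (simp add: \<kappa>_def)
        have w_sup: "norm (w t) \<le> sup_norm T w" if "t \<in> {0..T}" for t by (rule sup_norm_upper[OF w(3) that])
        have w0: "0 \<le> sup_norm T w" using order_trans[OF norm_ge_zero w_sup[of 0]] T by simp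
        \<comment> \<open>The 1 in \<open>1 + sup_norm T w\<close> pays for the increments: those of
          \<open>w\<close> are at most \<open>K * (t - s)\<close>, and
          \<open>K \<le> \<Lambda>' powr \<kappa>\<close>.\<close>
        have wc: "S.controlled (1 + sup_norm T w) w"
        proof (rule S.controlledI)
          show "norm (w t) \<le> (1 + sup_norm T w) * S.growth t" if "t \<in> {0..T}" for t
          proof (rule order_trans)
            show "norm (w t) \<le> (1 + sup_norm T w) * 1" using w_sup[OF that] by simp
            show "(1 + sup_norm T w) * 1 \<le> (1 + sup_norm T w) * S.growth t"
              using S.growth_ge_1[of t] that w0 by (intro mult_left_mono) auto
          qed
          fix s t :: real assume st: "0 \<le> s" "s \<le> t" "t \<le> T" "t - s \<le> 1 / \<Lambda>'"
          have "1 / \<Lambda>' \<le> 1" using \<Lambda>' by simp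
          then have ts1: "t - s \<le> 1" using st by linarith
          have "norm (w t - w s) \<le> K * (t - s)"
            using lipschitz_onD[OF w(2), of t s] st by (simp add: dist_norm)
          also have "\<dots> \<le> \<Lambda>' powr \<kappa> * (t - s) powr \<kappa>"
          proof (rule mult_mono)
            have "K \<le> P"
            proof -
              have "K \<le> (T + 1) * K" using K by (intro T1) simp
              also have "\<dots> \<le> P" unfolding P_def using T L nonneg Bc by (intro mult_left_mono) auto
              finally show ?thesis .
            qed
            then show "K \<le> \<Lambda>' powr \<kappa>" using PQ PQ' by linarith
            have "(t - s) powr 1 \<le> (t - s) powr \<kappa>" using st ts1 \<kappa> by (intro powr_mono') auto
            then show "t - s \<le> (t - s) powr \<kappa>" using st by simp
          qed (use st in auto)
          also have "\<dots> = 1 * (\<Lambda>' * (t - s)) powr \<kappa>" using \<Lambda>' st by (simp add: powr_mult)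
          also have "\<dots> \<le> ((1 + sup_norm T w) * S.growth t) * (\<Lambda>' * (t - s)) powr \<kappa>"
          proof (rule mult_right_mono)
            show "1 \<le> (1 + sup_norm T w) * S.growth t"
              using S.growth_ge_1[of t] st w0 mult_mono[of 1 "1 + sup_norm T w" 1 "S.growth t"] by simp
          qed simp
          finally show "norm (w t - w s) \<le> (1 + sup_norm T w) * S.growth t * (\<Lambda>' * (t - s)) powr (1 - \<alpha>)"
            by (simp add: \<kappa>_def)
        qed (use w0 in simp)
        \<comment> \<open>\<open>z\<close> was constructed at the scale \<open>\<Lambda>\<close>. At
          \<open>\<Lambda>'\<close> it has some radius \<open>B\<close>, which
          \<open>solution_controlled\<close> replaces by the explicit one.\<close>
        obtain B where B: "S.controlled B z" "0 \<le> B" using S.hoelder_space_imp_controlled[OF z_space] .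
        have "S.controlled (2 * (1 + sup_norm T w)) z"
          using S.solution_controlled[OF wc _ B] S.solves_z_iff[OF B] z_solves w0 by simp
        then have z_le: "norm (z t) \<le> 2 * (1 + sup_norm T w) * S.growth t" if "t \<in> {0..T}" for t
          by (rule S.controlled_norm[OF _ that])
        have growth_le: "S.growth t \<le> exp (max (T * (K5 + K6 * Ng) powr (1 / (1 - \<alpha>))) (max 1 T))"
          if "t \<in> {0..T}" for t
        proof -
          have "\<Lambda>' * t \<le> \<Lambda>' * T" using that \<Lambda>' by (intro mult_left_mono) auto
          \<comment> \<open>If the root is at most 1, then \<open>\<Lambda>' = 1\<close> and the
            exponent is \<open>T\<close>; otherwise it is the first entry of the maximum.\<close>
          also have "\<dots> \<le> max (T * (K5 + K6 * Ng) powr (1 / (1 - \<alpha>))) (max 1 T)"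
            by (cases "(K5 + K6 * Ng) powr (1 / (1 - \<alpha>)) \<le> 1")
              (simp_all add: \<Lambda>'_def \<kappa>_def le_max_iff_disj mult.commute)
          finally show ?thesis by (simp add: S.growth_def)
        qed
        show ?thesis
          unfolding sup_norm_def[of T z]
        proof (rule cSUP_least)
          fix t assume t: "t \<in> {0..T}"
          have "2 * (1 + sup_norm T w) * S.growth t
              \<le> 2 * (1 + sup_norm T w) * exp (max (T * (K5 + K6 * Ng) powr (1 / (1 - \<alpha>))) (max 1 T))"
            using growth_le[OF t] w0 by (intro mult_left_mono) auto
          with z_le[OF t] show "norm (z t)
              \<le> 2 * (1 + sup_norm T w) * exp (max (T * (K5 + K6 * Ng) powr (1 / (1 - \<alpha>))) (max 1 T))"
            by linarith
        qed (use T in auto)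
      qed
      show ?thesis
        unfolding Let_def
        using z_space z_solves unique bound[OF _ refl refl, unfolded Hb_def Fb_def Sb_def Ng_def]
        by blast
    qed
  qed
qed

end
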